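(* Let $p$ be a polynomial in two complex variables with $p(z)\neq 0$ for all $z\in\mathbb{D}^2$, and let $b_1 = \tilde{p}/p$ be the corresponding rational inner function on $\mathbb{D}^2$, assumed non-constant. Let $\alpha\in\mathbb{T}$, let $\sigma^1=\sigma_\alpha[b_1]$, and let $\sigma^1=\sigma^1_0+\sigma^1_1+\sigma^1_2$ be the decomposition of the pluriharmonic measure $\sigma^1$ described in the context. Then there is a set $N\subset\mathbb{T}^2$ which is a null set for $A(\mathbb{D}^2)^\perp$ and which is a carrier of $\sigma^1_0$. Consequently, for every non-constant holomorphic function $b_2:\mathbb{D}^2\to\mathbb{D}$, with $\sigma^2=\sigma_\alpha[b_2]$, the following conditions are equivalent: (i) $\sigma^1 \ll \sigma^2$ and $\frac{d\sigma^1}{d\sigma^2} \in L^2(\sigma^2)$; (ii) $\frac{\alpha - b_2}{\alpha - b_1}\, k_{b_1}(\cdot, w) \in \mathcal{H}(b_2)$ for all $w \in \mathbb{D}^2$; (iii) $\frac{\alpha - b_2}{\alpha - b_1}\, k_{b_1}(\cdot, w) \in \mathcal{H}(b_2)$ for some $w \in \mathbb{D}^2$.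
   Context: $\mathbb{D}$ is the open unit disc in $\mathbb{C}$ and $\mathbb{T}$ the unit circle. Reflection: if $p$ has polydegree $(d_1,d_2)$ (i.e. degree $d_j$ in $z_j$), then $\tilde{p}(z) = z_1^{d_1}z_2^{d_2}\,\overline{p(1/\overline{z_1},1/\overline{z_2})}$. Clark-Aleksandrov measures: for a non-constant holomorphic $b:\mathbb{D}^2\to\mathbb{D}$ and $\alpha\in\mathbb{T}$, $\sigma_\alpha[b]$ is the unique positive Borel measure on $\mathbb{T}^2$ such that $$\int_{\mathbb{T}^2} \prod_{j=1}^2 \frac{1-|z_j|^2}{|\zeta_j - z_j|^2}\, d\sigma_\alpha[b](\zeta) = \frac{1-|b(z)|^2}{|\alpha - b(z)|^2}, \quad z\in\mathbb{D}^2.$$ De Branges-Rovnyak spaces: let $C(z,w) = \prod_{j=1}^2 \frac{1}{1 - z_j\overline{w_j}}$ be the Cauchy kernel. $\mathcal{H}(b)$ is the reproducing kernel Hilbert space of functions on $\mathbb{D}^2$ with reproducing kernel $k_b(z,w) = (1 - b(z)\overline{b(w)})\,C(z,w)$, $z,w\in\mathbb{D}^2$. The bidisc algebra $A(\mathbb{D}^2)$ is the set of continuous functions on $\overline{\mathbb{D}^2}$ that are holomorphic in $\mathbb{D}^2$; $A(\mathbb{D}^2)^\perp$ is the set of complex Borel measures $\mu$ on $\mathbb{T}^2$ with $\int f\,d\mu = 0$ for all $f\in A(\mathbb{D}^2)$. A Borel set $S\subset\mathbb{T}^2$ is a null set for $A(\mathbb{D}^2)^\perp$ if $|\mu|(S)=0$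 for all $\mu\in A(\mathbb{D}^2)^\perp$. A Borel set $S$ is a carrier of $\mu$ (carries $\mu$) if $\mu(A)=\mu(A\cap S)$ for all Borel $A\subset\mathbb{T}^2$. Pluriharmonic measures: $\mathrm{RP}(\mathbb{T}^2)$ is the class of measures on $\mathbb{T}^2$ whose Poisson integral is the real part of a holomorphic function on $\mathbb{D}^2$; equivalently, real measures $\mu$ with $\int z_1^{k_1}z_2^{k_2}\,d\mu = 0$ for $k_1,k_2\in\mathbb{Z}$ unless $k_1,k_2\ge 0$ or $k_1,k_2\le 0$. Every Clark-Aleksandrov measure belongs to $\mathrm{RP}(\mathbb{T}^2)$. Decomposition: every $\mu\in \mathrm{RP}(\mathbb{T}^2)$ can be decomposed as $\mu=\mu_0+\mu_1+\mu_2$, where $\mu_0,\mu_1,\mu_2$ are mutually singular measures in $\mathrm{RP}(\mathbb{T}^2)$ such that: $\mu_0 = \overline{z_1}z_2\,T_*(\nu_0)$ for some $\nu_0\in A(\mathbb{D}^2)^\perp$ that is absolutely continuous with respect to some representing measure for $(0,0)$ (a Borel probability measure $\rho$ on $\mathbb{T}^2$ with $\int f\,d\rho = f(0,0)$ for all $f\in A(\mathbb{D}^2)$), where $T(z_1,z_2)=(z_1,\overline{z_2})$ and $T_*$ denotes pushforward, $T_*(\nu)(S)=\nu(T^{-1}(S))$; $\mu_1=\tau_1\times m$, where $\tau_1$ is a real measure on $\mathbb{T}$ carried by a set of Lebesgue measure zero; and $\mu_2 = m\times\tau_2$, where $\tau_2$ is a real measure on $\mathbb{T}$ carried by a set of Lebesgue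 measure zero. Here $m$ is normalized Lebesgue measure on $\mathbb{T}$. *)

theory Defs
  imports "HOL-Analysis.Analysis" "HOL-Computational_Algebra.Polynomial"
begin

section \<open>Bidisc, torus and holomorphic functions\<close>

abbreviation bidisc :: "(complex \<times> complex) set" where
  "bidisc \<equiv> ball 0 1 \<times> ball 0 1"

abbreviation circle_borel :: "complex measure" where
  "circle_borel \<equiv> restrict_space borel (sphere 0 1)"

abbreviation torus_borel :: "(complex \<times> complex) measure" where
  "torus_borel \<equiv> restrict_space borel (sphere 0 1 \<times> sphere 0 1)"

definition circle_leb :: "complex measure" where
  "circle_leb = distr (restrict_space lborel {0..<1}) circle_borel (\<lambda>t. cis (2 * pi * t))"

text \<open>Holomorphy in two variables: the Frechet derivative exists and is complex linear.\<close>

definition holomorphic2_on ::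
    "(complex \<times> complex \<Rightarrow> complex) \<Rightarrow> (complex \<times> complex) set \<Rightarrow> bool" where
  "holomorphic2_on f U \<longleftrightarrow>
     (\<forall>z\<in>U. \<exists>a b. (f has_derivative (\<lambda>h. a * fst h + b * snd h)) (at z))"

definition bidisc_algebra :: "(complex \<times> complex \<Rightarrow> complex) set" where
  "bidisc_algebra = {f. continuous_on (closure bidisc) f \<and> holomorphic2_on f bidisc}"


section \<open>Bivariate polynomials and their reflection\<close>

text \<open>A polynomial in \<open>z\<^sub>1, z\<^sub>2\<close> is a polynomial in \<open>z\<^sub>2\<close> with coefficients in \<open>\<complex>[z\<^sub>1]\<close>:
  the coefficient of \<open>z\<^sub>1^j * z\<^sub>2^k\<close> is \<open>coeff (coeff p k) j\<close>.\<close>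

definition poly2 :: "complex poly poly \<Rightarrow> complex \<times> complex \<Rightarrow> complex" where
  "poly2 p z = poly (poly p [:snd z:]) (fst z)"

definition degree_z1 :: "complex poly poly \<Rightarrow> nat" where
  "degree_z1 p = Max ((\<lambda>k. degree (coeff p k)) ` {..degree p})"

definition degree_z2 :: "complex poly poly \<Rightarrow> nat" where
  "degree_z2 p = degree p"

text \<open>The reflection, expanded as a polynomial so that it is also defined where a coordinate
  vanishes; \<open>reflection_eq\<close> below is its usual formula.\<close>

definition reflection :: "complex poly poly \<Rightarrow> complex \<times> complex \<Rightarrow> complex" where
  "reflection p z = (\<Sum>k\<le>degree_z2 p. \<Sum>j\<le>degree_z1 p.
     cnj (coeff (coeff p k) j) * fst z ^ (degree_z1 p - j) * snd z ^ (degree_z2 p - k))"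

lemma degree_coeff_le_degree_z1:
  assumes "k \<le> degree p"
  shows "degree (coeff p k) \<le> degree_z1 p"
  unfolding degree_z1_def using assms by (intro Max_ge) auto

lemma poly_eq_sum_atMost:
  fixes q :: "complex poly"
  assumes "degree q \<le> n"
  shows "poly q x = (\<Sum>j\<le>n. coeff q j * x ^ j)"
proof -
  have "(\<Sum>j\<le>n. coeff q j * x ^ j) = (\<Sum>j\<le>degree q. coeff q j * x ^ j)"
    using assms by (intro sum.mono_neutral_right) (auto simp: coeff_eq_0)
  then show ?thesis by (simp add: poly_altdef)
qed

lemma poly2_eq_sum:
  "poly2 p z = (\<Sum>k\<le>degree_z2 p. \<Sum>j\<le>degree_z1 p.
     coeff (coeff p k) j * fst z ^ j * snd z ^ k)"
proof -
  have "poly2 p z = (\<Sum>k\<le>degree p. poly (coeff p k) (fst z) * snd z ^ k)"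
    by (simp add: poly2_def poly_altdef[of p] poly_sum poly_power)
  also have "\<dots> = (\<Sum>k\<le>degree p. \<Sum>j\<le>degree_z1 p. coeff (coeff p k) j * fst z ^ j * snd z ^ k)"
    by (intro sum.cong refl)
       (simp add: poly_eq_sum_atMost[OF degree_coeff_le_degree_z1] sum_distrib_right)
  finally show ?thesis by (simp add: degree_z2_def)
qed

lemma reflection_eq:
  assumes "z1 \<noteq> 0" "z2 \<noteq> 0"
  shows "reflection p (z1, z2) =
    z1 ^ degree_z1 p * z2 ^ degree_z2 p * cnj (poly2 p (1 / cnj z1, 1 / cnj z2))"
  unfolding reflection_def poly2_eq_sum
  using assms by (auto simp: sum_distrib_left power_diff field_simps intro!: sum.cong)


section \<open>Complex measures\<close>

text \<open>A complex measure on a measurable space \<open>M\<close> is a countably additive set function on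
  \<open>sets M\<close>; its values outside \<open>sets M\<close> are irrelevant. Only the measurable space underlying
  \<open>M\<close> is used in this section.\<close>

definition complex_measure :: "'a measure \<Rightarrow> ('a set \<Rightarrow> complex) \<Rightarrow> bool" where
  "complex_measure M \<mu> \<longleftrightarrow> \<mu> {} = 0 \<and>
     (\<forall>A :: nat \<Rightarrow> 'a set. range A \<subseteq> sets M \<longrightarrow> disjoint_family A \<longrightarrow>
        (\<lambda>i. \<mu> (A i)) sums \<mu> (\<Union>i. A i))"

definition real_measure :: "'a measure \<Rightarrow> ('a set \<Rightarrow> complex) \<Rightarrow> bool" where
  "real_measure M \<mu> \<longleftrightarrow> complex_measure M \<mu> \<and> (\<forall>A\<in>sets M. \<mu> A \<in> \<real>)"

definition total_variation :: "'a measure \<Rightarrow> ('a set \<Rightarrow> complex) \<Rightarrow> 'a set \<Rightarrow> ennreal" where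
  "total_variation M \<mu> S =
     (SUP A\<in>{A :: nat \<Rightarrow> 'a set. range A \<subseteq> sets M \<and> disjoint_family A \<and> (\<Union>i. A i) = S}.
        \<Sum>i. ennreal (cmod (\<mu> (A i))))"

text \<open>The positive part in the Jordan decomposition of a signed measure \<open>r\<close>; the negative part
  is the positive part of \<open>-r\<close>.\<close>

definition positive_part :: "'a measure \<Rightarrow> ('a set \<Rightarrow> real) \<Rightarrow> 'a measure" where
  "positive_part M r =
     measure_of (space M) (sets M) (\<lambda>A. SUP B\<in>{B \<in> sets M. B \<subseteq> A}. ennreal (r B))"

definition cm_integral :: "'a measure \<Rightarrow> ('a set \<Rightarrow> complex) \<Rightarrow> ('a \<Rightarrow> complex) \<Rightarrow> complex" where
  "cm_integral M \<mu> f =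
      (integral\<^sup>L (positive_part M (\<lambda>A. Re (\<mu> A))) f
        - integral\<^sup>L (positive_part M (\<lambda>A. - Re (\<mu> A))) f)
    + \<i> * (integral\<^sup>L (positive_part M (\<lambda>A. Im (\<mu> A))) f
        - integral\<^sup>L (positive_part M (\<lambda>A. - Im (\<mu> A))) f)"

definition carries :: "'a measure \<Rightarrow> 'a set \<Rightarrow> ('a set \<Rightarrow> complex) \<Rightarrow> bool" where
  "carries M S \<mu> \<longleftrightarrow> S \<in> sets M \<and> (\<forall>A\<in>sets M. \<mu> A = \<mu> (A \<inter> S))"

definition mutually_singular ::
    "'a measure \<Rightarrow> ('a set \<Rightarrow> complex) \<Rightarrow> ('a set \<Rightarrow> complex) \<Rightarrow> bool" where
  "mutually_singular M \<mu> \<nu> \<longleftrightarrow> (\<exists>A B. A \<inter> B = {} \<and> carries M A \<mu> \<and> carries M B \<nu>)"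

definition cm_absolutely_continuous :: "('a set \<Rightarrow> complex) \<Rightarrow> 'a measure \<Rightarrow> bool" where
  "cm_absolutely_continuous \<nu> \<rho> \<longleftrightarrow> (\<forall>A\<in>null_sets \<rho>. \<nu> A = 0)"

definition cm_of :: "'a measure \<Rightarrow> 'a set \<Rightarrow> complex" where
  "cm_of \<sigma> A = complex_of_real (measure \<sigma> A)"

text \<open>The measure \<open>g d\<mu>\<close>.\<close>

definition cm_density ::
    "'a measure \<Rightarrow> ('a \<Rightarrow> complex) \<Rightarrow> ('a set \<Rightarrow> complex) \<Rightarrow> 'a set \<Rightarrow> complex" where
  "cm_density M g \<mu> A = cm_integral M \<mu> (\<lambda>x. indicator A x * g x)"

definition cm_pushforward ::
    "'a measure \<Rightarrow> ('a \<Rightarrow> 'b) \<Rightarrow> ('a set \<Rightarrow> complex) \<Rightarrow> 'b set \<Rightarrow> complex" where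
  "cm_pushforward M T \<nu> S = \<nu> (T -` S \<inter> space M)"

text \<open>The product \<open>\<mu> \<times> \<nu>\<close>, where \<open>M\<close> is the measurable space of the first factor \<open>\<mu>\<close>.\<close>

definition cm_prod ::
    "'a measure \<Rightarrow> ('a set \<Rightarrow> complex) \<Rightarrow> ('b set \<Rightarrow> complex) \<Rightarrow> ('a \<times> 'b) set \<Rightarrow> complex" where
  "cm_prod M \<mu> \<nu> S = cm_integral M \<mu> (\<lambda>x. \<nu> (Pair x -` S))"

lemma cm_integral_cm_of:
  assumes "finite_measure \<sigma>" "sets \<sigma> = sets M"
  shows "cm_integral M (cm_of \<sigma>) f = integral\<^sup>L \<sigma> f"
proof -
  interpret finite_measure \<sigma> by fact
  have sp: "space \<sigma> = space M" using assms(2) by (rule sets_eq_imp_space_eq)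
  have "(SUP B\<in>{B \<in> sets M. B \<subseteq> A}. ennreal (Re (cm_of \<sigma> B))) = emeasure \<sigma> A"
    if "A \<in> sets M" for A
  proof (rule antisym)
    show "(SUP B\<in>{B \<in> sets M. B \<subseteq> A}. ennreal (Re (cm_of \<sigma> B))) \<le> emeasure \<sigma> A"
      using that assms(2) by (intro SUP_least)
        (auto simp: cm_of_def emeasure_eq_measure intro!: ennreal_leI finite_measure_mono)
    show "emeasure \<sigma> A \<le> (SUP B\<in>{B \<in> sets M. B \<subseteq> A}. ennreal (Re (cm_of \<sigma> B)))"
      using that by (intro SUP_upper2[of A]) (auto simp: cm_of_def emeasure_eq_measure)
  qed
  then have "positive_part M (\<lambda>A. Re (cm_of \<sigma> A)) = measure_of (space M) (sets M) (emeasure \<sigma>)"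
    unfolding positive_part_def
    by (intro measure_of_eq) (auto simp: sets.sigma_sets_eq sets.space_closed)
  also have "\<dots> = \<sigma>" using measure_of_of_measure[of \<sigma>] by (simp add: sp assms(2))
  finally have 1: "positive_part M (\<lambda>A. Re (cm_of \<sigma> A)) = \<sigma>" .
  have z: "integral\<^sup>L (positive_part M r) f = 0" if "\<And>A. A \<in> sets M \<Longrightarrow> r A \<le> 0"
    for r :: "'a set \<Rightarrow> real"
  proof -
    have "(SUP B\<in>{B \<in> sets M. B \<subseteq> A}. ennreal (r B)) = 0" for A
      using that by (intro antisym SUP_least) (auto simp: ennreal_neg)
    then have "positive_part M r = measure_of (space M) (sets M) (\<lambda>_. 0)"
      by (simp add: positive_part_def)
    also have "\<dots> = null_measure M" by (simp add: null_measure_def)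
    finally show ?thesis by simp
  qed
  show ?thesis
    unfolding cm_integral_def 1 by (simp add: z) (simp add: z cm_of_def)
qed


section \<open>Clark measures and pluriharmonic measures\<close>

definition poisson2 :: "complex \<times> complex \<Rightarrow> complex \<times> complex \<Rightarrow> real" where
  "poisson2 z \<zeta> = ((1 - (cmod (fst z))\<^sup>2) / (cmod (fst \<zeta> - fst z))\<^sup>2)
                * ((1 - (cmod (snd z))\<^sup>2) / (cmod (snd \<zeta> - snd z))\<^sup>2)"

text \<open>\<open>\<sigma>\<close> is the Clark measure \<open>\<sigma>\<^sub>\<alpha>[b]\<close>, which is determined by this property.\<close>

definition is_clark_measure ::
    "(complex \<times> complex \<Rightarrow> complex) \<Rightarrow> complex \<Rightarrow> (complex \<times> complex) measure \<Rightarrow> bool" where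
  "is_clark_measure b \<alpha> \<sigma> \<longleftrightarrow>
     finite_measure \<sigma> \<and> sets \<sigma> = sets torus_borel \<and>
     (\<forall>z\<in>bidisc. (\<integral>\<zeta>. poisson2 z \<zeta> \<partial>\<sigma>) = (1 - (cmod (b z))\<^sup>2) / (cmod (\<alpha> - b z))\<^sup>2)"

definition RP :: "((complex \<times> complex) set \<Rightarrow> complex) set" where
  "RP = {\<mu>. complex_measure torus_borel \<mu> \<and>
     (\<exists>F. holomorphic2_on F bidisc \<and>
       (\<forall>z\<in>bidisc. cm_integral torus_borel \<mu> (\<lambda>\<zeta>. of_real (poisson2 z \<zeta>)) = of_real (Re (F z))))}"


section \<open>Annihilating measures, null sets and the decomposition\<close>

definition annihilator :: "((complex \<times> complex) set \<Rightarrow> complex) set" where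
  "annihilator = {\<mu>. complex_measure torus_borel \<mu> \<and>
     (\<forall>f\<in>bidisc_algebra. cm_integral torus_borel \<mu> f = 0)}"

definition annihilator_null_set :: "(complex \<times> complex) set \<Rightarrow> bool" where
  "annihilator_null_set S \<longleftrightarrow> S \<in> sets torus_borel \<and>
     (\<forall>\<mu>\<in>annihilator. total_variation torus_borel \<mu> S = 0)"

definition representing_measure_0 :: "(complex \<times> complex) measure \<Rightarrow> bool" where
  "representing_measure_0 \<rho> \<longleftrightarrow>
     sets \<rho> = sets torus_borel \<and> emeasure \<rho> (space \<rho>) = 1 \<and>
     (\<forall>f\<in>bidisc_algebra. (\<integral>\<zeta>. f \<zeta> \<partial>\<rho>) = f (0, 0))"

definition conj_snd :: "complex \<times> complex \<Rightarrow> complex \<times> complex" where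
  "conj_snd z = (fst z, cnj (snd z))"

definition singular_on_circle :: "(complex set \<Rightarrow> complex) \<Rightarrow> bool" where
  "singular_on_circle \<tau> \<longleftrightarrow> real_measure circle_borel \<tau> \<and>
     (\<exists>E\<in>null_sets circle_leb. carries circle_borel E \<tau>)"

definition RP_decomposition ::
    "((complex \<times> complex) set \<Rightarrow> complex) \<Rightarrow> ((complex \<times> complex) set \<Rightarrow> complex) \<Rightarrow>
     ((complex \<times> complex) set \<Rightarrow> complex) \<Rightarrow> ((complex \<times> complex) set \<Rightarrow> complex) \<Rightarrow> bool" where
  "RP_decomposition \<mu> \<mu>0 \<mu>1 \<mu>2 \<longleftrightarrow>
     (\<forall>S\<in>sets torus_borel. \<mu> S = \<mu>0 S + \<mu>1 S + \<mu>2 S) \<and>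
     \<mu>0 \<in> RP \<and> \<mu>1 \<in> RP \<and> \<mu>2 \<in> RP \<and>
     mutually_singular torus_borel \<mu>0 \<mu>1 \<and>
     mutually_singular torus_borel \<mu>0 \<mu>2 \<and>
     mutually_singular torus_borel \<mu>1 \<mu>2 \<and>
     (\<exists>\<nu>0\<in>annihilator. \<exists>\<rho>. representing_measure_0 \<rho> \<and> cm_absolutely_continuous \<nu>0 \<rho> \<and>
        (\<forall>S\<in>sets torus_borel. \<mu>0 S =
           cm_density torus_borel (\<lambda>\<zeta>. cnj (fst \<zeta>) * snd \<zeta>)
             (cm_pushforward torus_borel conj_snd \<nu>0) S)) \<and>
     (\<exists>\<tau>1. singular_on_circle \<tau>1 \<and>
        (\<forall>S\<in>sets torus_borel. \<mu>1 S = cm_prod circle_borel \<tau>1 (cm_of circle_leb) S)) \<and>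
     (\<exists>\<tau>2. singular_on_circle \<tau>2 \<and>
        (\<forall>S\<in>sets torus_borel. \<mu>2 S = cm_prod circle_borel (cm_of circle_leb) \<tau>2 S))"


section \<open>Reproducing kernel Hilbert spaces\<close>

text \<open>\<open>H\<close> with inner product \<open>ip\<close> (linear in the first argument) is the Hilbert space of functions
  on \<open>X\<close> with reproducing kernel \<open>K\<close>. Functions on \<open>X\<close> are extended by \<open>0\<close> outside \<open>X\<close>.\<close>

definition zero_extend :: "'a set \<Rightarrow> ('a \<Rightarrow> complex) \<Rightarrow> 'a \<Rightarrow> complex" where
  "zero_extend X f = (\<lambda>x. if x \<in> X then f x else 0)"

locale rkhs =
  fixes X :: "'a set" and K :: "'a \<Rightarrow> 'a \<Rightarrow> complex"
    and H :: "('a \<Rightarrow> complex) set"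
    and ip :: "('a \<Rightarrow> complex) \<Rightarrow> ('a \<Rightarrow> complex) \<Rightarrow> complex"
  assumes zero_outside: "f \<in> H \<Longrightarrow> x \<notin> X \<Longrightarrow> f x = 0"
    and zero_mem: "(\<lambda>x. 0) \<in> H"
    and add_mem: "f \<in> H \<Longrightarrow> g \<in> H \<Longrightarrow> (\<lambda>x. f x + g x) \<in> H"
    and scale_mem: "f \<in> H \<Longrightarrow> (\<lambda>x. c * f x) \<in> H"
    and ip_add: "f \<in> H \<Longrightarrow> g \<in> H \<Longrightarrow> h \<in> H \<Longrightarrow> ip (\<lambda>x. f x + g x) h = ip f h + ip g h"
    and ip_scale: "f \<in> H \<Longrightarrow> g \<in> H \<Longrightarrow> ip (\<lambda>x. c * f x) g = c * ip f g"
    and ip_cnj: "f \<in> H \<Longrightarrow> g \<in> H \<Longrightarrow> ip g f = cnj (ip f g)"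
    and ip_nonneg: "f \<in> H \<Longrightarrow> 0 \<le> Re (ip f f)"
    and ip_definite: "f \<in> H \<Longrightarrow> ip f f = 0 \<Longrightarrow> f = (\<lambda>x. 0)"
    and complete: "\<lbrakk>\<And>n. u n \<in> H;
        \<And>e. 0 < e \<Longrightarrow> \<exists>N. \<forall>m\<ge>N. \<forall>n\<ge>N. sqrt (Re (ip (u m - u n) (u m - u n))) < e\<rbrakk>
      \<Longrightarrow> \<exists>f\<in>H. (\<lambda>n. sqrt (Re (ip (u n - f) (u n - f)))) \<longlonglongrightarrow> 0"
    and kernel_mem: "w \<in> X \<Longrightarrow> zero_extend X (\<lambda>z. K z w) \<in> H"
    and reproducing: "f \<in> H \<Longrightarrow> w \<in> X \<Longrightarrow> f w = ip f (zero_extend X (\<lambda>z. K z w))"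

definition cauchy_kernel :: "complex \<times> complex \<Rightarrow> complex \<times> complex \<Rightarrow> complex" where
  "cauchy_kernel z w =
     (1 / (1 - fst z * cnj (fst w))) * (1 / (1 - snd z * cnj (snd w)))"

definition dBR_kernel :: "(complex \<times> complex \<Rightarrow> complex) \<Rightarrow>
    complex \<times> complex \<Rightarrow> complex \<times> complex \<Rightarrow> complex" where
  "dBR_kernel b z w = (1 - b z * cnj (b w)) * cauchy_kernel z w"

text \<open>\<open>H\<close> with \<open>ip\<close> is the de Branges-Rovnyak space \<open>\<H>(b)\<close>.\<close>

abbreviation is_dBR_space where
  "is_dBR_space b H ip \<equiv> rkhs bidisc (dBR_kernel b) H ip"

end

theory Submission
  imports Defs "HOL-Complex_Analysis.Complex_Analysis"
    "HOL-Computational_Algebra.Fundamental_Theorem_Algebra"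
begin

text \<open>The proof works with the closure of the span of the Cauchy kernels under bounded pointwise limits
  of sequences on the torus; this closure is an algebra. Both the vanishing of an annihilating measure and,
  for fixed \<open>w\<close>, the estimate \<open>\<bar>\<integral> f cnj (C(\<cdot>, w)) d\<sigma>\<^sub>1\<bar> \<le> K \<parallel>f\<parallel>\<close> with the norm of \<open>L\<^sup>2(\<sigma>\<^sub>2)\<close>,
  which expresses membership in \<open>\<H>(b\<^sub>2)\<close>, pass from the span to its closure. If \<open>q\<close> is a polynomial
  without zeros in the bidisc, the functions \<open>q(\<zeta>) / q(r \<zeta>)\<close> are bounded and tend to the indicator of
  \<open>q \<noteq> 0\<close> as \<open>r\<close> tends to \<open>1\<close>. Apply this to \<open>q = reflection p - \<alpha> p\<close>, whose zero set on the torus carries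
  \<open>\<sigma>\<^sub>1\<close>. Off the finitely many lines where \<open>q(0, \<zeta>\<^sub>2)\<close> or \<open>q(\<zeta>\<^sub>1, 0)\<close> vanishes, the equation \<open>q = 0\<close>
  makes the conjugate coordinates limits of analytic functions, so the closure contains every bounded Borel
  function supported there: that set is null for annihilating measures, and the estimate becomes one for the
  density of \<open>\<sigma>\<^sub>1\<close>. The component \<open>\<mu>\<^sub>0\<close> does not charge lines. On a line every Clark measure is a
  multiple of Lebesgue measure, so there only the total masses have to be compared.\<close>

section \<open>Closure under bounded pointwise limits\<close>

text \<open>Membership in the space of \<open>b2\<close> tests \<sigma>1 on analytic functions only,
  while square integrability of the density concerns all Borel functions. What closes the gap is a
  set on which analytic functions already approximate every bounded Borel function, and such a set
  is automatically null for annihilating measures; this is why both assertions share one proof.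
  Lines must be left out of it: the product of a point mass at \<open>a\<close> with
  \<open>\<zeta>2 dm(\<zeta>2)\<close> annihilates the bidisc algebra and charges the line
  \<open>\<zeta>1 = a\<close>. Only finitely many lines have to be removed, because \<open>q\<close>
  does not vanish at the origin. Approximation is bounded and pointwise rather than in a norm, so
  that one closure serves all measures at once, by dominated convergence.\<close>

abbreviation torus :: "(complex \<times> complex) set" where
  "torus \<equiv> sphere 0 1 \<times> sphere 0 1"

text \<open>Limits are iterated without restriction, since pointwise limits of pointwise limits need
  not be limits of one sequence from \<open>S\<close>. Properties of the closure are proved by
  induction, with a passage to the limit as the step \<open>lim\<close>.\<close>

inductive_set bp_closure :: "'a set \<Rightarrow> ('a \<Rightarrow> complex) set \<Rightarrow> ('a \<Rightarrow> complex) set"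
  for T S where
  base: "f \<in> S \<Longrightarrow> f \<in> bp_closure T S"
| lim: "(\<And>n. f n \<in> bp_closure T S) \<Longrightarrow> (\<And>n x. x \<in> T \<Longrightarrow> cmod (f n x) \<le> B) \<Longrightarrow>
    (\<And>x. x \<in> T \<Longrightarrow> (\<lambda>n. f n x) \<longlonglongrightarrow> g x) \<Longrightarrow> g \<in> bp_closure T S" for f :: "nat \<Rightarrow> 'a \<Rightarrow> complex"

locale bp_closed =
  fixes T :: "'a set" and Q :: "('a \<Rightarrow> complex) set"
  assumes bounded: "f \<in> Q \<Longrightarrow> \<exists>B. \<forall>x\<in>T. cmod (f x) \<le> B"
    and add: "f \<in> Q \<Longrightarrow> g \<in> Q \<Longrightarrow> (\<lambda>x. f x + g x) \<in> Q"
    and scale: "f \<in> Q \<Longrightarrow> (\<lambda>x. c * f x) \<in> Q"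
    and lim: "(\<And>n. u n \<in> Q) \<Longrightarrow> (\<And>n x. x \<in> T \<Longrightarrow> cmod (u n x) \<le> B) \<Longrightarrow>
      (\<And>x. x \<in> T \<Longrightarrow> (\<lambda>n. u n x) \<longlonglongrightarrow> g x) \<Longrightarrow> g \<in> Q"
begin

text \<open>The rule \<open>lim\<close> sees values on \<open>T\<close> only, so the constant
  sequence \<open>f\<close> also converges to \<open>g\<close>.\<close>

lemma cong:
  assumes "f \<in> Q" "\<And>x. x \<in> T \<Longrightarrow> g x = f x"
  shows "g \<in> Q"
proof -
  obtain B where B: "\<forall>x\<in>T. cmod (f x) \<le> B" using bounded assms by blast
  show ?thesis by (rule lim[of "\<lambda>_. f" B]) (use assms B in auto)
qed

lemma diff: "f \<in> Q \<Longrightarrow> g \<in> Q \<Longrightarrow> (\<lambda>x. f x - g x) \<in> Q"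
  using add[OF _ scale[of g "-1"], of f] by simp

lemma sum:
  assumes "finite I" "I \<noteq> {}" "\<And>i. i \<in> I \<Longrightarrow> f i \<in> Q"
  shows "(\<lambda>x. \<Sum>i\<in>I. f i x) \<in> Q"
  using assms by (induction I rule: finite_ne_induct) (auto intro: add)

lemma lim_at:
  fixes u :: "'b::first_countable_topology \<Rightarrow> 'a \<Rightarrow> complex"
  assumes "at a within S \<noteq> bot" "\<And>t. t \<in> S \<Longrightarrow> u t \<in> Q"
    and "\<And>t x. t \<in> S \<Longrightarrow> x \<in> T \<Longrightarrow> cmod (u t x) \<le> B"
    and "\<And>x. x \<in> T \<Longrightarrow> ((\<lambda>t. u t x) \<longlongrightarrow> g x) (at a within S)"
  shows "g \<in> Q"
proof -
  obtain s :: "nat \<Rightarrow> 'b" where s: "\<And>n. s n \<in> S - {a}" "s \<longlonglongrightarrow> a"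
    using assms(1) by (metis trivial_limit_within islimpt_sequential)
  show ?thesis
  proof (rule lim[of "\<lambda>n. u (s n)" B])
    show "(\<lambda>n. u (s n) x) \<longlonglongrightarrow> g x" if "x \<in> T" for x
      using assms(4)[OF that] s unfolding tendsto_at_iff_sequentially comp_def by blast
  qed (use s assms in auto)
qed

lemma uniform_lim:
  assumes g: "\<And>e. e > 0 \<Longrightarrow> \<exists>f\<in>Q. \<forall>x\<in>T. cmod (f x - g x) \<le> e"
  shows "g \<in> Q"
proof -
  have "\<exists>f\<in>Q. \<forall>x\<in>T. cmod (f x - g x) \<le> inverse (of_nat (Suc n))" for n :: nat
    by (rule g) simp
  then obtain f where f: "\<And>n. f n \<in> Q"
    and fg: "\<And>n x. x \<in> T \<Longrightarrow> cmod (f n x - g x) \<le> inverse (of_nat (Suc n))"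
    by metis
  obtain B where B: "\<forall>x\<in>T. cmod (f 0 x) \<le> B" using bounded f by blast
  show ?thesis
  proof (rule lim[of f "B + 2", OF f])
    fix n x assume x: "x \<in> T"
    have "inverse (real (Suc n)) \<le> 1" by (simp add: field_simps)
    then have "cmod (f n x - g x) \<le> 1" using fg[OF x, of n] by linarith
    moreover have "cmod (f 0 x - g x) \<le> 1" using fg[OF x, of 0] by simp
    ultimately have "cmod (f n x - f 0 x) \<le> 2"
      using norm_triangle_ineq4[of "f n x - g x" "f 0 x - g x"] by simp
    then show "cmod (f n x) \<le> B + 2"
      using B x norm_triangle_sub[of "f n x" "f 0 x"] by force
  next
    fix x assume x: "x \<in> T"
    have "(\<lambda>n. f n x - g x) \<longlonglongrightarrow> 0"
      by (rule Lim_null_comparison[OF _ LIMSEQ_inverse_real_of_nat])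
         (use fg[OF x] in auto)
    then show "(\<lambda>n. f n x) \<longlonglongrightarrow> g x" by (simp add: LIM_zero_iff)
  qed
qed

end

lemma bp_closed_bp_closure:
  assumes bounded: "\<And>f. f \<in> S \<Longrightarrow> \<exists>B. \<forall>x\<in>T. cmod (f x) \<le> B"
    and add: "\<And>f g. f \<in> S \<Longrightarrow> g \<in> S \<Longrightarrow> (\<lambda>x. f x + g x) \<in> S"
    and scale: "\<And>f c. f \<in> S \<Longrightarrow> (\<lambda>x. c * f x) \<in> S"
  shows "bp_closed T (bp_closure T S)"
proof
  show bd: "\<exists>B. \<forall>x\<in>T. cmod (f x) \<le> B" if "f \<in> bp_closure T S" for f
    using that
  proof induction
    case (lim f B g)
    have "cmod (g x) \<le> B" if "x \<in> T" for x
      by (rule Lim_bounded[OF tendsto_norm[OF lim.hyps(3)[OF that]], of 0]) (use lim.hyps(2) that in auto)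
    then show ?case by blast
  qed (rule bounded)
  show "(\<lambda>x. c * f x) \<in> bp_closure T S" if "f \<in> bp_closure T S" for f c
    using that
  proof induction
    case (lim f B g)
    show ?case
      by (rule bp_closure.lim[of "\<lambda>n x. c * f n x" _ _ "cmod c * B"])
         (use lim in \<open>auto intro!: tendsto_intros mult_left_mono simp: norm_mult\<close>)
  qed (auto intro: bp_closure.base scale)
  \<comment> \<open>Two successive inductions: the second summand stays a generator here and runs
    through the closure below.\<close>
  have base_add: "(\<lambda>x. f x + g x) \<in> bp_closure T S" if "f \<in> bp_closure T S" "g \<in> S" for f g
    using that
  proof induction
    case (lim f B h)
    obtain B' where B': "\<forall>x\<in>T. cmod (g x) \<le> B'" using bounded lim.prems by blast
    show ?case
      by (rule bp_closure.lim[of "\<lambda>n x. f n x + g x" _ _ "B + B'"])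
         (use lim B' in \<open>auto intro!: tendsto_intros norm_triangle_mono\<close>)
  qed (auto intro: bp_closure.base add)
  show "(\<lambda>x. f x + g x) \<in> bp_closure T S" if "f \<in> bp_closure T S" "g \<in> bp_closure T S" for f g
    using that(2,1)
  proof induction
    case (lim h B g)
    obtain B' where B': "\<forall>x\<in>T. cmod (f x) \<le> B'" using bd lim.prems by blast
    show ?case
      by (rule bp_closure.lim[of "\<lambda>n x. f x + h n x" _ _ "B' + B"])
         (use lim B' in \<open>auto intro!: tendsto_intros norm_triangle_mono\<close>)
  qed (rule base_add)
qed (rule bp_closure.lim)

text \<open>The same two successive inductions as for sums. Products of generators are only required
  to lie in the closure, because a product of two Cauchy kernels is in general not a combination of
  Cauchy kernels.\<close>

lemma bp_closure_mult:
  assumes bp: "bp_closed T (bp_closure T S)"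
    and base: "\<And>f g. f \<in> S \<Longrightarrow> g \<in> S \<Longrightarrow> (\<lambda>x. f x * g x) \<in> bp_closure T S"
    and f: "f \<in> bp_closure T S" and g: "g \<in> bp_closure T S"
  shows "(\<lambda>x. f x * g x) \<in> bp_closure T S"
proof -
  interpret bp_closed T "bp_closure T S" by (rule bp)
  have base_mult: "(\<lambda>x. f x * g x) \<in> bp_closure T S" if f: "f \<in> bp_closure T S" and g: "g \<in> S" for f g
    using f
  proof induction
    case (lim f B h)
    obtain B' where B': "\<forall>x\<in>T. cmod (g x) \<le> B'"
      using bounded[OF bp_closure.base[OF g]] by blast
    show ?case
    proof (rule bp_closure.lim[of "\<lambda>n x. f n x * g x" _ _ "B * B'"])
      show "cmod (f n x * g x) \<le> B * B'" if "x \<in> T" for n x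
        unfolding norm_mult using lim.hyps(2)[OF that, of n] B' that
        by (intro mult_mono) (auto intro: order_trans[OF norm_ge_zero])
      show "(\<lambda>n. f n x * g x) \<longlonglongrightarrow> h x * g x" if "x \<in> T" for x
        by (intro tendsto_intros lim.hyps that)
    qed (rule lim.IH)
  qed (rule base[OF _ g])
  show ?thesis
    using g
  proof induction
    case (lim h B g)
    obtain B' where B': "\<forall>x\<in>T. cmod (f x) \<le> B'"
      using bounded[OF f] by blast
    show ?case
    proof (rule bp_closure.lim[of "\<lambda>n x. f x * h n x" _ _ "B' * B"])
      show "cmod (f x * h n x) \<le> B' * B" if "x \<in> T" for n x
        unfolding norm_mult using lim.hyps(2)[OF that, of n] B' that
        by (intro mult_mono) (auto intro: order_trans[OF norm_ge_zero])
      show "(\<lambda>n. f x * h n x) \<longlonglongrightarrow> f x * g x" if "x \<in> T" for x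
        by (intro tendsto_intros lim.hyps that)
    qed (rule lim.IH)
  qed (rule base_mult[OF f])
qed

lemma bp_closure_measurable:
  assumes "f \<in> bp_closure (space M) S" "\<And>f. f \<in> S \<Longrightarrow> f \<in> borel_measurable M"
  shows "f \<in> borel_measurable M"
  using assms(1)
proof induction
  case (lim f B g)
  show ?case
    by (rule borel_measurable_LIMSEQ_metric[of f]) (use lim in auto)
qed (rule assms(2))

locale bp_algebra = bp_closed torus Q for Q :: "(complex \<times> complex \<Rightarrow> complex) set" +
  assumes mult: "f \<in> Q \<Longrightarrow> g \<in> Q \<Longrightarrow> (\<lambda>x. f x * g x) \<in> Q"
    and one: "(\<lambda>_. 1) \<in> Q"
begin

lemma const: "(\<lambda>_. c) \<in> Q"
  using scale[OF one, of c] by simp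

lemma power: "f \<in> Q \<Longrightarrow> (\<lambda>x. f x ^ n) \<in> Q"
  by (induction n) (auto intro: one mult)

lemma sum': "finite I \<Longrightarrow> (\<And>i. i \<in> I \<Longrightarrow> f i \<in> Q) \<Longrightarrow> (\<lambda>x. \<Sum>i\<in>I. f i x) \<in> Q"
  using sum[of I f] const[of 0] by (cases "I = {}") auto

end

section \<open>Bounded Borel functions from the coordinates and their conjugates\<close>

locale bp_star_algebra = bp_algebra +
  assumes coordinates: "fst \<in> Q" "(\<lambda>x. cnj (fst x)) \<in> Q" "snd \<in> Q" "(\<lambda>x. cnj (snd x)) \<in> Q"
begin

text \<open>The real and imaginary parts of the coordinates separate points, so Stone-Weierstrass
  applies to the real functions whose complexification lies in \<open>Q\<close>; uniform limits are
  bounded pointwise limits.\<close>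

lemma continuous_real:
  assumes "continuous_on torus (f :: _ \<Rightarrow> real)"
  shows "(\<lambda>x. of_real (f x)) \<in> Q"
proof -
  define P where "P f \<longleftrightarrow> continuous_on torus f \<and> (\<lambda>x. of_real (f x)) \<in> Q"
    for f :: "complex \<times> complex \<Rightarrow> real"
  have re: "(\<lambda>x. of_real (Re (h x))) \<in> Q" and im: "(\<lambda>x. of_real (Im (h x))) \<in> Q"
    if "h \<in> Q" "(\<lambda>x. cnj (h x)) \<in> Q" for h
  proof -
    have "(\<lambda>x. (1/2) * (h x + cnj (h x))) \<in> Q" by (rule scale[OF add[OF that]])
    then show "(\<lambda>x. of_real (Re (h x))) \<in> Q" by (rule cong) (simp add: complex_eq_iff)
    have "(\<lambda>x. (- (\<i>/2)) * (h x - cnj (h x))) \<in> Q" by (rule scale[OF diff[OF that]])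
    then show "(\<lambda>x. of_real (Im (h x))) \<in> Q" by (rule cong) (simp add: complex_eq_iff)
  qed
  have coord: "P (\<lambda>x. Re (fst x))" "P (\<lambda>x. Im (fst x))" "P (\<lambda>x. Re (snd x))" "P (\<lambda>x. Im (snd x))"
    unfolding P_def using re im coordinates by (auto intro!: continuous_intros)
  have P_const: "P (\<lambda>x. c)" for c unfolding P_def using const by auto
  have P_add: "P (\<lambda>x. f x + g x)" if "P f \<and> P g" for f g
    using that add unfolding P_def by (auto intro!: continuous_intros)
  have P_mult: "P (\<lambda>x. f x * g x)" if "P f \<and> P g" for f g
    using that mult unfolding P_def by (auto intro!: continuous_intros)
  show ?thesis
  proof (rule uniform_lim)
    fix e :: real assume e: "e > 0"
    have "\<exists>g. P g \<and> (\<forall>x\<in>torus. \<bar>f x - g x\<bar> < e)"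
    proof (rule Stone_Weierstrass_HOL)
      show "compact torus" by (intro compact_Times) auto
      show "\<exists>h. P h \<and> h x \<noteq> h y" if "x \<in> torus \<and> y \<in> torus \<and> x \<noteq> y" for x y
      proof -
        have "Re (fst x) \<noteq> Re (fst y) \<or> Im (fst x) \<noteq> Im (fst y) \<or>
            Re (snd x) \<noteq> Re (snd y) \<or> Im (snd x) \<noteq> Im (snd y)"
          using that by (metis complex_eq_iff prod_eq_iff)
        then show ?thesis using coord by blast
      qed
    qed (use assms e P_const P_add P_mult P_def in simp_all)
    then obtain g where g: "P g" "\<And>x. x \<in> torus \<Longrightarrow> \<bar>f x - g x\<bar> < e" by blast
    show "\<exists>h\<in>Q. \<forall>x\<in>torus. cmod (h x - complex_of_real (f x)) \<le> e"
    proof (rule bexI)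
      show "\<forall>x\<in>torus. cmod (complex_of_real (g x) - complex_of_real (f x)) \<le> e"
        using g(2) by (auto simp flip: of_real_diff simp: abs_minus_commute intro: less_imp_le)
    qed (use g(1) P_def in auto)
  qed
qed

lemma indicator_borel:
  assumes "A \<in> sets borel"
  shows "(\<lambda>x. indicator A x) \<in> Q"
proof -
  have "A \<in> sigma_sets UNIV (Collect closed)"
    using assms by (simp add: borel_eq_closed)
  then show ?thesis
  proof induction
    case (Basic K)
    then have K: "closed K" by simp
    show ?case
    \<comment> \<open>\<open>infdist x {}\<close> is 0 by convention, so for the empty set the
      functions below would be constantly 1.\<close>
    proof (cases "K = {}")
      case False
      show ?thesis
      proof (rule lim[of "\<lambda>n x. of_real (max 0 (1 - real n * infdist x K))" 1])
        fix n x
        have "0 \<le> real n * infdist x K" by (simp add: infdist_nonneg)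
        then have "\<bar>max 0 (1 - real n * infdist x K)\<bar> \<le> 1" by linarith
        then show "cmod (of_real (max 0 (1 - real n * infdist x K))) \<le> 1"
          by (simp only: norm_of_real)
      next
        fix x :: "complex \<times> complex"
        have "\<forall>\<^sub>F n in sequentially. max 0 (1 - real n * infdist x K) = indicator K x"
        proof (cases "x \<in> K")
          case True
          then show ?thesis by simp
        next
          case False
          then have pos: "infdist x K > 0"
            using in_closed_iff_infdist_zero[OF K \<open>K \<noteq> {}\<close>, of x] infdist_nonneg[of x K] by linarith
          obtain N where N: "1 / infdist x K < real N" using reals_Archimedean2 by blast
          show ?thesis
          proof (rule eventually_sequentiallyI[of N])
            fix n assume "N \<le> n"
            then have "1 / infdist x K < real n" using N by linarith
            then show "max 0 (1 - real n * infdist x K) = indicator K x"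
              using pos False by (simp add: field_simps)
          qed
        qed
        then have "(\<lambda>n. complex_of_real (max 0 (1 - real n * infdist x K))) \<longlonglongrightarrow> of_real (indicator K x)"
          by (intro tendsto_of_real tendsto_eventually)
        then show "(\<lambda>n. complex_of_real (max 0 (1 - real n * infdist x K))) \<longlonglongrightarrow> indicator K x"
          by (simp add: of_real_indicator)
      qed (intro continuous_real continuous_intros)
    qed (simp add: const)
  next
    case Empty
    then show ?case by (simp add: const)
  next
    case (Compl A)
    show ?case
      by (rule cong[OF diff[OF one Compl.IH]]) (auto simp: indicator_def)
  next
    case (Union A)
    have *: "(\<lambda>x. indicator (\<Union>i<n. A i) x) \<in> Q" for n
    proof (induction n)
      case 0
      then show ?case by (simp add: const)
    next
      case (Suc n)
      have "(\<lambda>x. indicator (\<Union>i<n. A i) x + indicator (A n) x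
               - indicator (\<Union>i<n. A i) x * indicator (A n) x) \<in> Q"
        by (intro diff add mult Suc Union.IH)
      then show ?case
        by (rule cong) (auto simp: indicator_def lessThan_Suc)
    qed
    show ?case
      by (rule lim[of "\<lambda>n x. indicator (\<Union>i<n. A i) x" 1, OF *])
         (simp_all only: LIMSEQ_indicator_UN, simp add: indicator_def)
  qed
qed

lemma borel_measurable:
  assumes f: "f \<in> borel_measurable torus_borel" and B: "\<And>x. x \<in> torus \<Longrightarrow> cmod (f x) \<le> B"
  shows "f \<in> Q"
proof -
  have sp: "space torus_borel = torus" by (simp add: space_restrict_space)
  obtain F where F: "\<And>i. simple_function torus_borel (F i)"
    and conv: "\<And>x. x \<in> torus \<Longrightarrow> (\<lambda>i. F i x) \<longlonglongrightarrow> f x"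
    and bd: "\<And>i x. x \<in> torus \<Longrightarrow> dist (F i x) 0 \<le> 2 * dist (f x) 0"
    using borel_measurable_implies_sequence_metric[OF f, of 0] unfolding sp by blast
  show ?thesis
  proof (rule lim[of F "2 * B"])
    fix i
    have fin: "finite (F i ` torus)" using F[of i] by (simp add: simple_function_def sp)
    \<comment> \<open>Level sets are Borel in the torus, whereas \<open>indicator_borel\<close>
      speaks of Borel sets of the ambient space, of which they are traces.\<close>
    have "\<exists>B\<in>sets borel. F i -` {y} \<inter> torus = torus \<inter> B" if "y \<in> F i ` torus" for y
    proof -
      have "F i -` {y} \<inter> torus \<in> sets torus_borel"
        using F[of i] that unfolding simple_function_def sp by blast
      then show ?thesis unfolding sets_restrict_space by (auto simp only: image_iff)
    qed
    then obtain B where B: "\<And>y. y \<in> F i ` torus \<Longrightarrow> B y \<in> sets borel"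
      and eq: "\<And>y. y \<in> F i ` torus \<Longrightarrow> F i -` {y} \<inter> torus = torus \<inter> B y"
      by metis
    have "(\<lambda>x. \<Sum>y\<in>F i ` torus. y * indicator (B y) x) \<in> Q"
      by (rule sum'[OF fin], rule scale, rule indicator_borel, rule B)
    then show "F i \<in> Q"
    proof (rule cong)
      fix x assume x: "x \<in> torus"
      have "(\<Sum>y\<in>F i ` torus. y * indicator (B y) x) = (\<Sum>y\<in>F i ` torus. if y = F i x then y else 0)"
      proof (rule sum.cong[OF refl])
        fix y assume y: "y \<in> F i ` torus"
        have "x \<in> F i -` {y} \<inter> torus \<longleftrightarrow> x \<in> torus \<inter> B y" by (simp only: eq[OF y])
        then have "x \<in> B y \<longleftrightarrow> y = F i x"
          using x by (simp only: Int_iff vimage_singleton_eq simp_thms) blast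
        then show "y * indicator (B y) x = (if y = F i x then y else 0)"
          by (simp add: indicator_def)
      qed
      also have "\<dots> = F i x"
        using fin imageI[OF x, of "F i"] by (simp only: sum.delta if_True)
      finally show "F i x = (\<Sum>y\<in>F i ` torus. y * indicator (B y) x)" ..
    qed
  next
    fix i x assume "x \<in> torus"
    then show "cmod (F i x) \<le> 2 * B" using bd[of x i] B[of x] by simp
  qed (rule conv)
qed

end

text \<open>Difference quotients in the parameter \<open>v\<close> produce a factor
  \<open>\<phi>\<close>, and partial fractions produce a product of two resolvents;
  \<open>v = 0\<close> in the former and coinciding parameters in the latter are reached as limits.
  In this way resolvents, all that the Cauchy kernels provide, generate powers of
  \<open>\<phi>\<close>.\<close>

lemma (in bp_closed) resolvent_step:
  fixes \<phi> :: "'a \<Rightarrow> complex"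
  assumes \<phi>: "\<And>x. x \<in> T \<Longrightarrow> cmod (\<phi> x) \<le> 1"
    and g: "\<And>x. x \<in> T \<Longrightarrow> cmod (g x) \<le> B"
    and res: "\<And>v. cmod v < 1 \<Longrightarrow> (\<lambda>x. g x / (1 - \<phi> x * v)) \<in> Q"
  shows "cmod v < 1 \<Longrightarrow> (\<lambda>x. \<phi> x * g x / (1 - \<phi> x * v)) \<in> Q"
    and "cmod v < 1 \<Longrightarrow> cmod v' < 1 \<Longrightarrow> (\<lambda>x. g x / ((1 - \<phi> x * v') * (1 - \<phi> x * v))) \<in> Q"
proof -
  have ge: "1 - cmod v \<le> cmod (1 - \<phi> x * v)" if "x \<in> T" for x v
  proof -
    have "cmod (\<phi> x * v) \<le> cmod v"
      using mult_right_mono[OF \<phi>[OF that], of "cmod v"] by (simp add: norm_mult)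
    then show ?thesis using norm_triangle_ineq2[of 1 "\<phi> x * v"] by simp
  qed
  have nz: "1 - \<phi> x * v \<noteq> 0" if "x \<in> T" "cmod v < 1" for x v
    using ge[OF that(1), of v] that(2) by auto
  have step: "(\<lambda>x. \<phi> x * g x / (1 - \<phi> x * v)) \<in> Q" if v: "cmod v < 1" "v \<noteq> 0" for v
  proof -
    have "(\<lambda>x. (1 / v) * (g x / (1 - \<phi> x * v) - g x / (1 - \<phi> x * 0))) \<in> Q"
      by (rule scale[OF diff[OF res[OF v(1)] res]]) simp
    then show ?thesis
      by (rule cong) (use nz[OF _ v(1)] v(2) in \<open>simp add: field_simps\<close>)
  qed
  have step0: "(\<lambda>x. \<phi> x * g x / (1 - \<phi> x * 0)) \<in> Q"
  proof (rule lim_at[of 0 "ball 0 (1/2) - {0}" "\<lambda>v x. \<phi> x * g x / (1 - \<phi> x * v)" "2 * B"])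
    show "at (0::complex) within ball 0 (1/2) - {0} \<noteq> bot"
      by (simp add: trivial_limit_within islimpt_punctured[symmetric] islimpt_ball)
    show "((\<lambda>v. \<phi> x * g x / (1 - \<phi> x * v)) \<longlongrightarrow> \<phi> x * g x / (1 - \<phi> x * 0)) (at 0 within ball 0 (1/2) - {0})"
      for x by (intro tendsto_intros) auto
    fix v :: complex and x assume v: "v \<in> ball 0 (1/2) - {0}" and x: "x \<in> T"
    then have "1/2 \<le> cmod (1 - \<phi> x * v)" using ge[OF x, of v] by simp
    moreover have "cmod (\<phi> x * g x) \<le> B"
      using mult_mono[OF \<phi>[OF x] g[OF x]] by (simp add: norm_mult)
    ultimately show "cmod (\<phi> x * g x / (1 - \<phi> x * v)) \<le> 2 * B"
      using frac_le[of B "cmod (\<phi> x * g x)" "1/2" "cmod (1 - \<phi> x * v)"] norm_ge_zero[of "\<phi> x * g x"]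
      by (simp add: norm_divide)
  qed (rule step; simp)
  show "(\<lambda>x. \<phi> x * g x / (1 - \<phi> x * v)) \<in> Q" if "cmod v < 1" for v
    using step[OF that] step0 by (cases "v = 0") auto
  \<comment> \<open>Partial fractions, from
    \<open>v * (1 - \<phi> x * v') - v' * (1 - \<phi> x * v) = v - v'\<close>.\<close>
  have distinct: "(\<lambda>x. g x / ((1 - \<phi> x * v') * (1 - \<phi> x * v))) \<in> Q"
    if v: "cmod v < 1" "cmod v' < 1" "v \<noteq> v'" for v v'
  proof -
    have "(\<lambda>x. (1 / (v - v')) * (v * (g x / (1 - \<phi> x * v)) - v' * (g x / (1 - \<phi> x * v')))) \<in> Q"
      by (rule scale, rule diff; rule scale; rule res; fact)
    then show ?thesis
    proof (rule cong)
      fix x assume x: "x \<in> T"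
      show "g x / ((1 - \<phi> x * v') * (1 - \<phi> x * v)) =
          (1 / (v - v')) * (v * (g x / (1 - \<phi> x * v)) - v' * (g x / (1 - \<phi> x * v')))"
        using nz[OF x v(1)] nz[OF x v(2)] v(3) by (simp add: divide_simps) (simp add: algebra_simps)
    qed
  qed
  have same: "(\<lambda>x. g x / ((1 - \<phi> x * v) * (1 - \<phi> x * v))) \<in> Q" if v: "cmod v < 1" for v
  proof -
    \<comment> \<open>Half the distance from \<open>v\<close> to the circle: for \<open>w\<close> in
      \<open>ball v d\<close> both denominators stay above \<open>d\<close>.\<close>
    define d where "d = (1 - cmod v) / 2"
    have d: "d > 0" "cmod v + d < 1" "1 - cmod v = 2 * d" using v by (auto simp: d_def field_simps)
    have le: "d \<le> cmod (1 - \<phi> x * w)" if "x \<in> T" "w \<in> ball v d" for x w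
    proof -
      have "cmod w \<le> cmod v + d"
        using that(2) norm_triangle_sub[of w v] by (simp add: dist_norm norm_minus_commute)
      then show ?thesis using ge[OF that(1), of w] d by linarith
    qed
    show ?thesis
    proof (rule lim_at[of v "ball v d - {v}" "\<lambda>w x. g x / ((1 - \<phi> x * w) * (1 - \<phi> x * v))" "B / (d * d)"])
      show "at v within ball v d - {v} \<noteq> bot"
        using d by (simp add: trivial_limit_within islimpt_punctured[symmetric] islimpt_ball)
      show "((\<lambda>w. g x / ((1 - \<phi> x * w) * (1 - \<phi> x * v))) \<longlongrightarrow> g x / ((1 - \<phi> x * v) * (1 - \<phi> x * v)))
          (at v within ball v d - {v})" if "x \<in> T" for x
        using nz[OF that v] by (intro tendsto_intros) auto
    next
      fix w assume w: "w \<in> ball v d - {v}"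
      have "cmod w < cmod v + d"
        using w norm_triangle_sub[of w v] by (simp add: dist_norm norm_minus_commute)
      then show "(\<lambda>x. g x / ((1 - \<phi> x * w) * (1 - \<phi> x * v))) \<in> Q"
        using d w by (intro distinct v) auto
      fix x assume x: "x \<in> T"
      have "d * d \<le> cmod ((1 - \<phi> x * w) * (1 - \<phi> x * v))"
        unfolding norm_mult using le[OF x, of w] le[OF x, of v] w d by (intro mult_mono) auto
      then show "cmod (g x / ((1 - \<phi> x * w) * (1 - \<phi> x * v))) \<le> B / (d * d)"
        unfolding norm_divide using g[OF x] d order_trans[OF norm_ge_zero g[OF x]]
        by (intro frac_le) auto
    qed
  qed
  show "(\<lambda>x. g x / ((1 - \<phi> x * v') * (1 - \<phi> x * v))) \<in> Q" if "cmod v < 1" "cmod v' < 1" for v v'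
    using distinct[OF that] same[OF that(1)] by (cases "v = v'") auto
qed

section \<open>The algebra generated by the Cauchy kernels\<close>

definition cauchy_sum ::
    "(complex \<times> (complex \<times> complex)) list \<Rightarrow> complex \<times> complex \<Rightarrow> complex" where
  "cauchy_sum xs \<zeta> = (\<Sum>(c, w)\<leftarrow>xs. c * cauchy_kernel \<zeta> w)"

text \<open>Lists encode finite combinations, so that appending and rescaling give the vector space
  operations; repeated points do no harm.\<close>

definition cauchy_span :: "(complex \<times> complex \<Rightarrow> complex) set" where
  "cauchy_span = cauchy_sum ` {xs. snd ` set xs \<subseteq> bidisc}"

abbreviation bp_cauchy :: "(complex \<times> complex \<Rightarrow> complex) set" where
  "bp_cauchy \<equiv> bp_closure torus cauchy_span"

lemma one_minus_mult_nonzero: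
  fixes z w :: complex
  assumes "cmod z \<le> 1" "cmod w < 1"
  shows "1 - z * w \<noteq> 0"
proof
  assume "1 - z * w = 0"
  then have "cmod z * cmod w = 1" by (metis norm_mult norm_one right_minus_eq)
  moreover have "cmod z * cmod w \<le> cmod w" using assms by (simp add: mult_left_le_one_le)
  ultimately show False using assms by simp
qed

lemma cauchy_kernel_continuous:
  assumes "w \<in> bidisc"
  shows "continuous_on (cball 0 1 \<times> cball 0 1) (\<lambda>\<zeta>. cauchy_kernel \<zeta> w)"
proof -
  have "\<forall>\<zeta>\<in>cball 0 1 \<times> cball 0 1. 1 - fst \<zeta> * cnj (fst w) \<noteq> 0"
    "\<forall>\<zeta>\<in>cball 0 1 \<times> cball 0 1. 1 - snd \<zeta> * cnj (snd w) \<noteq> 0"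
    using assms by (auto simp del: right_minus_eq simp: one_minus_mult_nonzero)
  then show ?thesis unfolding cauchy_kernel_def by (intro continuous_intros)
qed

lemma cauchy_sum_continuous:
  assumes "snd ` set xs \<subseteq> bidisc"
  shows "continuous_on (cball 0 1 \<times> cball 0 1) (cauchy_sum xs)"
proof -
  have "continuous_on (cball 0 1 \<times> cball 0 1) (\<lambda>\<zeta>. \<Sum>(c, w)\<leftarrow>xs. c * cauchy_kernel \<zeta> w)"
    using assms by (induction xs) (auto intro!: continuous_intros cauchy_kernel_continuous)
  then show ?thesis by (simp add: cauchy_sum_def[abs_def])
qed

lemma continuous_torus_bounded:
  fixes f :: "complex \<times> complex \<Rightarrow> 'b::real_normed_vector"
  assumes "continuous_on torus f"
  obtains B where "B > 0" "\<And>\<zeta>. \<zeta> \<in> torus \<Longrightarrow> norm (f \<zeta>) \<le> B"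
proof -
  have "compact (f ` torus)" by (intro compact_continuous_image assms compact_Times) auto
  then obtain B where "B > 0" "\<forall>y\<in>f ` torus. norm y \<le> B"
    using compact_imp_bounded bounded_pos by metis
  then show ?thesis using that by blast
qed

lemma torus_subset_cball: "torus \<subseteq> cball 0 1 \<times> cball 0 1"
  by auto

lemma cauchy_sum_Nil: "cauchy_sum [] = (\<lambda>_. 0)"
  and cauchy_sum_Cons: "cauchy_sum ((c, w) # xs) = (\<lambda>\<zeta>. c * cauchy_kernel \<zeta> w + cauchy_sum xs \<zeta>)"
  and cauchy_sum_append: "cauchy_sum (xs @ ys) = (\<lambda>\<zeta>. cauchy_sum xs \<zeta> + cauchy_sum ys \<zeta>)"
  and cauchy_sum_scale: "cauchy_sum (map (\<lambda>(d, w). (c * d, w)) xs) = (\<lambda>\<zeta>. c * cauchy_sum xs \<zeta>)"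
  by (auto simp: cauchy_sum_def fun_eq_iff sum_list_const_mult[symmetric] o_def case_prod_unfold mult.assoc)

interpretation bp_cauchy: bp_closed torus bp_cauchy
proof (rule bp_closed_bp_closure)
  fix f assume "f \<in> cauchy_span"
  then obtain xs where xs: "f = cauchy_sum xs" "snd ` set xs \<subseteq> bidisc" by (auto simp: cauchy_span_def)
  show "\<exists>B. \<forall>x\<in>torus. cmod (f x) \<le> B"
    using continuous_torus_bounded[OF continuous_on_subset[OF cauchy_sum_continuous[OF xs(2)] torus_subset_cball]]
    unfolding xs(1) by metis
next
  fix f g assume "f \<in> cauchy_span" "g \<in> cauchy_span"
  then obtain xs ys where "f = cauchy_sum xs" "snd ` set xs \<subseteq> bidisc"
    "g = cauchy_sum ys" "snd ` set ys \<subseteq> bidisc" by (auto simp: cauchy_span_def)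
  then show "(\<lambda>x. f x + g x) \<in> cauchy_span"
    unfolding cauchy_span_def by (intro image_eqI[of _ _ "xs @ ys"]) (auto simp: cauchy_sum_append)
next
  fix f c assume "f \<in> cauchy_span"
  then obtain xs where "f = cauchy_sum xs" "snd ` set xs \<subseteq> bidisc" by (auto simp: cauchy_span_def)
  then show "(\<lambda>x. c * f x) \<in> cauchy_span"
    unfolding cauchy_span_def
    by (intro image_eqI[of _ _ "map (\<lambda>(d, w). (c * d, w)) xs"]) (auto simp: cauchy_sum_scale)
qed

lemma cauchy_kernel_in_bp_cauchy:
  assumes "w \<in> bidisc" shows "(\<lambda>\<zeta>. cauchy_kernel \<zeta> w) \<in> bp_cauchy"
proof (rule bp_closure.base)
  show "(\<lambda>\<zeta>. cauchy_kernel \<zeta> w) \<in> cauchy_span"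
    unfolding cauchy_span_def
    by (rule image_eqI[of _ _ "[(1, w)]"]) (use assms in \<open>auto simp: cauchy_sum_def\<close>)
qed

lemma resolvents_in_bp_cauchy:
  assumes "cmod u < 1" "cmod v < 1"
  shows "(\<lambda>\<zeta>. 1 / (1 - fst \<zeta> * u) / (1 - snd \<zeta> * v)) \<in> bp_cauchy"
  using cauchy_kernel_in_bp_cauchy[of "(cnj u, cnj v)"] assms by (simp add: cauchy_kernel_def)

lemma resolvent_bound:
  assumes "cmod z = 1" "cmod v < 1"
  shows "cmod (1 / (1 - z * v)) \<le> 1 / (1 - cmod v)"
proof -
  have "1 - cmod v \<le> cmod (1 - z * v)"
    using norm_triangle_ineq2[of 1 "z * v"] assms by (simp add: norm_mult)
  then show ?thesis using assms by (simp add: norm_divide frac_le)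
qed

text \<open>\<open>resolvent_step\<close> at \<open>v = 0\<close> with \<open>g = 1\<close>: the
  coordinate is the derivative of the resolvents in their parameter at the origin.\<close>

lemma fst_in_bp_cauchy: "fst \<in> bp_cauchy"
proof -
  have "(\<lambda>\<zeta>. fst \<zeta> * 1 / (1 - fst \<zeta> * 0)) \<in> bp_cauchy"
    by (rule bp_cauchy.resolvent_step(1)[of _ _ 1])
       (use resolvents_in_bp_cauchy[of _ 0] in auto)
  then show ?thesis by simp
qed

lemma snd_in_bp_cauchy: "snd \<in> bp_cauchy"
proof -
  have "(\<lambda>\<zeta>. snd \<zeta> * 1 / (1 - snd \<zeta> * 0)) \<in> bp_cauchy"
    by (rule bp_cauchy.resolvent_step(1)[of _ _ 1])
       (use resolvents_in_bp_cauchy[of 0] in auto)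
  then show ?thesis by simp
qed

text \<open>Resolvents of the first coordinate are multiplied while a resolvent of the second is
  carried along as the factor \<open>g\<close>; then the roles are exchanged.\<close>

lemma cauchy_kernel_mult_in_bp_cauchy:
  assumes "w \<in> bidisc" "w' \<in> bidisc"
  shows "(\<lambda>\<zeta>. cauchy_kernel \<zeta> w * cauchy_kernel \<zeta> w') \<in> bp_cauchy"
proof -
  obtain u v u' v' where w: "w = (cnj u, cnj v)" "w' = (cnj u', cnj v')"
    by (metis complex_cnj_cnj surj_pair)
  have uv: "cmod u < 1" "cmod v < 1" "cmod u' < 1" "cmod v' < 1" using assms w by auto
  have first: "(\<lambda>\<zeta>. (1 / (1 - snd \<zeta> * y)) / ((1 - fst \<zeta> * u) * (1 - fst \<zeta> * u'))) \<in> bp_cauchy"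
    if y: "cmod y < 1" for y
  proof (rule bp_cauchy.resolvent_step(2)[of _ _ "1 / (1 - cmod y)"])
    show "(\<lambda>\<zeta>. 1 / (1 - snd \<zeta> * y) / (1 - fst \<zeta> * x)) \<in> bp_cauchy" if "cmod x < 1" for x
      using resolvents_in_bp_cauchy[OF that y] by (simp add: mult.commute)
  qed (use uv resolvent_bound[OF _ y] in auto)
  have "(\<lambda>\<zeta>. (1 / ((1 - fst \<zeta> * u) * (1 - fst \<zeta> * u'))) / ((1 - snd \<zeta> * v) * (1 - snd \<zeta> * v'))) \<in> bp_cauchy"
  proof (rule bp_cauchy.resolvent_step(2)[of _ _ "1 / (1 - cmod u) * (1 / (1 - cmod u'))"])
    fix \<zeta> assume z: "\<zeta> \<in> torus"
    have "cmod (1 / (1 - fst \<zeta> * u)) * cmod (1 / (1 - fst \<zeta> * u')) \<le> 1 / (1 - cmod u) * (1 / (1 - cmod u'))"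
      using z uv by (intro mult_mono resolvent_bound) auto
    then show "cmod (1 / ((1 - fst \<zeta> * u) * (1 - fst \<zeta> * u'))) \<le> 1 / (1 - cmod u) * (1 / (1 - cmod u'))"
      by (simp add: norm_divide norm_mult)
  next
    show "(\<lambda>\<zeta>. 1 / ((1 - fst \<zeta> * u) * (1 - fst \<zeta> * u')) / (1 - snd \<zeta> * y)) \<in> bp_cauchy"
      if "cmod y < 1" for y
      using first[OF that] by (simp add: mult.commute mult.left_commute)
  qed (use uv in auto)
  then show ?thesis by (simp add: w cauchy_kernel_def mult.commute mult.left_commute)
qed

lemma cauchy_sum_mult_in_bp_cauchy:
  assumes "snd ` set xs \<subseteq> bidisc" "snd ` set ys \<subseteq> bidisc"
  shows "(\<lambda>\<zeta>. cauchy_sum xs \<zeta> * cauchy_sum ys \<zeta>) \<in> bp_cauchy"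
proof -
  have zero: "(\<lambda>\<zeta>. 0) \<in> bp_cauchy"
    using bp_cauchy.scale[OF fst_in_bp_cauchy, of 0] by simp
  have one: "(\<lambda>\<zeta>. cauchy_kernel \<zeta> w * cauchy_sum ys \<zeta>) \<in> bp_cauchy" if w: "w \<in> bidisc" for w
    using assms(2)
  proof (induction ys)
    case Nil
    then show ?case using zero by (simp add: cauchy_sum_Nil)
  next
    case (Cons y ys)
    obtain c v where y: "y = (c, v)" by (cases y)
    have "(\<lambda>\<zeta>. c * (cauchy_kernel \<zeta> w * cauchy_kernel \<zeta> v) + cauchy_kernel \<zeta> w * cauchy_sum ys \<zeta>) \<in> bp_cauchy"
      by (rule bp_cauchy.add[OF bp_cauchy.scale[OF cauchy_kernel_mult_in_bp_cauchy]])
         (use Cons y w in auto)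
    then show ?case by (simp add: y cauchy_sum_Cons algebra_simps)
  qed
  show ?thesis
    using assms(1)
  proof (induction xs)
    case Nil
    then show ?case using zero by (simp add: cauchy_sum_Nil)
  next
    case (Cons x xs)
    obtain c v where x: "x = (c, v)" by (cases x)
    have "(\<lambda>\<zeta>. c * (cauchy_kernel \<zeta> v * cauchy_sum ys \<zeta>) + cauchy_sum xs \<zeta> * cauchy_sum ys \<zeta>) \<in> bp_cauchy"
      by (rule bp_cauchy.add[OF bp_cauchy.scale[OF one]]) (use Cons x in auto)
    then show ?case by (simp add: x cauchy_sum_Cons algebra_simps)
  qed
qed

interpretation bp_cauchy: bp_algebra bp_cauchy
proof
  have "(\<lambda>\<zeta>. cauchy_kernel \<zeta> (0, 0)) \<in> bp_cauchy" by (rule cauchy_kernel_in_bp_cauchy) auto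
  then show "(\<lambda>_. 1) \<in> bp_cauchy" by (simp add: cauchy_kernel_def)
  have base: "(\<lambda>x. f x * g x) \<in> bp_cauchy" if "f \<in> cauchy_span" "g \<in> cauchy_span" for f g
    using that cauchy_sum_mult_in_bp_cauchy unfolding cauchy_span_def by blast
  show "(\<lambda>x. f x * g x) \<in> bp_cauchy" if "f \<in> bp_cauchy" "g \<in> bp_cauchy" for f g
    by (rule bp_closure_mult[OF bp_cauchy.bp_closed_axioms base that])
qed

section \<open>Inverses, and polynomials without zeros in the bidisc\<close>

lemma (in bp_algebra) inverse_perturb:
  assumes g: "(\<lambda>x. 1 / g x) \<in> Q" and fg: "(\<lambda>x. g x - f x) \<in> Q"
    and close: "\<And>x. x \<in> torus \<Longrightarrow> cmod (g x - f x) \<le> cmod (g x) / 2"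
    and nz: "\<And>x. x \<in> torus \<Longrightarrow> g x \<noteq> 0"
  shows "(\<lambda>x. 1 / f x) \<in> Q"
proof -
  obtain B where B: "\<forall>x\<in>torus. cmod (1 / g x) \<le> B" using bounded[OF g] by blast
  \<comment> \<open>\<open>1 / f = (1 / g) / (1 - t)\<close>, and
    \<open>cmod (t x) \<le> 1/2\<close> bounds all partial sums of the Neumann series by 2.\<close>
  define t where "t x = (g x - f x) * (1 / g x)" for x
  have t: "t \<in> Q" unfolding t_def by (rule mult[OF fg g])
  have t_le: "cmod (t x) \<le> 1/2" if "x \<in> torus" for x
    using close[OF that] nz[OF that] by (simp add: t_def norm_divide field_simps)
  show ?thesis
  proof (rule lim[of "\<lambda>n x. (1 / g x) * (\<Sum>i<n. t x ^ i)" "B * 2"])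
    show "(\<lambda>x. (1 / g x) * (\<Sum>i<n. t x ^ i)) \<in> Q" for n
      by (rule mult[OF g]) (rule sum', simp, rule power, rule t)
    fix x assume x: "x \<in> torus"
    have "cmod (\<Sum>i<n. t x ^ i) \<le> 2" for n
    proof -
      have "cmod (\<Sum>i<n. t x ^ i) \<le> (\<Sum>i<n. (1/2) ^ i)"
        using t_le[OF x] by (intro sum_norm_le) (simp add: norm_power power_mono)
      also have "\<dots> \<le> (\<Sum>i. (1/2) ^ i)"
        by (rule sum_le_suminf) (auto simp: summable_geometric)
      also have "\<dots> = (2::real)" by (subst suminf_geometric) auto
      finally show ?thesis .
    qed
    then show "cmod ((1 / g x) * (\<Sum>i<n. t x ^ i)) \<le> B * 2" for n
      unfolding norm_mult using B x
      by (intro mult_mono) (auto intro: order_trans[OF norm_ge_zero])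
    have "(\<lambda>i. t x ^ i) sums (1 / (1 - t x))"
      using t_le[OF x] by (intro geometric_sums) simp
    then have "(\<lambda>n. (1 / g x) * (\<Sum>i<n. t x ^ i)) \<longlonglongrightarrow> (1 / g x) * (1 / (1 - t x))"
      unfolding sums_def by (intro tendsto_intros)
    moreover have "(1 / g x) * (1 / (1 - t x)) = 1 / f x"
      using nz[OF x] by (simp add: t_def field_simps)
    ultimately show "(\<lambda>n. (1 / g x) * (\<Sum>i<n. t x ^ i)) \<longlonglongrightarrow> 1 / f x" by simp
  qed
qed

text \<open>Continuation in the dilation parameter: the inverse of a constant is carried along
  \<open>t \<mapsto> q (t \<zeta>)\<close> by finitely many Neumann series.\<close>

lemma (in bp_algebra) inverse_dilation:
  fixes q :: "complex \<times> complex \<Rightarrow> complex"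
  assumes q: "\<And>t. (\<lambda>\<zeta>. q (t *\<^sub>R \<zeta>)) \<in> Q"
    and cont: "continuous_on UNIV q"
    and nz: "\<And>z. z \<in> bidisc \<Longrightarrow> q z \<noteq> 0"
    and r: "0 \<le> r" "r < 1"
  shows "(\<lambda>\<zeta>. 1 / q (r *\<^sub>R \<zeta>)) \<in> Q"
proof -
  define K where "K = {0..r} \<times> torus"
  define h where "h = (\<lambda>(t, \<zeta>). q (t *\<^sub>R \<zeta>))"
  have K: "compact K" unfolding K_def by (intro compact_Times) auto
  have h: "continuous_on K h"
    unfolding h_def case_prod_unfold
    by (intro continuous_on_compose2[OF cont] continuous_intros) auto
  have nzK: "h x \<noteq> 0" if "x \<in> K" for x
  proof -
    obtain t a b where x: "x = (t, (a, b))" by (metis surj_pair)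
    then have "\<bar>t\<bar> < 1" "cmod a = 1" "cmod b = 1" using that r by (auto simp: K_def)
    then show ?thesis using nz[of "t *\<^sub>R (a, b)"] by (simp add: x h_def)
  qed
  \<comment> \<open>By compactness all dilations up to \<open>r\<close> stay away from 0 uniformly,
    so that a small absolute change is also a small relative one.\<close>
  obtain m where m: "m > 0" "\<And>x. x \<in> K \<Longrightarrow> m \<le> cmod (h x)"
  proof -
    have "continuous_on K (\<lambda>x. cmod (h x))" by (intro continuous_intros h)
    moreover have "K \<noteq> {}" using r by (auto simp: K_def intro!: exI[of _ 1])
    ultimately obtain x0 where "x0 \<in> K" "\<forall>y\<in>K. cmod (h x0) \<le> cmod (h y)"
      using continuous_attains_inf[OF K] by blast
    then show ?thesis using that[of "cmod (h x0)"] nzK by auto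
  qed
  obtain d where d: "d > 0" "\<And>x y. x \<in> K \<Longrightarrow> y \<in> K \<Longrightarrow> dist y x < d \<Longrightarrow> dist (h y) (h x) < m / 2"
    using compact_uniformly_continuous[OF h K] m(1) unfolding uniformly_continuous_on_def
    by (metis half_gt_zero)
  \<comment> \<open>A step of length \<open>r / N\<close> changes \<open>q\<close> by less than
    \<open>m / 2\<close>, hence by at most half its modulus, as \<open>inverse_perturb\<close>
    requires.\<close>
  obtain N :: nat where N: "N > 0" "r / N < d"
    using reals_Archimedean2[of "r / d"] d r
    by (metis divide_less_eq gr0I less_divide_eq mult.commute of_nat_0 of_nat_0_less_iff
        divide_nonneg_pos not_less of_nat_0_le_iff)
  have "(\<lambda>\<zeta>. 1 / q ((r * n / N) *\<^sub>R \<zeta>)) \<in> Q" if "n \<le> N" for n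
    using that
  proof (induction n)
    case 0
    then show ?case using const[of "1 / q 0"] by (simp add: zero_prod_def)
  next
    case (Suc n)
    have mem: "(r * k / N, \<zeta>) \<in> K" if "k \<le> N" "\<zeta> \<in> torus" for k \<zeta>
    proof -
      have "r * k / N \<le> r" using that(1) N r by (simp add: field_simps mult_left_mono)
      then show ?thesis using that(2) r by (auto simp: K_def)
    qed
    show ?case
    proof (rule inverse_perturb[of "\<lambda>\<zeta>. q ((r * n / N) *\<^sub>R \<zeta>)"])
      show "(\<lambda>\<zeta>. 1 / q ((r * n / N) *\<^sub>R \<zeta>)) \<in> Q" using Suc by simp
      show "(\<lambda>\<zeta>. q ((r * n / N) *\<^sub>R \<zeta>) - q ((r * Suc n / N) *\<^sub>R \<zeta>)) \<in> Q" by (intro diff q)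
      fix \<zeta> assume z: "\<zeta> \<in> torus"
      have "dist (r * n / N, \<zeta>) (r * Suc n / N, \<zeta>) = r / N"
      proof -
        have "r * n / N - r * Suc n / N = - (r / N)" by (simp add: diff_divide_distrib[symmetric] algebra_simps)
        then show ?thesis using r by (simp add: dist_prod_def dist_real_def)
      qed
      then have "dist (h (r * n / N, \<zeta>)) (h (r * Suc n / N, \<zeta>)) < m / 2"
        using Suc.prems z N by (intro d mem) auto
      moreover have "m \<le> cmod (h (r * n / N, \<zeta>))" using Suc.prems z by (intro m mem) auto
      ultimately show "cmod (q ((r * n / N) *\<^sub>R \<zeta>) - q ((r * Suc n / N) *\<^sub>R \<zeta>))
          \<le> cmod (q ((r * n / N) *\<^sub>R \<zeta>)) / 2"
        by (simp add: h_def dist_norm)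
      show "q ((r * n / N) *\<^sub>R \<zeta>) \<noteq> 0" using nzK[OF mem[of n]] Suc.prems z by (simp add: h_def)
    qed
  qed
  from this[of N] show ?thesis using N by simp
qed

text \<open>Roots are split off one at a time. A root \<open>a\<close> has modulus at least 1, so
  \<open>1 - r \<le> \<bar>r - a\<bar>\<close> and therefore
  \<open>\<bar>1 - a\<bar> \<le> 2 * \<bar>r - a\<bar>\<close>: each linear factor costs a
  2.\<close>

lemma zero_free_poly_dilation_bound:
  fixes s :: "complex poly"
  assumes "\<And>z. cmod z < 1 \<Longrightarrow> poly s z \<noteq> 0" "0 \<le> r" "r < 1"
  shows "cmod (poly s 1) \<le> 2 ^ degree s * cmod (poly s (of_real r))"
  using assms(1)
proof (induction "degree s" arbitrary: s)
  case 0
  then obtain c where "s = [:c:]" using degree_eq_zeroE by metis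
  then show ?case by simp
next
  case (Suc n)
  then have "\<not> constant (poly s)" by (simp add: constant_degree)
  then obtain a where a: "poly s a = 0" using fundamental_theorem_of_algebra by blast
  then obtain t where t: "s = [:-a, 1:] * t" by (meson dvdE poly_eq_0_iff_dvd)
  have "s \<noteq> 0" using Suc by auto
  then have "t \<noteq> 0" using t by auto
  then have deg: "degree s = Suc (degree t)" 
    unfolding t by (subst degree_mult_eq) auto
  have "cmod (poly t 1) \<le> 2 ^ degree t * cmod (poly t (of_real r))"
    using Suc.hyps(1)[of t] Suc.hyps(2) Suc.prems deg by (auto simp: t)
  moreover have "cmod (1 - a) \<le> 2 * cmod (of_real r - a)"
  proof -
    have "cmod a \<ge> 1" using a Suc.prems by force
    then have "1 - r \<le> cmod (of_real r - a)"
      using norm_triangle_ineq3[of a "of_real r"] assms by (simp add: norm_minus_commute)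
    moreover have "cmod (1 - a) \<le> cmod (1 - of_real r) + cmod (of_real r - a)"
      using norm_triangle_ineq[of "1 - of_real r" "of_real r - a"] by simp
    moreover have "cmod (1 - of_real r) = 1 - r"
      using assms by (metis abs_of_nonneg diff_ge_0_iff_ge less_imp_le norm_of_real of_real_1 of_real_diff)
    ultimately show ?thesis by linarith
  qed
  ultimately have "cmod (1 - a) * cmod (poly t 1)
      \<le> (2 * cmod (of_real r - a)) * (2 ^ degree t * cmod (poly t (of_real r)))"
    by (intro mult_mono) auto
  moreover have "poly s z = (z - a) * poly t z" for z by (simp add: t algebra_simps)
  ultimately show ?case by (simp add: deg norm_mult mult_ac)
qed

text \<open>\<open>m\<close> and \<open>n\<close> only bound the degrees. Hence the difference of
  the reflection and \<alpha> times \<open>p\<close> is covered whatever cancels, and the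
  restrictions to the axes are again of this form, with \<open>m = 0\<close> or
  \<open>n = 0\<close>.\<close>

definition bipoly :: "nat \<Rightarrow> nat \<Rightarrow> (nat \<Rightarrow> nat \<Rightarrow> complex) \<Rightarrow> complex \<times> complex \<Rightarrow> complex" where
  "bipoly m n c z = (\<Sum>k\<le>n. \<Sum>j\<le>m. c j k * fst z ^ j * snd z ^ k)"

lemma continuous_bipoly [continuous_intros]:
  "continuous_on S f \<Longrightarrow> continuous_on S (\<lambda>x. bipoly m n c (f x))"
  unfolding bipoly_def by (intro continuous_intros)

lemma bipoly_in_bp_cauchy: "bipoly m n c \<in> bp_cauchy"
proof -
  have "(\<lambda>z. \<Sum>k\<le>n. \<Sum>j\<le>m. c j k * (fst z ^ j * snd z ^ k)) \<in> bp_cauchy"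
    by (rule bp_cauchy.sum', simp, rule bp_cauchy.sum', simp, rule bp_cauchy.scale,
        rule bp_cauchy.mult; rule bp_cauchy.power; rule fst_in_bp_cauchy snd_in_bp_cauchy)
  then show ?thesis by (rule bp_cauchy.cong) (simp add: bipoly_def mult.assoc)
qed

lemma bipoly_dilation: "bipoly m n c (t *\<^sub>R z) = bipoly m n (\<lambda>j k. c j k * of_real t ^ (j + k)) z"
  by (simp add: bipoly_def scaleR_conv_of_real power_mult_distrib power_add mult_ac)

text \<open>Restriction to the disc of all \<open>l * z\<close> with
  \<open>\<bar>l\<bar> < 1\<close> gives a polynomial in one variable of degree at most
  \<open>m + n\<close> without zeros there.\<close>

lemma bipoly_dilation_bound:
  assumes nz: "\<And>z. z \<in> bidisc \<Longrightarrow> bipoly m n c z \<noteq> 0"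
    and r: "0 \<le> r" "r < 1" and z: "z \<in> torus"
  shows "cmod (bipoly m n c z) \<le> 2 ^ (m + n) * cmod (bipoly m n c (r *\<^sub>R z))"
proof -
  define s where "s = (\<Sum>k\<le>n. \<Sum>j\<le>m. monom (c j k * fst z ^ j * snd z ^ k) (j + k))"
  have s: "poly s l = bipoly m n c (l * fst z, l * snd z)" for l
    by (simp add: s_def bipoly_def poly_sum poly_monom power_mult_distrib power_add mult_ac)
  have deg: "degree s \<le> m + n"
    unfolding s_def
    by (intro degree_sum_le) (auto intro!: degree_sum_le order_trans[OF degree_monom_le] add_mono)
  have "cmod (poly s 1) \<le> 2 ^ degree s * cmod (poly s (of_real r))"
  proof (rule zero_free_poly_dilation_bound)
    fix l :: complex assume "cmod l < 1"
    then show "poly s l \<noteq> 0" using z unfolding s by (intro nz) (auto simp: norm_mult)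
  qed (use r in auto)
  also have "\<dots> \<le> 2 ^ (m + n) * cmod (poly s (of_real r))"
    using deg by (intro mult_right_mono power_increasing) auto
  finally show ?thesis by (simp add: s scaleR_conv_of_real scaleR_prod_def)
qed

text \<open>Only the product of \<open>g\<close> with the polynomial has to lie in the closure. This
  is the means of reaching functions such as conjugate coordinates, of which merely a polynomial
  multiple is visibly analytic.\<close>

lemma divide_zero_free:
  assumes nz: "\<And>z. z \<in> bidisc \<Longrightarrow> bipoly m n c z \<noteq> 0"
    and gq: "(\<lambda>\<zeta>. g \<zeta> * bipoly m n c \<zeta>) \<in> bp_cauchy"
    and g: "\<And>\<zeta>. \<zeta> \<in> torus \<Longrightarrow> cmod (g \<zeta>) \<le> B"
  shows "(\<lambda>\<zeta>. g \<zeta> * of_bool (bipoly m n c \<zeta> \<noteq> 0)) \<in> bp_cauchy"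
proof (rule bp_cauchy.lim_at[of 1 "{0<..<1}"
      "\<lambda>r \<zeta>. g \<zeta> * bipoly m n c \<zeta> * (1 / bipoly m n c (r *\<^sub>R \<zeta>))" "B * 2 ^ (m + n)"])
  show "at (1::real) within {0<..<1} \<noteq> bot" by (simp add: at_within_eq_bot_iff)
next
  fix r :: real assume r: "r \<in> {0<..<1}"
  show "(\<lambda>\<zeta>. g \<zeta> * bipoly m n c \<zeta> * (1 / bipoly m n c (r *\<^sub>R \<zeta>))) \<in> bp_cauchy"
  proof (rule bp_cauchy.mult[OF gq bp_cauchy.inverse_dilation])
    show "(\<lambda>\<zeta>. bipoly m n c (t *\<^sub>R \<zeta>)) \<in> bp_cauchy" for t
      unfolding bipoly_dilation by (rule bipoly_in_bp_cauchy)
  qed (use r nz in \<open>auto intro!: continuous_intros\<close>)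
  fix \<zeta> assume z: "\<zeta> \<in> torus"
  have "r *\<^sub>R \<zeta> \<in> bidisc" using z r by (auto simp: scaleR_prod_def)
  then have "bipoly m n c (r *\<^sub>R \<zeta>) \<noteq> 0" by (rule nz)
  then have "cmod (bipoly m n c \<zeta> * (1 / bipoly m n c (r *\<^sub>R \<zeta>))) \<le> 2 ^ (m + n)"
    using bipoly_dilation_bound[OF nz _ _ z, of r] r by (simp add: norm_divide field_simps)
  then have "cmod (g \<zeta>) * cmod (bipoly m n c \<zeta> * (1 / bipoly m n c (r *\<^sub>R \<zeta>))) \<le> B * 2 ^ (m + n)"
    using g[OF z] by (intro mult_mono) (auto intro: order_trans[OF norm_ge_zero])
  then show "cmod (g \<zeta> * bipoly m n c \<zeta> * (1 / bipoly m n c (r *\<^sub>R \<zeta>))) \<le> B * 2 ^ (m + n)"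
    by (simp add: norm_mult norm_divide)
next
  fix \<zeta> assume z: "\<zeta> \<in> torus"
  show "((\<lambda>r. g \<zeta> * bipoly m n c \<zeta> * (1 / bipoly m n c (r *\<^sub>R \<zeta>))) \<longlongrightarrow>
      g \<zeta> * of_bool (bipoly m n c \<zeta> \<noteq> 0)) (at 1 within {0<..<1})"
  proof (cases "bipoly m n c \<zeta> = 0")
    case False
    have "continuous_on UNIV (\<lambda>r. bipoly m n c (r *\<^sub>R \<zeta>))" by (intro continuous_intros)
    then have "((\<lambda>r. bipoly m n c (r *\<^sub>R \<zeta>)) \<longlongrightarrow> bipoly m n c (1 *\<^sub>R \<zeta>)) (at 1 within {0<..<1})"
      by (meson UNIV_I continuous_on_def tendsto_within_subset top_greatest)
    then have "((\<lambda>r. g \<zeta> * bipoly m n c \<zeta> * (1 / bipoly m n c (r *\<^sub>R \<zeta>))) \<longlongrightarrow>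
      g \<zeta> * bipoly m n c \<zeta> * (1 / bipoly m n c \<zeta>)) (at 1 within {0<..<1})"
      using False by (intro tendsto_intros) auto
    then show ?thesis using False by simp
  qed simp
qed

lemma nonzero_set_in_bp_cauchy:
  assumes "\<And>z. z \<in> bidisc \<Longrightarrow> bipoly m n c z \<noteq> 0"
  shows "(\<lambda>\<zeta>. of_bool (bipoly m n c \<zeta> \<noteq> 0)) \<in> bp_cauchy"
  using divide_zero_free[OF assms, of "\<lambda>_. 1" 1] bipoly_in_bp_cauchy by simp

lemma zero_set_in_bp_cauchy:
  assumes "\<And>z. z \<in> bidisc \<Longrightarrow> bipoly m n c z \<noteq> 0"
  shows "(\<lambda>\<zeta>. of_bool (bipoly m n c \<zeta> = 0)) \<in> bp_cauchy"
  by (rule bp_cauchy.cong[OF bp_cauchy.diff[OF bp_cauchy.one nonzero_set_in_bp_cauchy[OF assms]]]) auto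

text \<open>If the polynomial \<open>q\<close> with coefficients \<open>c\<close> vanishes on a line
  \<open>\<zeta>1 = a\<close>, then \<open>q (a, \<cdot>)\<close> is identically zero, in particular
  at 0. The last two conditions thus remove all lines contained in the zero set, together with
  points on a few other lines.\<close>

definition curve_part :: "nat \<Rightarrow> nat \<Rightarrow> (nat \<Rightarrow> nat \<Rightarrow> complex) \<Rightarrow> (complex \<times> complex) set" where
  "curve_part m n c = {\<zeta> \<in> torus. bipoly m n c \<zeta> = 0 \<and>
     bipoly m n c (0, snd \<zeta>) \<noteq> 0 \<and> bipoly m n c (fst \<zeta>, 0) \<noteq> 0}"

lemma sum_atMost_shift0: "(\<Sum>j\<le>m. f j) = f 0 + (\<Sum>j<m. f (Suc j))" for f :: "nat \<Rightarrow> complex"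
proof -
  have "{..m} = {..<Suc m}" by auto
  then show ?thesis by (simp only: sum.lessThan_Suc_shift)
qed

lemma bipoly_0_left: "bipoly m n c (0, snd z) = bipoly 0 n c z"
  and bipoly_0_right: "bipoly m n c (fst z, 0) = bipoly m 0 c z"
  by (simp_all add: bipoly_def sum_atMost_shift0)

text \<open>On the zero set of \<open>q\<close> the equation \<open>q = 0\<close> expresses \<open>q (0, \<zeta>\<^sub>2) / \<zeta>\<^sub>1\<close> as a polynomial,
  so that the conjugate coordinates become limits of analytic functions there.\<close>

lemma curve_part_in_bp_cauchy:
  assumes nz: "\<And>z. z \<in> bidisc \<Longrightarrow> bipoly m n c z \<noteq> 0"
    and f: "f \<in> borel_measurable torus_borel" "\<And>\<zeta>. \<zeta> \<in> torus \<Longrightarrow> cmod (f \<zeta>) \<le> B"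
  shows "(\<lambda>\<zeta>. indicator (curve_part m n c) \<zeta> * f \<zeta>) \<in> bp_cauchy"
proof -
  \<comment> \<open>On the torus this is the indicator of \<open>curve_part\<close>, written as a
    product of functions already known to lie in the closure.\<close>
  define e where "e = (\<lambda>\<zeta>. of_bool (bipoly m n c \<zeta> = 0) * of_bool (bipoly 0 n c \<zeta> \<noteq> 0) *
      of_bool (bipoly m 0 c \<zeta> \<noteq> 0) :: complex)"
  have nz1: "bipoly 0 n c z \<noteq> 0" and nz2: "bipoly m 0 c z \<noteq> 0" if "z \<in> bidisc" for z
    using nz[of "(0, snd z)"] nz[of "(fst z, 0)"] that by (auto simp: bipoly_0_left bipoly_0_right)
  note sets = zero_set_in_bp_cauchy[OF nz] nonzero_set_in_bp_cauchy[OF nz1] nonzero_set_in_bp_cauchy[OF nz2]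
  have e: "e \<in> bp_cauchy" unfolding e_def by (intro bp_cauchy.mult sets)
  have ee: "e x * e x = e x" for x by (simp add: e_def)
  have poly1: "(\<lambda>z. \<Sum>k\<le>n. \<Sum>j<m. c (Suc j) k * (fst z ^ j * snd z ^ k)) \<in> bp_cauchy"
   and poly2: "(\<lambda>z. \<Sum>k<n. \<Sum>j\<le>m. c j (Suc k) * (fst z ^ j * snd z ^ k)) \<in> bp_cauchy"
    by (rule bp_cauchy.sum', simp, rule bp_cauchy.sum', simp, rule bp_cauchy.scale,
        rule bp_cauchy.mult; rule bp_cauchy.power; rule fst_in_bp_cauchy snd_in_bp_cauchy)+
  have split1: "bipoly m n c z = bipoly 0 n c z + fst z * (\<Sum>k\<le>n. \<Sum>j<m. c (Suc j) k * (fst z ^ j * snd z ^ k))" for z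
    by (simp add: bipoly_def sum_atMost_shift0[of _ m] sum.distrib sum_distrib_left mult_ac)
  have split2: "bipoly m n c z = bipoly m 0 c z + snd z * (\<Sum>k<n. \<Sum>j\<le>m. c j (Suc k) * (fst z ^ j * snd z ^ k))" for z
    by (simp add: bipoly_def sum_atMost_shift0[of _ n] sum.distrib sum_distrib_left mult_ac)
  have conj_eq: "cnj w * a = - b" if "a + w * b = 0" "cmod w = 1" for a b w :: complex
  proof -
    have "cnj w * w = 1" using that(2) by (simp add: mult.commute complex_norm_square[symmetric])
    then have "cnj w * (a + w * b) = cnj w * a + b" by (simp add: algebra_simps flip: mult.assoc)
    then show ?thesis using that(1) by (simp add: eq_neg_iff_add_eq_0)
  qed
  have "(\<lambda>\<zeta>. (of_bool (bipoly m n c \<zeta> = 0) * cnj (fst \<zeta>)) * of_bool (bipoly 0 n c \<zeta> \<noteq> 0)) \<in> bp_cauchy"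
  proof (rule divide_zero_free[OF nz1, where B = 1])
    have "(\<lambda>\<zeta>. of_bool (bipoly m n c \<zeta> = 0) * (- 1 * (\<Sum>k\<le>n. \<Sum>j<m. c (Suc j) k * (fst \<zeta> ^ j * snd \<zeta> ^ k)))) \<in> bp_cauchy"
      by (intro bp_cauchy.mult sets bp_cauchy.scale poly1)
    then show "(\<lambda>\<zeta>. of_bool (bipoly m n c \<zeta> = 0) * cnj (fst \<zeta>) * bipoly 0 n c \<zeta>) \<in> bp_cauchy"
    proof (rule bp_cauchy.cong)
      fix \<zeta> assume "\<zeta> \<in> torus"
      then have "cmod (fst \<zeta>) = 1" by auto
      then show "of_bool (bipoly m n c \<zeta> = 0) * cnj (fst \<zeta>) * bipoly 0 n c \<zeta> =
          of_bool (bipoly m n c \<zeta> = 0) * (- 1 * (\<Sum>k\<le>n. \<Sum>j<m. c (Suc j) k * (fst \<zeta> ^ j * snd \<zeta> ^ k)))"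
        using conj_eq split1[of \<zeta>] by (cases "bipoly m n c \<zeta> = 0") auto
    qed
  qed (auto simp: norm_mult)
  then have "(\<lambda>\<zeta>. (of_bool (bipoly m n c \<zeta> = 0) * cnj (fst \<zeta>)) * of_bool (bipoly 0 n c \<zeta> \<noteq> 0)
      * of_bool (bipoly m 0 c \<zeta> \<noteq> 0)) \<in> bp_cauchy"
    by (rule bp_cauchy.mult[OF _ sets(3)])
  then have cfst: "(\<lambda>\<zeta>. e \<zeta> * cnj (fst \<zeta>)) \<in> bp_cauchy"
    by (rule bp_cauchy.cong) (simp add: e_def mult_ac)
  have "(\<lambda>\<zeta>. (of_bool (bipoly m n c \<zeta> = 0) * cnj (snd \<zeta>)) * of_bool (bipoly m 0 c \<zeta> \<noteq> 0)) \<in> bp_cauchy"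
  proof (rule divide_zero_free[OF nz2, where B = 1])
    have "(\<lambda>\<zeta>. of_bool (bipoly m n c \<zeta> = 0) * (- 1 * (\<Sum>k<n. \<Sum>j\<le>m. c j (Suc k) * (fst \<zeta> ^ j * snd \<zeta> ^ k)))) \<in> bp_cauchy"
      by (intro bp_cauchy.mult sets bp_cauchy.scale poly2)
    then show "(\<lambda>\<zeta>. of_bool (bipoly m n c \<zeta> = 0) * cnj (snd \<zeta>) * bipoly m 0 c \<zeta>) \<in> bp_cauchy"
    proof (rule bp_cauchy.cong)
      fix \<zeta> assume "\<zeta> \<in> torus"
      then have "cmod (snd \<zeta>) = 1" by auto
      then show "of_bool (bipoly m n c \<zeta> = 0) * cnj (snd \<zeta>) * bipoly m 0 c \<zeta> =
          of_bool (bipoly m n c \<zeta> = 0) * (- 1 * (\<Sum>k<n. \<Sum>j\<le>m. c j (Suc k) * (fst \<zeta> ^ j * snd \<zeta> ^ k)))"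
        using conj_eq split2[of \<zeta>] by (cases "bipoly m n c \<zeta> = 0") auto
    qed
  qed (auto simp: norm_mult)
  then have "(\<lambda>\<zeta>. (of_bool (bipoly m n c \<zeta> = 0) * cnj (snd \<zeta>)) * of_bool (bipoly m 0 c \<zeta> \<noteq> 0)
      * of_bool (bipoly 0 n c \<zeta> \<noteq> 0)) \<in> bp_cauchy"
    by (rule bp_cauchy.mult[OF _ sets(2)])
  then have csnd: "(\<lambda>\<zeta>. e \<zeta> * cnj (snd \<zeta>)) \<in> bp_cauchy"
    by (rule bp_cauchy.cong) (simp add: e_def mult_ac)
  \<comment> \<open>The functions that fall into the closure after multiplication by
    \<open>e\<close>. They form an algebra because \<open>e * e = e\<close>, and containing all four
    coordinate functions they satisfy \<open>bp_star_algebra\<close>.\<close>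
  define Q where "Q = {f. (\<exists>B. \<forall>\<zeta>\<in>torus. cmod (f \<zeta>) \<le> B) \<and> (\<lambda>\<zeta>. e \<zeta> * f \<zeta>) \<in> bp_cauchy}"
  have QI: "f \<in> Q" if "(\<lambda>\<zeta>. e \<zeta> * f \<zeta>) \<in> bp_cauchy" "\<And>\<zeta>. \<zeta> \<in> torus \<Longrightarrow> cmod (f \<zeta>) \<le> B" for f B
    using that unfolding Q_def by blast
  have QD: "(\<lambda>\<zeta>. e \<zeta> * f \<zeta>) \<in> bp_cauchy" if "f \<in> Q" for f using that unfolding Q_def by blast
  have Qb: "\<exists>B. \<forall>\<zeta>\<in>torus. cmod (f \<zeta>) \<le> B" if "f \<in> Q" for f using that unfolding Q_def by blast
  interpret Q: bp_star_algebra Q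
  proof
    fix f g assume f: "f \<in> Q" and g: "g \<in> Q"
    obtain B B' where B: "\<forall>\<zeta>\<in>torus. cmod (f \<zeta>) \<le> B" "\<forall>\<zeta>\<in>torus. cmod (g \<zeta>) \<le> B'"
      using Qb f g by metis
    show "(\<lambda>x. f x + g x) \<in> Q"
    proof (rule QI[where B = "B + B'"])
      show "(\<lambda>\<zeta>. e \<zeta> * (f \<zeta> + g \<zeta>)) \<in> bp_cauchy"
        using bp_cauchy.add[OF QD[OF f] QD[OF g]] by (simp add: algebra_simps)
    qed (use B in \<open>auto intro!: norm_triangle_mono\<close>)
    show "(\<lambda>x. f x * g x) \<in> Q"
    proof (rule QI[where B = "B * B'"])
      have "e x * f x * (e x * g x) = e x * (f x * g x)" for x
        using ee[of x] by (metis (no_types, lifting) mult.assoc mult.left_commute)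
      then show "(\<lambda>\<zeta>. e \<zeta> * (f \<zeta> * g \<zeta>)) \<in> bp_cauchy"
        using bp_cauchy.mult[OF QD[OF f] QD[OF g]] by presburger
      show "cmod (f \<zeta> * g \<zeta>) \<le> B * B'" if "\<zeta> \<in> torus" for \<zeta>
        unfolding norm_mult using B that by (intro mult_mono) (auto intro: order_trans[OF norm_ge_zero])
    qed
  next
    fix f k assume f: "f \<in> Q"
    obtain B where B: "\<forall>\<zeta>\<in>torus. cmod (f \<zeta>) \<le> B" using Qb f by metis
    show "(\<lambda>x. k * f x) \<in> Q"
    proof (rule QI[where B = "cmod k * B"])
      show "(\<lambda>\<zeta>. e \<zeta> * (k * f \<zeta>)) \<in> bp_cauchy"
        using bp_cauchy.scale[OF QD[OF f], of k] by (simp add: algebra_simps)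
    qed (use B in \<open>auto intro!: mult_left_mono simp: norm_mult\<close>)
  next
    fix u g B assume u: "\<And>n. u n \<in> Q" "\<And>n x. x \<in> torus \<Longrightarrow> cmod (u n x) \<le> B"
      and g: "\<And>x. x \<in> torus \<Longrightarrow> (\<lambda>n. u n x) \<longlonglongrightarrow> g x"
    show "g \<in> Q"
    proof (rule QI[where B = B])
      show "(\<lambda>\<zeta>. e \<zeta> * g \<zeta>) \<in> bp_cauchy"
      proof (rule bp_cauchy.lim[of "\<lambda>n \<zeta>. e \<zeta> * u n \<zeta>" B, OF QD[OF u(1)]])
        show "cmod (e x * u n x) \<le> B" if "x \<in> torus" for n x
          using u(2)[OF that, of n] order_trans[OF norm_ge_zero u(2)[OF that, of n]]
          by (auto simp: e_def norm_mult)
      qed (intro tendsto_intros g)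
      show "cmod (g x) \<le> B" if "x \<in> torus" for x
        by (rule Lim_bounded[OF tendsto_norm[OF g[OF that]], of 0]) (use u(2) that in auto)
    qed
  next
    show "(\<lambda>_. 1) \<in> Q" by (rule QI[where B = 1]) (use e in auto)
    show "fst \<in> Q" by (rule QI[where B = 1]) (auto intro: bp_cauchy.mult e fst_in_bp_cauchy)
    show "snd \<in> Q" by (rule QI[where B = 1]) (auto intro: bp_cauchy.mult e snd_in_bp_cauchy)
    show "(\<lambda>x. cnj (fst x)) \<in> Q" by (rule QI[where B = 1]) (auto intro: cfst)
    show "(\<lambda>x. cnj (snd x)) \<in> Q" by (rule QI[where B = 1]) (auto intro: csnd)
  qed (use Qb in auto)
  have "(\<lambda>\<zeta>. e \<zeta> * f \<zeta>) \<in> bp_cauchy" by (rule QD[OF Q.borel_measurable[OF f]])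
  then show ?thesis
    by (rule bp_cauchy.cong) (auto simp: e_def curve_part_def bipoly_0_left bipoly_0_right indicator_def)
qed

section \<open>Complex measures as integrals\<close>

locale signed_measure =
  fixes M :: "'a measure" and r :: "'a set \<Rightarrow> real"
  assumes empty: "r {} = 0"
    and sums: "range A \<subseteq> sets M \<Longrightarrow> disjoint_family A \<Longrightarrow> (\<lambda>i. r (A i)) sums r (\<Union>i::nat. A i)"
begin

lemma additive:
  assumes "A \<in> sets M" "B \<in> sets M" "A \<inter> B = {}"
  shows "r (A \<union> B) = r A + r B"
proof -
  have "(\<lambda>i. r (binaryset A B i)) sums r (\<Union>i. binaryset A B i)"
    by (rule sums) (use assms in \<open>auto simp: disjoint_family_on_def binaryset_def\<close>)
  moreover have "(\<lambda>i. r (binaryset A B i)) sums (\<Sum>i\<in>{0, 1}. r (binaryset A B i))"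
    by (rule sums_finite) (auto simp: binaryset_def empty)
  ultimately show ?thesis by (simp add: sums_unique2 UN_binaryset_eq) (auto simp: binaryset_def dest: sums_unique2)
qed

lemma Diff: "A \<in> sets M \<Longrightarrow> B \<in> sets M \<Longrightarrow> B \<subseteq> A \<Longrightarrow> r (A - B) = r A - r B"
  using additive[of B "A - B"] by (simp add: Un_absorb1)

definition unbdd :: "'a set \<Rightarrow> bool" where
  "unbdd A \<longleftrightarrow> A \<in> sets M \<and> (\<forall>K. \<exists>B\<in>sets M. B \<subseteq> A \<and> K < \<bar>r B\<bar>)"

text \<open>With \<open>\<bar>r B\<bar> > 1 + \<bar>r A\<bar>\<close> both \<open>B\<close> and
  \<open>A - B\<close> have values of modulus at least 1, and one of the two is again unbounded;
  that one is kept.\<close>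

lemma unbdd_split:
  assumes "unbdd A"
  obtains B where "unbdd B" "B \<subseteq> A" "1 \<le> \<bar>r (A - B)\<bar>"
proof -
  have A: "A \<in> sets M" using assms by (simp add: unbdd_def)
  obtain B where B: "B \<in> sets M" "B \<subseteq> A" "1 + \<bar>r A\<bar> < \<bar>r B\<bar>"
    using assms unfolding unbdd_def by blast
  have diff: "1 \<le> \<bar>r (A - B)\<bar>" "1 \<le> \<bar>r (A - (A - B))\<bar>"
    using B Diff[OF A B(1,2)] by (auto simp: double_diff)
  show ?thesis
  proof (cases "unbdd B")
    case True
    then show ?thesis using that B diff by blast
  next
    case False
    have "unbdd (A - B)"
    proof (rule ccontr)
      assume "\<not> unbdd (A - B)"
      then obtain K K' where K: "\<And>C. C \<in> sets M \<Longrightarrow> C \<subseteq> B \<Longrightarrow> \<bar>r C\<bar> \<le> K"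
        "\<And>C. C \<in> sets M \<Longrightarrow> C \<subseteq> A - B \<Longrightarrow> \<bar>r C\<bar> \<le> K'"
        using False A B unfolding unbdd_def by (meson not_less sets.Diff)
      obtain C where C: "C \<in> sets M" "C \<subseteq> A" "K + K' < \<bar>r C\<bar>"
        using assms unfolding unbdd_def by blast
      have "r C = r (C \<inter> B) + r (C - B)"
        using additive[of "C \<inter> B" "C - B"] C B by (simp add: Int_Diff_Un Int_Diff_disjoint)
      moreover have "\<bar>r (C \<inter> B)\<bar> \<le> K" "\<bar>r (C - B)\<bar> \<le> K'"
        using K(1)[of "C \<inter> B"] K(2)[of "C - B"] C B by auto
      ultimately show False using C by linarith
    qed
    then show ?thesis using that[of "A - B"] diff by auto
  qed
qed

text \<open>Otherwise repeated splitting yields disjoint sets \<open>E n - E (Suc n)\<close> with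
  values of modulus at least 1, against the convergence of their sum.\<close>

lemma bounded:
  obtains K where "\<And>B. B \<in> sets M \<Longrightarrow> \<bar>r B\<bar> \<le> K"
proof (cases "unbdd (space M)")
  case False
  then show ?thesis using that sets.sets_into_space unfolding unbdd_def by (meson not_less sets.top)
next
  case True
  define next_set where "next_set A = (SOME B. unbdd B \<and> B \<subseteq> A \<and> 1 \<le> \<bar>r (A - B)\<bar>)" for A
  have next_set: "unbdd (next_set A) \<and> next_set A \<subseteq> A \<and> 1 \<le> \<bar>r (A - next_set A)\<bar>" if "unbdd A" for A
    unfolding next_set_def by (rule someI_ex) (use unbdd_split[OF that] in blast)
  define E where "E n = (next_set ^^ n) (space M)" for n
  have E: "unbdd (E n)" for n by (induction n) (auto simp: E_def True next_set)
  have E_Suc: "E (Suc n) \<subseteq> E n" "1 \<le> \<bar>r (E n - E (Suc n))\<bar>" for n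
    using next_set[OF E[of n]] by (auto simp: E_def)
  have dec: "decseq E" using E_Suc by (intro decseq_SucI)
  have "disjoint_family (\<lambda>n. E n - E (Suc n))"
    unfolding disjoint_family_on_def
  proof (intro ballI impI)
    fix m n :: nat assume "m \<noteq> n"
    moreover have "(E m - E (Suc m)) \<inter> (E n - E (Suc n)) = {}" if "m < n" for m n
      using decseqD[OF dec, of "Suc m" n] that by auto
    ultimately show "(E m - E (Suc m)) \<inter> (E n - E (Suc n)) = {}"
      by (metis Int_commute nat_neq_iff)
  qed
  moreover have "range (\<lambda>n. E n - E (Suc n)) \<subseteq> sets M" using E by (auto simp: unbdd_def)
  ultimately have "summable (\<lambda>n. r (E n - E (Suc n)))"
    using sums sums_summable by blast
  then have "(\<lambda>n. \<bar>r (E n - E (Suc n))\<bar>) \<longlonglongrightarrow> 0"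
    using summable_LIMSEQ_zero tendsto_rabs_zero by blast
  then have "1 \<le> (0::real)"
    by (rule LIMSEQ_le_const) (use E_Suc(2) in blast)
  then show ?thesis by simp
qed

lemma minus: "signed_measure M (\<lambda>A. - r A)"
  by standard (auto intro: sums_minus sums simp: empty)

text \<open>\<open>ennreal\<close> cuts negative values to 0. Nothing is lost, since the empty set
  already contributes the value 0 to the supremum.\<close>

lemma SUP_ennreal:
  assumes "A \<in> sets M"
  shows "(SUP B\<in>{B \<in> sets M. B \<subseteq> A}. ennreal (r B)) = ennreal (SUP B\<in>{B \<in> sets M. B \<subseteq> A}. r B)"
    and "bdd_above (r ` {B \<in> sets M. B \<subseteq> A})"
    and "0 \<le> (SUP B\<in>{B \<in> sets M. B \<subseteq> A}. r B)"
proof -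
  obtain K where K: "\<And>B. B \<in> sets M \<Longrightarrow> \<bar>r B\<bar> \<le> K" using bounded by blast
  show bdd: "bdd_above (r ` {B \<in> sets M. B \<subseteq> A})"
    using K by (intro bdd_aboveI2[of _ _ K]) (auto simp: abs_le_iff)
  have "r {} \<le> (SUP B\<in>{B \<in> sets M. B \<subseteq> A}. r B)" by (rule cSUP_upper[OF _ bdd]) auto
  then show nn: "0 \<le> (SUP B\<in>{B \<in> sets M. B \<subseteq> A}. r B)" by (simp add: empty)
  let ?S = "{B \<in> sets M. B \<subseteq> A}"
  show "(SUP B\<in>?S. ennreal (r B)) = ennreal (SUP B\<in>?S. r B)"
  proof (rule antisym)
    show "(SUP B\<in>?S. ennreal (r B)) \<le> ennreal (SUP B\<in>?S. r B)"
      by (intro SUP_least ennreal_leI cSUP_upper[OF _ bdd])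
    show "ennreal (SUP B\<in>?S. r B) \<le> (SUP B\<in>?S. ennreal (r B))"
    proof (rule ennreal_le_epsilon)
      fix e :: real assume e: "0 < e"
      obtain B where B: "B \<in> ?S" "(SUP B\<in>?S. r B) - e < r B"
        using less_cSUP_iff[OF _ bdd, of "(SUP B\<in>?S. r B) - e"] e sets.empty_sets by fastforce
      have "ennreal (SUP B\<in>?S. r B) \<le> ennreal (r B + e)" using B by (intro ennreal_leI) simp
      also have "\<dots> \<le> ennreal (r B) + ennreal e"
        using e by (cases "0 \<le> r B") (auto simp: ennreal_plus ennreal_neg intro!: ennreal_leI)
      also have "\<dots> \<le> (SUP B\<in>?S. ennreal (r B)) + ennreal e"
        using B by (intro add_right_mono SUP_upper)
      finally show "ennreal (SUP B\<in>?S. r B) \<le> (SUP B\<in>?S. ennreal (r B)) + ennreal e" .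
    qed
  qed
qed

text \<open>\<open>measure_of\<close> returns the given set function only if it is countably
  additive. For one inequality a test set is cut along the \<open>A i\<close>; for the other, test
  sets in finitely many \<open>A i\<close> are united.\<close>

lemma emeasure_positive_part:
  assumes "A \<in> sets M"
  shows "emeasure (positive_part M r) A = (SUP B\<in>{B \<in> sets M. B \<subseteq> A}. ennreal (r B))"
  unfolding positive_part_def
proof (rule emeasure_measure_of_sigma[OF sets.sigma_algebra_axioms _ _ assms])
  let ?p = "\<lambda>A. SUP B\<in>{B \<in> sets M. B \<subseteq> A}. ennreal (r B)"
  have "{B \<in> sets M. B \<subseteq> {}} = {{}}" by auto
  then show "positive (sets M) ?p" by (simp add: positive_def empty)
  show "countably_additive (sets M) ?p"
    unfolding countably_additive_def
  proof (intro allI impI)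
    fix A :: "nat \<Rightarrow> 'a set"
    assume A: "range A \<subseteq> sets M" "disjoint_family A" and U: "(\<Union>i. A i) \<in> sets M"
    have Ai: "A i \<in> sets M" for i using A by auto
    show "(\<Sum>i. ?p (A i)) = ?p (\<Union>i. A i)"
    proof (rule antisym)
      show "?p (\<Union>i. A i) \<le> (\<Sum>i. ?p (A i))"
      proof (rule SUP_least)
        fix B assume B: "B \<in> {B \<in> sets M. B \<subseteq> (\<Union>i. A i)}"
        define b where "b i = max 0 (r (B \<inter> A i))" for i
        have sm: "(\<lambda>i. r (B \<inter> A i)) sums r (\<Union>i. B \<inter> A i)"
          using A B by (intro sums) (auto simp: disjoint_family_on_def)
        have UB: "(\<Union>i. B \<inter> A i) = B" using B by auto
        show "ennreal (r B) \<le> (\<Sum>i. ?p (A i))"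
        proof (rule LIMSEQ_le_const2)
          show "(\<lambda>n. ennreal (\<Sum>i<n. r (B \<inter> A i))) \<longlonglongrightarrow> ennreal (r B)"
            using sm unfolding sums_def UB by (intro tendsto_ennrealI)
          have "ennreal (\<Sum>i<n. r (B \<inter> A i)) \<le> (\<Sum>i. ?p (A i))" for n
          proof -
            have "ennreal (\<Sum>i<n. r (B \<inter> A i)) \<le> ennreal (\<Sum>i<n. b i)"
              by (intro ennreal_leI sum_mono) (simp add: b_def)
            also have "\<dots> = (\<Sum>i<n. ennreal (b i))" by (rule sum_ennreal[symmetric]) (simp add: b_def)
            also have "\<dots> \<le> (\<Sum>i<n. ?p (A i))"
            proof (rule sum_mono)
              fix i
              have "ennreal (b i) = ennreal (r (B \<inter> A i))" by (simp add: b_def max_def ennreal_neg)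
              also have "\<dots> \<le> ?p (A i)" using B Ai by (intro SUP_upper) auto
              finally show "ennreal (b i) \<le> ?p (A i)" .
            qed
            also have "\<dots> \<le> (\<Sum>i. ?p (A i))" by (rule sum_le_suminf) auto
            finally show ?thesis .
          qed
          then show "\<exists>N. \<forall>n\<ge>N. ennreal (\<Sum>i<n. r (B \<inter> A i)) \<le> (\<Sum>i. ?p (A i))" by blast
        qed
      qed
      have fin: "(\<Sum>i<n. ?p (A i)) \<le> ?p (\<Union>i<n. A i)" for n
      proof (induction n)
        case (Suc n)
        have Un: "(\<Union>i<n. A i) \<in> sets M" using Ai by auto
        have disj: "(\<Union>i<n. A i) \<inter> A n = {}"
          using A(2) by (auto simp: disjoint_family_on_def) (metis disjoint_iff less_irrefl)
        have "?p (\<Union>i<n. A i) + ?p (A n) \<le> ?p (\<Union>i<Suc n. A i)"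
        proof -
          let ?r = "\<lambda>A. SUP B\<in>{B \<in> sets M. B \<subseteq> A}. r B"
          have US: "(\<Union>i<Suc n. A i) \<in> sets M" using Ai by auto
          have "?r (\<Union>i<n. A i) + ?r (A n) \<le> ?r (\<Union>i<Suc n. A i)"
          proof -
            have *: "r B + r C \<le> ?r (\<Union>i<Suc n. A i)"
              if "B \<in> {B \<in> sets M. B \<subseteq> (\<Union>i<n. A i)}" "C \<in> {B \<in> sets M. B \<subseteq> A n}" for B C
            proof -
              have "r B + r C = r (B \<union> C)" using that disj by (intro additive[symmetric]) auto
              also have "\<dots> \<le> ?r (\<Union>i<Suc n. A i)"
                using that by (intro cSUP_upper SUP_ennreal(2)[OF US]) (auto simp: lessThan_Suc)
              finally show ?thesis .
            qed
            have "?r (\<Union>i<n. A i) \<le> ?r (\<Union>i<Suc n. A i) - r C" if "C \<in> {B \<in> sets M. B \<subseteq> A n}" for C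
              by (rule cSUP_least) (use *[OF _ that] sets.empty_sets in \<open>auto simp: le_diff_eq\<close>)
            then have "?r (A n) \<le> ?r (\<Union>i<Suc n. A i) - ?r (\<Union>i<n. A i)"
              by (intro cSUP_least) (use sets.empty_sets in \<open>auto simp: le_diff_eq add.commute\<close>)
            then show ?thesis by linarith
          qed
          then show ?thesis
            unfolding SUP_ennreal(1)[OF Un] SUP_ennreal(1)[OF Ai] SUP_ennreal(1)[OF US]
            using SUP_ennreal(3)[OF Un] SUP_ennreal(3)[OF Ai[of n]]
            by (simp add: ennreal_plus[symmetric] ennreal_leI del: ennreal_plus)
        qed
        then show ?case
          unfolding sum.lessThan_Suc by (rule order_trans[OF add_right_mono[OF Suc]])
      qed simp
      show "(\<Sum>i. ?p (A i)) \<le> ?p (\<Union>i. A i)"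
        unfolding suminf_eq_SUP
      proof (rule SUP_least)
        fix n
        have "?p (\<Union>i<n. A i) \<le> ?p (\<Union>i. A i)" by (rule SUP_subset_mono) auto
        then show "(\<Sum>i<n. ?p (A i)) \<le> ?p (\<Union>i. A i)" using fin[of n] by (rule order_trans[rotated])
      qed
    qed
  qed
qed

lemma sets_positive_part: "sets (positive_part M r) = sets M"
  by (simp add: positive_part_def sets.space_closed)

lemma finite_positive_part: "finite_measure (positive_part M r)"
proof
  have "space (positive_part M r) = space M" by (rule sets_eq_imp_space_eq[OF sets_positive_part])
  then show "emeasure (positive_part M r) (space (positive_part M r)) \<noteq> \<infinity>"
    by (simp add: emeasure_positive_part SUP_ennreal)
qed

lemma measure_positive_part:
  assumes "A \<in> sets M"
  shows "measure (positive_part M r) A = (SUP B\<in>{B \<in> sets M. B \<subseteq> A}. r B)"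
  using emeasure_positive_part[OF assms] SUP_ennreal[OF assms] by (simp add: measure_def)

text \<open>Complementation inside \<open>A\<close>: \<open>r B = r A - r (A - B)\<close>, so a
  large \<open>r B\<close> corresponds to a large \<open>- r (A - B)\<close>, up to the constant
  \<open>r A\<close>.\<close>

lemma Jordan:
  assumes A: "A \<in> sets M"
  shows "measure (positive_part M r) A - measure (positive_part M (\<lambda>A. - r A)) A = r A"
proof -
  interpret m: signed_measure M "\<lambda>A. - r A" by (rule minus)
  let ?S = "{B \<in> sets M. B \<subseteq> A}"
  have "(SUP B\<in>?S. r B) \<le> r A + (SUP B\<in>?S. - r B)"
  proof (rule cSUP_least)
    show "?S \<noteq> {}" by auto
    fix B assume B: "B \<in> ?S"
    then have "- r (A - B) \<le> (SUP B\<in>?S. - r B)"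
      using A by (intro cSUP_upper m.SUP_ennreal(2)) auto
    then show "r B \<le> r A + (SUP B\<in>?S. - r B)" using Diff[OF A] B by simp
  qed
  moreover have "(SUP B\<in>?S. - r B) \<le> (SUP B\<in>?S. r B) - r A"
  proof (rule cSUP_least)
    show "?S \<noteq> {}" by auto
    fix B assume B: "B \<in> ?S"
    then have "r (A - B) \<le> (SUP B\<in>?S. r B)"
      using A by (intro cSUP_upper SUP_ennreal(2)) auto
    then show "- r B \<le> (SUP B\<in>?S. r B) - r A" using Diff[OF A] B by simp
  qed
  ultimately show ?thesis
    by (simp add: measure_positive_part[OF A] m.measure_positive_part[OF A])
qed

end

lemma signed_measure_Re_Im:
  assumes "complex_measure M \<mu>"
  shows "signed_measure M (\<lambda>A. Re (\<mu> A))" "signed_measure M (\<lambda>A. Im (\<mu> A))"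
  using assms by (auto simp: complex_measure_def signed_measure_def intro: sums_Re sums_Im)

lemma tendsto_integral_bounded:
  fixes f :: "nat \<Rightarrow> 'a \<Rightarrow> complex"
  assumes "finite_measure N" "\<And>n. f n \<in> borel_measurable N"
    and "\<And>n x. x \<in> space N \<Longrightarrow> cmod (f n x) \<le> B"
    and "\<And>x. x \<in> space N \<Longrightarrow> (\<lambda>n. f n x) \<longlonglongrightarrow> g x"
  shows "(\<lambda>n. integral\<^sup>L N (f n)) \<longlonglongrightarrow> integral\<^sup>L N g"
proof -
  interpret finite_measure N by fact
  show ?thesis
  proof (rule integral_dominated_convergence[where w = "\<lambda>_. B"])
    show "g \<in> borel_measurable N"
      by (rule borel_measurable_LIMSEQ_metric[of f]) (use assms in auto)
  qed (use assms in auto)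
qed

lemma cm_integral_tendsto:
  assumes \<mu>: "complex_measure M \<mu>" and f: "\<And>n. f n \<in> borel_measurable M"
    and B: "\<And>n x. x \<in> space M \<Longrightarrow> cmod (f n x) \<le> B"
    and lim: "\<And>x. x \<in> space M \<Longrightarrow> (\<lambda>n. f n x) \<longlonglongrightarrow> g x"
  shows "(\<lambda>n. cm_integral M \<mu> (f n)) \<longlonglongrightarrow> cm_integral M \<mu> g"
proof -
  have *: "(\<lambda>n. integral\<^sup>L (positive_part M r) (f n)) \<longlonglongrightarrow> integral\<^sup>L (positive_part M r) g"
    if "signed_measure M r" for r
  proof -
    interpret signed_measure M r by fact
    show ?thesis
      by (rule tendsto_integral_bounded[OF finite_positive_part])
         (use f B lim in \<open>auto simp: sets_eq_imp_space_eq[OF sets_positive_part] cong: measurable_cong_sets[OF sets_positive_part refl]\<close>)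
  qed
  note sm = signed_measure_Re_Im[OF \<mu>]
  show ?thesis
    unfolding cm_integral_def
    by (intro tendsto_intros * sm signed_measure.minus)
qed

lemma cm_integral_indicator:
  assumes \<mu>: "complex_measure M \<mu>" and A: "A \<in> sets M"
  shows "cm_integral M \<mu> (indicator A) = \<mu> A"
proof -
  have "integral\<^sup>L (positive_part M r) (indicator A :: _ \<Rightarrow> complex) = of_real (measure (positive_part M r) A)"
    if "signed_measure M r" for r
  proof -
    interpret signed_measure M r by fact
    interpret finite_measure "positive_part M r" by (rule finite_positive_part)
    have "A \<in> sets (positive_part M r)" using A by (simp add: sets_positive_part)
    then have "integral\<^sup>L (positive_part M r) (\<lambda>x. complex_of_real (indicator A x)) =
        of_real (measure (positive_part M r) A)"
      by (simp only: integral_complex_of_real Bochner_Integration.integral_indicator sets.Int_space_eq2)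
    then show ?thesis by (simp add: of_real_indicator)
  qed
  note * = this signed_measure.Jordan[OF _ A] signed_measure.minus
  note sm = signed_measure_Re_Im[OF \<mu>]
  show ?thesis
    unfolding cm_integral_def
    by (simp add: *[OF sm(1)] *[OF sm(2)] *(1)[OF *(3)[OF sm(1)]] *(1)[OF *(3)[OF sm(2)]]
        complex_eq_iff flip: of_real_diff)
qed

section \<open>Clark measures\<close>

text \<open>The real derivative of \<open>a\<close> is complex linear as well as conjugate linear,
  hence zero; its values at 1 and \<open>\<i>\<close> show this.\<close>

lemma holomorphic_antiholomorphic_constant:
  assumes a: "a holomorphic_on ball 0 1" and c: "c holomorphic_on ball 0 1"
    and eq: "\<And>z. z \<in> ball 0 1 \<Longrightarrow> a z = c (cnj z)"
  obtains k where "\<And>z. z \<in> ball 0 1 \<Longrightarrow> a z = k"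
proof -
  have "(a has_field_derivative 0) (at z within ball 0 1)" if z: "z \<in> ball 0 1" for z
  proof -
    have cz: "cnj z \<in> ball 0 1" using z by simp
    obtain a' where a': "(a has_field_derivative a') (at z)"
      using a z by (meson holomorphic_on_imp_differentiable_at open_ball field_differentiable_def)
    obtain c' where c': "(c has_field_derivative c') (at (cnj z))"
      using c cz by (meson holomorphic_on_imp_differentiable_at open_ball field_differentiable_def)
    have "((\<lambda>x. c (cnj x)) has_derivative (\<lambda>h. c' * cnj h)) (at z)"
      using has_derivative_compose[OF bounded_linear_imp_has_derivative[OF bounded_linear_cnj]
          c'[unfolded has_field_derivative_def]] .
    then have "(a has_derivative (\<lambda>h. c' * cnj h)) (at z)"
      by (rule has_derivative_transform_within_open[OF _ open_ball z]) (simp add: eq)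
    then have "(\<lambda>h. a' * h) = (\<lambda>h. c' * cnj h)"
      using a' has_derivative_unique unfolding has_field_derivative_def by blast
    then have "a' * 1 = c' * cnj 1" "a' * \<i> = c' * cnj \<i>" by (meson fun_cong)+
    then have "a' = 0" by (simp add: complex_eq_iff)
    then show ?thesis using a' has_field_derivative_at_within by blast
  qed
  then show ?thesis
    using has_field_derivative_zero_constant[of "ball 0 1" a] that by (metis convex_ball)
qed

lemma one_minus_mult_norm_ge:
  fixes z w :: complex
  assumes "cmod z \<le> r" "cmod w \<le> 1"
  shows "1 - r \<le> cmod (1 - z * w)"
proof -
  have "cmod (z * w) \<le> r * 1" unfolding norm_mult using assms order_trans[OF norm_ge_zero assms(1)]
    by (intro mult_mono) auto
  then show ?thesis using norm_triangle_ineq2[of 1 "z * w"] by simp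
qed

lemma norm_divide_le:
  fixes x y :: complex
  assumes "cmod x \<le> B" "d \<le> cmod y" "0 < d"
  shows "cmod (x / y) \<le> B / d"
  using assms order_trans[OF norm_ge_zero assms(1)] by (simp add: norm_divide frac_le)

text \<open>One coordinate \<open>\<phi>\<close> enters through a resolvent, while the dependence on
  the other coordinate is frozen in the bounded factor \<open>K\<close>.\<close>

locale bounded_kernel = finite_measure +
  fixes K \<phi> :: "'a \<Rightarrow> complex" and B :: real
  assumes K: "K \<in> borel_measurable M" "\<And>x. x \<in> space M \<Longrightarrow> cmod (K x) \<le> B"
    and \<phi>: "\<phi> \<in> borel_measurable M" "\<And>x. x \<in> space M \<Longrightarrow> cmod (\<phi> x) \<le> 1"
begin

lemma integrable_resolvent:
  assumes "cmod z < 1"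
  shows "integrable M (\<lambda>x. K x / (1 - z * \<phi> x))"
proof (rule integrable_const_bound[where B = "B / (1 - cmod z)"])
  show "AE x in M. cmod (K x / (1 - z * \<phi> x)) \<le> B / (1 - cmod z)"
    using assms by (auto intro!: norm_divide_le K one_minus_mult_norm_ge \<phi>)
qed (use K \<phi> in measurable)

lemma holomorphic_resolvent_integral:
  "(\<lambda>z. \<integral>x. K x / (1 - z * \<phi> x) \<partial>M) holomorphic_on ball 0 1"
  unfolding holomorphic_on_def
proof
  fix z :: complex assume "z \<in> ball 0 1"
  then have z1: "cmod z < 1" by simp
  \<comment> \<open>A disc around 0 that contains \<open>z\<close> and on which all denominators
    stay above \<open>1 - r\<close>.\<close>
  define r where "r = (1 + cmod z) / 2"
  have r: "cmod z < r" "r < 1" using z1 by (auto simp: r_def)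
  let ?A = "\<lambda>z. \<integral>x. K x / (1 - z * \<phi> x) \<partial>M"
  let ?D = "\<integral>x. K x * \<phi> x / ((1 - z * \<phi> x) * (1 - z * \<phi> x)) \<partial>M"
  have ge: "1 - r \<le> cmod (1 - y * \<phi> x)" if "x \<in> space M" "cmod y \<le> r" for x y
    using that by (intro one_minus_mult_norm_ge \<phi>)
  have nz: "1 - y * \<phi> x \<noteq> 0" if "x \<in> space M" "cmod y \<le> r" for x y
    using ge[OF that] r by auto
  have "((\<lambda>y. (?A y - ?A z) / (y - z)) \<longlongrightarrow> ?D) (at z within ball 0 r)"
    unfolding tendsto_at_iff_sequentially comp_def
  proof (intro allI impI)
    fix y :: "nat \<Rightarrow> complex" assume y: "\<forall>i. y i \<in> ball 0 r - {z}" and lim: "y \<longlonglongrightarrow> z"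
    have yr: "cmod (y n) \<le> r" for n using y by (auto intro: less_imp_le)
    have eq: "(?A (y n) - ?A z) / (y n - z) =
        (\<integral>x. K x * \<phi> x / ((1 - y n * \<phi> x) * (1 - z * \<phi> x)) \<partial>M)" for n
    proof -
      have "?A (y n) - ?A z = (\<integral>x. K x / (1 - y n * \<phi> x) - K x / (1 - z * \<phi> x) \<partial>M)"
        using yr[of n] r by (intro Bochner_Integration.integral_diff[symmetric] integrable_resolvent) auto
      also have "\<dots> = (\<integral>x. (y n - z) * (K x * \<phi> x / ((1 - y n * \<phi> x) * (1 - z * \<phi> x))) \<partial>M)"
      proof (rule Bochner_Integration.integral_cong[OF refl])
        fix x assume x: "x \<in> space M"
        show "K x / (1 - y n * \<phi> x) - K x / (1 - z * \<phi> x) =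
            (y n - z) * (K x * \<phi> x / ((1 - y n * \<phi> x) * (1 - z * \<phi> x)))"
          using nz[OF x yr[of n]] nz[OF x less_imp_le[OF r(1)]]
          by (simp add: divide_simps) (simp add: algebra_simps)
      qed
      also have "\<dots> = (y n - z) * (\<integral>x. K x * \<phi> x / ((1 - y n * \<phi> x) * (1 - z * \<phi> x)) \<partial>M)"
        by (rule integral_mult_right_zero)
      finally show ?thesis using y by (simp only: DiffD2 nonzero_mult_div_cancel_left right_minus_eq) simp
    qed
    show "(\<lambda>n. (?A (y n) - ?A z) / (y n - z)) \<longlonglongrightarrow> ?D"
      unfolding eq
    proof (rule tendsto_integral_bounded[where B = "B / ((1 - r) * (1 - r))"])
      show "finite_measure M" by (rule finite_measure_axioms)
      show "(\<lambda>x. K x * \<phi> x / ((1 - y n * \<phi> x) * (1 - z * \<phi> x))) \<in> borel_measurable M" for n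
        using K \<phi> by measurable
      fix x assume x: "x \<in> space M"
      show "cmod (K x * \<phi> x / ((1 - y n * \<phi> x) * (1 - z * \<phi> x))) \<le> B / ((1 - r) * (1 - r))" for n
      proof (rule norm_divide_le)
        have "cmod (K x) * cmod (\<phi> x) \<le> B * 1"
          using K(2)[OF x] \<phi>(2)[OF x] by (intro mult_mono) (auto intro: order_trans[OF norm_ge_zero])
        then show "cmod (K x * \<phi> x) \<le> B" by (simp add: norm_mult)
        show "(1 - r) * (1 - r) \<le> cmod ((1 - y n * \<phi> x) * (1 - z * \<phi> x))"
          unfolding norm_mult using r yr[of n] x by (intro mult_mono ge) auto
      qed (use r in simp)
      show "(\<lambda>n. K x * \<phi> x / ((1 - y n * \<phi> x) * (1 - z * \<phi> x)))
          \<longlonglongrightarrow> K x * \<phi> x / ((1 - z * \<phi> x) * (1 - z * \<phi> x))"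
        using nz[OF x less_imp_le[OF r(1)]] by (intro tendsto_intros lim) auto
    qed
  qed
  then have "(?A has_field_derivative ?D) (at z within ball 0 r)"
    by (simp add: has_field_derivative_iff)
  then have "(?A has_field_derivative ?D) (at z)"
    using r by (simp add: at_within_open[of z "ball 0 r"])
  then show "?A field_differentiable at z within ball 0 1"
    using field_differentiable_at_within field_differentiable_def by blast
qed

end

text \<open>The Poisson kernel with \<open>cnj z\<close> replaced by an independent variable.\<close>

definition polarized_poisson :: "complex \<Rightarrow> complex \<Rightarrow> complex \<Rightarrow> complex" where
  "polarized_poisson z v \<zeta> = 1 / (1 - z * cnj \<zeta>) + 1 / (1 - v * \<zeta>) - 1"

text \<open>In this form the kernel at \<open>v = cnj w\<close> is \<open>1 - z * cnj w\<close>
  times a Cauchy kernel and a conjugate Cauchy kernel in one variable, which is how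
  \<open>kernel_identity\<close> uses it.\<close>

lemma polarized_poisson_eq:
  assumes "cmod z < 1" "cmod v < 1" "cmod \<zeta> = 1"
  shows "polarized_poisson z v \<zeta> = (1 - z * v) / ((1 - z * cnj \<zeta>) * (1 - v * \<zeta>))"
proof -
  have "1 - z * cnj \<zeta> \<noteq> 0" "1 - v * \<zeta> \<noteq> 0"
    using one_minus_mult_norm_ge[of z "cmod z" "cnj \<zeta>"] one_minus_mult_norm_ge[of v "cmod v" \<zeta>] assms
    by auto
  moreover have "\<zeta> * cnj \<zeta> = 1" using assms(3) by (simp add: complex_norm_square[symmetric])
  ultimately show ?thesis
    unfolding polarized_poisson_def by (simp add: divide_simps) (simp add: algebra_simps)
qed

lemma polarized_poisson_diag:
  assumes "cmod z < 1" "cmod \<zeta> = 1"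
  shows "polarized_poisson z (cnj z) \<zeta> = of_real ((1 - (cmod z)\<^sup>2) / (cmod (\<zeta> - z))\<^sup>2)"
proof -
  have unit: "\<zeta> * cnj \<zeta> = 1" using assms(2) by (simp add: complex_norm_square[symmetric])
  have "1 - z * cnj \<zeta> = cnj \<zeta> * (\<zeta> - z)" using unit by (simp add: algebra_simps)
  then have norm: "cmod (1 - z * cnj \<zeta>) = cmod (\<zeta> - z)" using assms(2) by (simp add: norm_mult)
  have "(1 - z * cnj \<zeta>) * (1 - cnj z * \<zeta>) = (1 - z * cnj \<zeta>) * cnj (1 - z * cnj \<zeta>)" by simp
  also have "\<dots> = of_real ((cmod (1 - z * cnj \<zeta>))\<^sup>2)" by (simp only: complex_norm_square)
  finally have "(1 - z * cnj \<zeta>) * (1 - cnj z * \<zeta>) = of_real ((cmod (\<zeta> - z))\<^sup>2)"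
    by (simp only: norm)
  moreover have "1 - z * cnj z = of_real (1 - (cmod z)\<^sup>2)"
    by (simp only: of_real_diff complex_norm_square of_real_1)
  ultimately show ?thesis using assms by (simp add: polarized_poisson_eq)
qed

lemma polarized_poisson_bound:
  assumes "cmod z \<le> r" "cmod v \<le> s" "cmod \<zeta> \<le> 1" "r < 1" "s < 1"
  shows "cmod (polarized_poisson z v \<zeta>) \<le> 1 / (1 - r) + 1 / (1 - s) + 1"
proof -
  have "cmod (1 / (1 - z * cnj \<zeta>)) \<le> 1 / (1 - r)" "cmod (1 / (1 - v * \<zeta>)) \<le> 1 / (1 - s)"
    using assms by (auto intro!: norm_divide_le one_minus_mult_norm_ge)
  then show ?thesis
    unfolding polarized_poisson_def
    by (intro order_trans[OF norm_triangle_ineq4] order_trans[OF add_right_mono[OF norm_triangle_ineq]]) simp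
qed

lemma cnj_measurable [measurable]: "cnj \<in> borel_measurable borel"
  by (intro borel_measurable_continuous_onI continuous_intros)

lemma polarized_poisson_measurable [measurable]:
  assumes [measurable]: "\<phi> \<in> borel_measurable M"
  shows "(\<lambda>x. polarized_poisson z v (\<phi> x)) \<in> borel_measurable M"
  unfolding polarized_poisson_def by measurable

text \<open>The kernel splits into a function of \<open>z\<close> and a function of \<open>v\<close>, so on the diagonal a
  holomorphic function equals an antiholomorphic one.\<close>

lemma (in bounded_kernel) polarization:
  assumes unit: "\<And>x. x \<in> space M \<Longrightarrow> cmod (\<phi> x) = 1"
    and f: "f holomorphic_on ball 0 1" and g: "g holomorphic_on ball 0 1"
    and diag: "\<And>z. z \<in> ball 0 1 \<Longrightarrow>
      (\<integral>x. K x * polarized_poisson z (cnj z) (\<phi> x) \<partial>M) = f z + g (cnj z)"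
    and z: "cmod z < 1" and v: "cmod v < 1"
  shows "(\<integral>x. K x * polarized_poisson z v (\<phi> x) \<partial>M) = f z + g v"
proof -
  interpret c: bounded_kernel M K "\<lambda>x. cnj (\<phi> x)" B
    by standard (use K \<phi> in auto)
  let ?A = "\<lambda>z. \<integral>x. K x / (1 - z * cnj (\<phi> x)) \<partial>M"
  let ?C = "\<lambda>v. \<integral>x. K x / (1 - v * \<phi> x) \<partial>M"
  let ?k = "\<integral>x. K x \<partial>M"
  have split: "(\<integral>x. K x * polarized_poisson z v (\<phi> x) \<partial>M) = ?A z + ?C v - ?k"
    if "cmod z < 1" "cmod v < 1" for z v
  proof -
    have "integrable M K" using integrable_resolvent[of 0] by simp
    then have "?A z + ?C v - ?k = (\<integral>x. K x / (1 - z * cnj (\<phi> x)) + K x / (1 - v * \<phi> x) - K x \<partial>M)"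
      using c.integrable_resolvent[OF that(1)] integrable_resolvent[OF that(2)]
      by (simp add: Bochner_Integration.integral_add Bochner_Integration.integral_diff)
    then show ?thesis by (simp add: polarized_poisson_def algebra_simps)
  qed
  have hA: "(\<lambda>z. ?A z - f z) holomorphic_on ball 0 1"
    by (intro holomorphic_intros c.holomorphic_resolvent_integral f)
  have hC: "(\<lambda>v. g v - ?C v + ?k) holomorphic_on ball 0 1"
    by (intro holomorphic_intros holomorphic_resolvent_integral g)
  have "?A z - f z = g (cnj z) - ?C (cnj z) + ?k" if "z \<in> ball 0 1" for z
    using diag[OF that] split[of z "cnj z"] that by (simp add: algebra_simps)
  then obtain k where k: "\<And>z. z \<in> ball 0 1 \<Longrightarrow> ?A z - f z = k"
    using holomorphic_antiholomorphic_constant[OF hA hC] by blast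
  have "g v - ?C v + ?k = k"
    using k[of "cnj v"] diag[of "cnj v"] split[of "cnj v" v] v by (simp add: algebra_simps)
  then have C: "?C v = g v + ?k - k" by (simp add: algebra_simps)
  have A: "?A z = f z + k" using k[of z] z by (simp add: algebra_simps)
  show ?thesis unfolding split[OF z v] A C by simp
qed

section \<open>Polarization of the Clark identity\<close>

lemma torus_borel_measurable [measurable]:
  "fst \<in> borel_measurable torus_borel" "snd \<in> borel_measurable torus_borel"
  by (auto intro!: measurable_restrict_space1 borel_measurable_continuous_onI continuous_intros)

lemma space_torus_borel: "space torus_borel = torus"
  by (simp add: space_restrict_space)

lemma holomorphic_on_ball_cnj_cnj:
  assumes "f holomorphic_on ball 0 r"
  shows "(\<lambda>z. cnj (f (cnj z))) holomorphic_on ball 0 r"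
proof -
  have "cnj ` ball 0 r = ball 0 r"
  proof (rule set_eqI)
    fix z show "z \<in> cnj ` ball 0 r \<longleftrightarrow> z \<in> ball 0 r"
      by (auto intro!: image_eqI[of z cnj "cnj z"])
  qed
  then have "(cnj \<circ> f \<circ> cnj) holomorphic_on ball 0 r"
    using assms by (subst holomorphic_on_compose_cnj_cnj) auto
  then show ?thesis by (simp add: comp_def)
qed

locale torus_measure = finite_measure \<sigma> for \<sigma> :: "(complex \<times> complex) measure" +
  assumes sets_eq: "sets \<sigma> = sets torus_borel"
begin

lemma space_eq: "space \<sigma> = torus"
  using sets_eq_imp_space_eq[OF sets_eq] by (simp add: space_restrict_space)

lemma measurable_eq: "measurable \<sigma> N = measurable torus_borel N"
  by (rule measurable_cong_sets[OF sets_eq refl])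

lemma fst_measurable [measurable]: "fst \<in> borel_measurable \<sigma>"
  and snd_measurable [measurable]: "snd \<in> borel_measurable \<sigma>"
  unfolding measurable_eq by (rule torus_borel_measurable)+

lemma integrable_bounded:
  fixes f :: "complex \<times> complex \<Rightarrow> 'b::{banach, second_countable_topology}"
  assumes "f \<in> borel_measurable torus_borel" "\<And>\<zeta>. \<zeta> \<in> torus \<Longrightarrow> norm (f \<zeta>) \<le> B"
  shows "integrable \<sigma> f"
  by (rule integrable_const_bound[where B = B]) (use assms in \<open>auto simp: space_eq measurable_eq\<close>)

end

text \<open>Holomorphy is required separately in each variable, as polarization treats the variables
  one after the other; the strict bound keeps \<open>\<alpha> - b\<close> from vanishing.\<close>

locale clark_measure =
  fixes b :: "complex \<times> complex \<Rightarrow> complex" and \<alpha> :: complex and \<sigma> :: "(complex \<times> complex) measure"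
  assumes alpha: "cmod \<alpha> = 1"
    and hol_fst: "w \<in> ball 0 1 \<Longrightarrow> (\<lambda>z. b (z, w)) holomorphic_on ball 0 1"
    and hol_snd: "z \<in> ball 0 1 \<Longrightarrow> (\<lambda>w. b (z, w)) holomorphic_on ball 0 1"
    and b_less: "x \<in> bidisc \<Longrightarrow> cmod (b x) < 1"
    and clark: "is_clark_measure b \<alpha> \<sigma>"
begin

sublocale torus_measure \<sigma>
  using clark by (simp add: is_clark_measure_def torus_measure_def torus_measure_axioms_def)

text \<open>The Cayley transform of \<open>b\<close>; its real part is the right-hand side of the
  Clark identity.\<close>

definition herglotz :: "complex \<times> complex \<Rightarrow> complex" where
  "herglotz z = (\<alpha> + b z) / (\<alpha> - b z)"

lemma alpha_neq: "z \<in> bidisc \<Longrightarrow> \<alpha> - b z \<noteq> 0"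
  using b_less alpha by fastforce

lemma Re_herglotz:
  assumes "z \<in> bidisc"
  shows "(herglotz z + cnj (herglotz z)) / 2 = of_real ((1 - (cmod (b z))\<^sup>2) / (cmod (\<alpha> - b z))\<^sup>2)"
proof -
  have a: "\<alpha> * cnj \<alpha> = 1" using alpha by (simp add: complex_norm_square[symmetric])
  have "cnj (\<alpha> - b z) \<noteq> 0" using alpha_neq[OF assms] by (metis complex_cnj_zero_iff)
  then have "(herglotz z + cnj (herglotz z)) / 2 = (1 - b z * cnj (b z)) / ((\<alpha> - b z) * cnj (\<alpha> - b z))"
    using alpha_neq[OF assms] a unfolding herglotz_def
    by (simp add: divide_simps) (simp add: algebra_simps)
  then show ?thesis by (simp only: of_real_divide of_real_diff complex_norm_square of_real_1)
qed

text \<open>\<open>polarization\<close> is applied in the first coordinate with the second on its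
  diagonal, then in the second with both parameters of the first already free. The right-hand side
  has no term mixing \<open>z\<close> and \<open>v\<close>, which expresses that mixed Fourier
  coefficients vanish.\<close>

lemma polarized_identity:
  assumes z: "cmod z1 < 1" "cmod z2 < 1" and v: "cmod v1 < 1" "cmod v2 < 1"
  shows "(\<integral>\<zeta>. polarized_poisson z1 v1 (fst \<zeta>) * polarized_poisson z2 v2 (snd \<zeta>) \<partial>\<sigma>) =
    (herglotz (z1, z2) + cnj (herglotz (cnj v1, cnj v2))) / 2"
proof -
  have hol1: "(\<lambda>x. herglotz (x, w)) holomorphic_on ball 0 1" if "w \<in> ball 0 1" for w
    unfolding herglotz_def using that alpha_neq by (intro holomorphic_intros hol_fst) auto
  have hol2: "(\<lambda>x. herglotz (w, x)) holomorphic_on ball 0 1" if "w \<in> ball 0 1" for w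
    unfolding herglotz_def using that alpha_neq by (intro holomorphic_intros hol_snd) auto
  have bk1: "bounded_kernel \<sigma> (\<lambda>\<zeta>. polarized_poisson z v (snd \<zeta>)) fst (1 / (1 - cmod z) + 1 / (1 - cmod v) + 1)"
    and bk2: "bounded_kernel \<sigma> (\<lambda>\<zeta>. polarized_poisson z v (fst \<zeta>)) snd (1 / (1 - cmod z) + 1 / (1 - cmod v) + 1)"
    if "cmod z < 1" "cmod v < 1" for z v
    by (unfold_locales; use that in \<open>auto simp: space_eq intro!: polarized_poisson_bound\<close>)+
  have diag: "(\<integral>\<zeta>. polarized_poisson w (cnj w) (snd \<zeta>) * polarized_poisson z (cnj z) (fst \<zeta>) \<partial>\<sigma>) =
      (herglotz (z, w) + cnj (herglotz (z, w))) / 2" if "cmod z < 1" "cmod w < 1" for z w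
  proof -
    have "(\<integral>\<zeta>. polarized_poisson w (cnj w) (snd \<zeta>) * polarized_poisson z (cnj z) (fst \<zeta>) \<partial>\<sigma>) =
        (\<integral>\<zeta>. complex_of_real (poisson2 (z, w) \<zeta>) \<partial>\<sigma>)"
      using that by (intro Bochner_Integration.integral_cong)
        (auto simp: space_eq polarized_poisson_diag poisson2_def mult_ac)
    also have "\<dots> = of_real ((1 - (cmod (b (z, w)))\<^sup>2) / (cmod (\<alpha> - b (z, w)))\<^sup>2)"
      using clark that unfolding is_clark_measure_def integral_complex_of_real by (simp del: of_real_divide)
    also have "\<dots> = (herglotz (z, w) + cnj (herglotz (z, w))) / 2"
      using that by (intro Re_herglotz[symmetric]) auto
    finally show ?thesis .
  qed
  have one: "(\<integral>\<zeta>. polarized_poisson w (cnj w) (snd \<zeta>) * polarized_poisson z v (fst \<zeta>) \<partial>\<sigma>) =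
      herglotz (z, w) / 2 + cnj (herglotz (cnj v, w)) / 2"
    if zv: "cmod z < 1" "cmod v < 1" and w: "cmod w < 1" for z v w
  proof -
    interpret bounded_kernel \<sigma> "\<lambda>\<zeta>. polarized_poisson w (cnj w) (snd \<zeta>)" fst
      "1 / (1 - cmod w) + 1 / (1 - cmod (cnj w)) + 1"
      by (rule bk1) (use w in auto)
    show ?thesis
    proof (rule polarization[of "\<lambda>z. herglotz (z, w) / 2" "\<lambda>v. cnj (herglotz (cnj v, w)) / 2"])
      show "(\<lambda>z. herglotz (z, w) / 2) holomorphic_on ball 0 1"
        "(\<lambda>v. cnj (herglotz (cnj v, w)) / 2) holomorphic_on ball 0 1"
        using w by (auto intro!: holomorphic_intros hol1 holomorphic_on_ball_cnj_cnj)
    qed (use zv w diag in \<open>auto simp: space_eq add_divide_distrib\<close>)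
  qed
  interpret bounded_kernel \<sigma> "\<lambda>\<zeta>. polarized_poisson z1 v1 (fst \<zeta>)" snd
    "1 / (1 - cmod z1) + 1 / (1 - cmod v1) + 1"
    by (rule bk2) (use z v in auto)
  have "(\<integral>\<zeta>. polarized_poisson z1 v1 (fst \<zeta>) * polarized_poisson z2 v2 (snd \<zeta>) \<partial>\<sigma>) =
    herglotz (z1, z2) / 2 + cnj (herglotz (cnj v1, cnj v2)) / 2"
  proof (rule polarization[of "\<lambda>z. herglotz (z1, z) / 2" "\<lambda>w. cnj (herglotz (cnj v1, cnj w)) / 2"])
    show "(\<lambda>z. herglotz (z1, z) / 2) holomorphic_on ball 0 1"
      "(\<lambda>w. cnj (herglotz (cnj v1, cnj w)) / 2) holomorphic_on ball 0 1"
      using z v by (auto intro!: holomorphic_intros hol2 holomorphic_on_ball_cnj_cnj)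
  qed (use z v one in \<open>auto simp: space_eq mult.commute\<close>)
  then show ?thesis by (simp add: add_divide_distrib)
qed

text \<open>This is \<open>polarized_identity\<close> at \<open>v = cnj w\<close>, multiplied by
  \<open>C(z, w)\<close>; the half sum of Cayley transforms yields the factor
  \<open>1 - b z * cnj (b w)\<close> because \<open>\<alpha> * cnj \<alpha> = 1\<close>.\<close>

lemma kernel_identity:
  assumes z: "z \<in> bidisc" and w: "w \<in> bidisc"
  shows "(\<integral>\<zeta>. cauchy_kernel \<zeta> w * cnj (cauchy_kernel \<zeta> z) \<partial>\<sigma>) =
    dBR_kernel b z w / ((\<alpha> - b z) * cnj (\<alpha> - b w))"
proof -
  obtain z1 z2 w1 w2 where zw: "z = (z1, z2)" "w = (w1, w2)" by (metis surj_pair)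
  have less: "cmod z1 < 1" "cmod z2 < 1" "cmod w1 < 1" "cmod w2 < 1" using z w zw by auto
  have "cauchy_kernel \<zeta> w * cnj (cauchy_kernel \<zeta> z) = cauchy_kernel z w *
      (polarized_poisson z1 (cnj w1) (fst \<zeta>) * polarized_poisson z2 (cnj w2) (snd \<zeta>))" if "\<zeta> \<in> torus" for \<zeta>
  proof -
    have nz: "1 - z1 * cnj w1 \<noteq> 0" "1 - z2 * cnj w2 \<noteq> 0"
      using less by (intro one_minus_mult_nonzero; simp)+
    have "cmod (fst \<zeta>) = 1" "cmod (snd \<zeta>) = 1" using that by auto
    then show ?thesis
      using nz less by (simp add: zw cauchy_kernel_def polarized_poisson_eq mult_ac)
  qed
  then have "(\<integral>\<zeta>. cauchy_kernel \<zeta> w * cnj (cauchy_kernel \<zeta> z) \<partial>\<sigma>) = (\<integral>\<zeta>. cauchy_kernel z w *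
      (polarized_poisson z1 (cnj w1) (fst \<zeta>) * polarized_poisson z2 (cnj w2) (snd \<zeta>)) \<partial>\<sigma>)"
    by (intro Bochner_Integration.integral_cong refl) (simp only: space_eq)
  also have "\<dots> = cauchy_kernel z w * ((herglotz z + cnj (herglotz w)) / 2)"
    using polarized_identity[of z1 z2 "cnj w1" "cnj w2"] less
    by (simp only: integral_mult_right_zero zw complex_mod_cnj complex_cnj_cnj)
  also have "(herglotz z + cnj (herglotz w)) / 2 = (1 - b z * cnj (b w)) / ((\<alpha> - b z) * cnj (\<alpha> - b w))"
  proof -
    have a: "\<alpha> * cnj \<alpha> = 1" using alpha by (simp add: complex_norm_square[symmetric])
    have "cnj (\<alpha> - b w) \<noteq> 0" using alpha_neq[OF w] by (metis complex_cnj_zero_iff)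
    then show ?thesis
      using alpha_neq[OF z] a unfolding herglotz_def by (simp add: divide_simps) (simp add: algebra_simps)
  qed
  finally show ?thesis by (simp add: dBR_kernel_def)
qed

end

text \<open>If mixed Fourier coefficients vanish, a fibre \<open>\<phi> = a\<close> of positive mass carries a multiple of
  Lebesgue measure: \<open>(1 - r) polarized_poisson (r a) 0\<close> and \<open>(1 - r) polarized_poisson 0 (r cnj a)\<close> both
  tend to the indicator of the fibre, and the limits depend on only one of the remaining variables each.\<close>

lemma fibre_poisson_integral:
  fixes \<phi> \<psi> :: "'a \<Rightarrow> complex"
  assumes fin: "finite_measure M"
    and meas [measurable]: "\<phi> \<in> borel_measurable M" "\<psi> \<in> borel_measurable M"
    and unit: "\<And>x. x \<in> space M \<Longrightarrow> cmod (\<phi> x) = 1" "\<And>x. x \<in> space M \<Longrightarrow> cmod (\<psi> x) = 1"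
    and sum: "\<And>z v z' v'. cmod z < 1 \<Longrightarrow> cmod v < 1 \<Longrightarrow> cmod z' < 1 \<Longrightarrow> cmod v' < 1 \<Longrightarrow>
      (\<integral>x. polarized_poisson z v (\<phi> x) * polarized_poisson z' v' (\<psi> x) \<partial>M) = f z z' + g v v'"
    and a: "cmod a = 1" and z: "cmod z < 1" and v: "cmod v < 1"
  shows "(\<integral>x. indicator {x \<in> space M. \<phi> x = a} x * polarized_poisson z v (\<psi> x) \<partial>M) =
    of_real (measure M {x \<in> space M. \<phi> x = a})"
proof -
  interpret finite_measure M by fact
  define L where "L = {x \<in> space M. \<phi> x = a}"
  have [measurable]: "L \<in> sets M" unfolding L_def by measurable
  define J where "J z v = (\<integral>x. indicator L x * polarized_poisson z v (\<psi> x) \<partial>M)" for z v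
  \<comment> \<open>The shift by 2 gives \<open>0 < r n\<close> from \<open>n = 0\<close>
    on.\<close>
  define r where "r n = 1 - inverse (real (n + 2))" for n
  have r: "0 < r n" "r n < 1" for n by (auto simp: r_def field_simps)
  have rlim: "r \<longlonglongrightarrow> 1"
    unfolding r_def using tendsto_diff[OF tendsto_const LIMSEQ_ignore_initial_segment[OF LIMSEQ_inverse_real_of_nat, of 1], of 1]
    by simp
  have aa: "cnj y * y = 1" "y * cnj y = 1" if "cmod y = 1" for y :: complex
  proof -
    show "y * cnj y = 1" using complex_norm_square[of y] that by simp
    then show "cnj y * y = 1" by (subst mult.commute)
  qed
  have point: "(\<lambda>n. of_real (1 - r n) * (1 / (1 - of_real (r n) * y))) \<longlonglongrightarrow> of_bool (y = 1)"
    if y: "cmod y = 1" for y :: complex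
  proof (cases "y = 1")
    case True
    have "of_real (1 - r n) * (1 / (1 - of_real (r n) * y)) = 1" for n
      using less_imp_neq[OF r(2)[of n]] True by simp
    then show ?thesis using True by simp
  next
    case False
    have "(\<lambda>n. of_real (1 - r n) * (1 / (1 - of_real (r n) * y))) \<longlonglongrightarrow> of_real (1 - 1) * (1 / (1 - of_real 1 * y))"
      using False by (intro tendsto_intros rlim) auto
    then show ?thesis using False by simp
  qed
  have small: "cmod (of_real (1 - r n) * (1 / (1 - of_real (r n) * y))) \<le> 1" if "cmod y = 1" for y n
  proof -
    have "1 - r n \<le> cmod (1 - of_real (r n) * y)"
      using r[of n] that by (intro one_minus_mult_norm_ge) auto
    then have "cmod (1 / (1 - of_real (r n) * y)) \<le> 1 / (1 - r n)" using r[of n] by (intro norm_divide_le) auto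
    then have "(1 - r n) * cmod (1 / (1 - of_real (r n) * y)) \<le> (1 - r n) * (1 / (1 - r n))"
      using r[of n] by (intro mult_left_mono) auto
    moreover have "cmod (of_real (1 - r n)) = 1 - r n" using r[of n] by (simp only: norm_of_real)
    moreover have "(1 - r n) * (1 / (1 - r n)) = 1" using r[of n] by simp
    ultimately show ?thesis by (simp only: norm_mult)
  qed
  \<comment> \<open>\<open>k\<close> will be \<open>a * cnj y\<close> or \<open>cnj a * y\<close>:
    unimodular on the circle and equal to 1 exactly at \<open>y = a\<close>. The two choices belong
    to the two halves of the polarized kernel.\<close>
  have conv: "(\<lambda>n. of_real (1 - r n) * (\<integral>x. h n (\<phi> x) * polarized_poisson z v (\<psi> x) \<partial>M)) \<longlonglongrightarrow> J z v"
    if h: "\<And>n y. h n y = 1 / (1 - of_real (r n) * k y)" "\<And>y. cmod y = 1 \<Longrightarrow> cmod (k y) = 1"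
      "\<And>y. cmod y = 1 \<Longrightarrow> k y = 1 \<longleftrightarrow> y = a" "k \<in> borel_measurable borel"
      and zv: "cmod z < 1" "cmod v < 1" for h k z v
  proof -
    have [measurable]: "(\<lambda>x. h n (\<phi> x)) \<in> borel_measurable M" for n
      unfolding h(1) using h(4) by measurable
    have "(\<lambda>n. \<integral>x. of_real (1 - r n) * h n (\<phi> x) * polarized_poisson z v (\<psi> x) \<partial>M) \<longlonglongrightarrow> J z v"
      unfolding J_def
    proof (rule tendsto_integral_bounded[OF fin, where B = "1 * (1 / (1 - cmod z) + 1 / (1 - cmod v) + 1)"])
      fix x assume x: "x \<in> space M"
      show "cmod (of_real (1 - r n) * h n (\<phi> x) * polarized_poisson z v (\<psi> x))
          \<le> 1 * (1 / (1 - cmod z) + 1 / (1 - cmod v) + 1)" for n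
        unfolding norm_mult[of _ "polarized_poisson z v (\<psi> x)"] h(1)
        using zv unit[OF x] h(2) by (intro mult_mono small polarized_poisson_bound) auto
      have "(\<lambda>n. of_real (1 - r n) * h n (\<phi> x)) \<longlonglongrightarrow> of_bool (k (\<phi> x) = 1)"
        unfolding h(1) by (rule point) (use h(2) unit[OF x] in auto)
      also have "of_bool (k (\<phi> x) = 1) = indicator L x"
        using h(3)[of "\<phi> x"] unit(1)[OF x] x by (simp add: L_def indicator_def)
      finally show "(\<lambda>n. of_real (1 - r n) * h n (\<phi> x) * polarized_poisson z v (\<psi> x))
          \<longlonglongrightarrow> indicator L x * polarized_poisson z v (\<psi> x)"
        by (intro tendsto_intros)
    qed measurable
    then show ?thesis by (simp add: mult.assoc)
  qed
  have to0: "(\<lambda>n. of_real (1 - r n) * c) \<longlonglongrightarrow> (0::complex)" for c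
    using tendsto_mult[OF tendsto_of_real[OF tendsto_diff[OF tendsto_const rlim, of 1]] tendsto_const, of c] by simp
  have v_indep: "J z v = J z 0" if zv: "cmod z < 1" "cmod v < 1" for z v
  proof -
    have lim: "(\<lambda>n. of_real (1 - r n) * (f (of_real (r n) * a) z + g 0 w)) \<longlonglongrightarrow> J z w" if w: "cmod w < 1" for w
    proof -
      have "(\<integral>x. polarized_poisson (of_real (r n) * a) 0 (\<phi> x) * polarized_poisson z w (\<psi> x) \<partial>M) =
          f (of_real (r n) * a) z + g 0 w" for n
        using r[of n] a zv w by (intro sum) (auto simp: norm_mult)
      moreover have "(\<lambda>n. of_real (1 - r n) * (\<integral>x. polarized_poisson (of_real (r n) * a) 0 (\<phi> x)
          * polarized_poisson z w (\<psi> x) \<partial>M)) \<longlonglongrightarrow> J z w"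
      proof (rule conv[where k = "\<lambda>y. a * cnj y"])
        show "a * cnj y = 1 \<longleftrightarrow> y = a" if "cmod y = 1" for y
        proof
          assume "a * cnj y = 1"
          then have "(a * cnj y) * y = y" by simp
          then show "y = a" using aa[OF that] by (simp only: mult.assoc mult_1_right)
        qed (simp add: aa a)
      qed (use a zv w in \<open>auto simp: polarized_poisson_def norm_mult mult.assoc\<close>)
      ultimately show ?thesis by simp
    qed
    \<comment> \<open>\<open>f (r a) z\<close> may be unbounded as \<open>r\<close> tends to 1, but
      it is the same for the parameters \<open>v\<close> and 0 and cancels; what remains is
      \<open>1 - r\<close> times a constant.\<close>
    have "(\<lambda>n. of_real (1 - r n) * (f (of_real (r n) * a) z + g 0 v)
        - of_real (1 - r n) * (f (of_real (r n) * a) z + g 0 0)) \<longlonglongrightarrow> J z v - J z 0"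
      using zv by (intro tendsto_diff lim) auto
    moreover have "of_real (1 - r n) * (f (of_real (r n) * a) z + g 0 v)
        - of_real (1 - r n) * (f (of_real (r n) * a) z + g 0 0) = of_real (1 - r n) * (g 0 v - g 0 0)" for n
      by (simp add: algebra_simps)
    ultimately have "(\<lambda>n. of_real (1 - r n) * (g 0 v - g 0 0)) \<longlonglongrightarrow> J z v - J z 0" by (simp only:)
    then have "J z v - J z 0 = 0" using to0 by (rule LIMSEQ_unique)
    then show ?thesis by simp
  qed
  have z_indep: "J z 0 = J 0 0" if zv: "cmod z < 1" for z
  proof -
    have lim: "(\<lambda>n. of_real (1 - r n) * (f 0 w + g (of_real (r n) * cnj a) 0)) \<longlonglongrightarrow> J w 0" if w: "cmod w < 1" for w
    proof -
      have "(\<integral>x. polarized_poisson 0 (of_real (r n) * cnj a) (\<phi> x) * polarized_poisson w 0 (\<psi> x) \<partial>M) =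
          f 0 w + g (of_real (r n) * cnj a) 0" for n
        using r[of n] a zv w by (intro sum) (auto simp: norm_mult)
      moreover have "(\<lambda>n. of_real (1 - r n) * (\<integral>x. polarized_poisson 0 (of_real (r n) * cnj a) (\<phi> x)
          * polarized_poisson w 0 (\<psi> x) \<partial>M)) \<longlonglongrightarrow> J w 0"
      proof (rule conv[where k = "\<lambda>y. cnj a * y"])
        show "cnj a * y = 1 \<longleftrightarrow> y = a" if "cmod y = 1" for y
        proof
          assume "cnj a * y = 1"
          then have "a * (cnj a * y) = a" by simp
          then show "y = a" using aa[OF a] by (simp only: mult.assoc[symmetric] mult_1_left)
        qed (simp add: aa a)
      qed (use a zv w in \<open>auto simp: polarized_poisson_def norm_mult mult.assoc\<close>)
      ultimately show ?thesis by simp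
    qed
    have "(\<lambda>n. of_real (1 - r n) * (f 0 z + g (of_real (r n) * cnj a) 0)
        - of_real (1 - r n) * (f 0 0 + g (of_real (r n) * cnj a) 0)) \<longlonglongrightarrow> J z 0 - J 0 0"
      using zv by (intro tendsto_diff lim) auto
    moreover have "of_real (1 - r n) * (f 0 z + g (of_real (r n) * cnj a) 0)
        - of_real (1 - r n) * (f 0 0 + g (of_real (r n) * cnj a) 0) = of_real (1 - r n) * (f 0 z - f 0 0)" for n
      by (simp add: algebra_simps)
    ultimately have "(\<lambda>n. of_real (1 - r n) * (f 0 z - f 0 0)) \<longlonglongrightarrow> J z 0 - J 0 0" by (simp only:)
    then have "J z 0 - J 0 0 = 0" using to0 by (rule LIMSEQ_unique)
    then show ?thesis by simp
  qed
  have "J 0 0 = (\<integral>x. complex_of_real (indicator L x) \<partial>M)"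
    by (simp add: J_def polarized_poisson_def of_real_indicator)
  also have "\<dots> = of_real (measure M L)"
    by (simp only: integral_complex_of_real Bochner_Integration.integral_indicator sets.Int_space_eq2 \<open>L \<in> sets M\<close>)
  finally have "J 0 0 = of_real (measure M L)" .
  then have "J z v = of_real (measure M L)" using v_indep[OF z v] z_indep[OF z] by simp
  then show ?thesis by (simp add: J_def L_def)
qed

lemma le_of_mult_self_le:
  fixes s k :: real
  assumes "s * s \<le> k * s" "0 \<le> s" "0 \<le> k"
  shows "s \<le> k"
  using assms by (cases "s = 0") auto

section \<open>Membership in reproducing kernel Hilbert spaces\<close>

text \<open>The choice \<open>c = - s * cnj D\<close> leaves a real quadratic in \<open>s\<close>,
  minimal at \<open>s = 1 / N\<close>. Stated for bare numbers, the bound serves both the inner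
  product and the defect of a near-minimizer.\<close>

lemma quadratic_nonneg_bound:
  fixes D :: complex
  assumes nn: "\<And>c. 0 \<le> e + 2 * Re (c * D) + (cmod c)\<^sup>2 * N" and "0 \<le> e" "0 \<le> N"
  shows "cmod D \<le> sqrt e * sqrt N"
proof -
  have s: "0 \<le> e - 2 * s * (cmod D)\<^sup>2 + s\<^sup>2 * (cmod D)\<^sup>2 * N" for s :: real
  proof -
    have "Re (- of_real s * cnj D * D) = - s * (cmod D)\<^sup>2"
      unfolding cmod_power2 by (simp add: power2_eq_square algebra_simps)
    moreover have "(cmod (- of_real s * cnj D))\<^sup>2 = s\<^sup>2 * (cmod D)\<^sup>2"
      by (simp add: norm_mult power_mult_distrib)
    ultimately show ?thesis using nn[of "- of_real s * cnj D"] by simp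
  qed
  have "(cmod D)\<^sup>2 \<le> e * N"
  proof (cases "N = 0")
    case True
    show ?thesis
    proof (rule ccontr)
      assume "\<not> (cmod D)\<^sup>2 \<le> e * N"
      then have pos: "0 < (cmod D)\<^sup>2" using True by simp
      \<comment> \<open>Without a quadratic term the linear one can be made to exceed
        \<open>e\<close>, here by 1.\<close>
      define s where "s = (e + 1) / (2 * (cmod D)\<^sup>2)"
      have "2 * s * (cmod D)\<^sup>2 = e + 1" using pos by (simp add: s_def)
      then show False using s[of s] True by simp
    qed
  next
    case False
    then have N: "0 < N" using assms by simp
    have "(1 / N)\<^sup>2 * (cmod D)\<^sup>2 * N = (cmod D)\<^sup>2 / N" using N by (simp add: power2_eq_square)
    then have "(cmod D)\<^sup>2 / N \<le> e" using s[of "1 / N"] by simp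
    then show ?thesis using N by (simp add: field_simps)
  qed
  then show ?thesis using real_le_rsqrt by (metis real_sqrt_mult)
qed

context rkhs
begin

abbreviation sq_norm :: "('a \<Rightarrow> complex) \<Rightarrow> real" where
  "sq_norm f \<equiv> Re (ip f f)"

definition kernel_sum :: "(complex \<times> 'a) list \<Rightarrow> 'a \<Rightarrow> complex" where
  "kernel_sum xs x = (\<Sum>(d, w)\<leftarrow>xs. d * zero_extend X (\<lambda>z. K z w) x)"

lemma kernel_sum_Nil: "kernel_sum [] = (\<lambda>x. 0)"
  and kernel_sum_Cons: "kernel_sum ((d, w) # xs) = (\<lambda>x. d * zero_extend X (\<lambda>z. K z w) x + kernel_sum xs x)"
  and kernel_sum_append: "kernel_sum (xs @ ys) = (\<lambda>x. kernel_sum xs x + kernel_sum ys x)"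
  by (auto simp: kernel_sum_def)

lemma kernel_sum_scale: "kernel_sum (map (\<lambda>(d, w). (c * d, w)) xs) = (\<lambda>x. c * kernel_sum xs x)"
  by (induction xs) (auto simp: kernel_sum_def fun_eq_iff algebra_simps)

lemma kernel_sum_mem: "snd ` set xs \<subseteq> X \<Longrightarrow> kernel_sum xs \<in> H"
  by (induction xs) (auto simp: kernel_sum_Nil kernel_sum_Cons intro!: zero_mem add_mem scale_mem kernel_mem)

lemma ip_add_right: "f \<in> H \<Longrightarrow> g \<in> H \<Longrightarrow> h \<in> H \<Longrightarrow> ip h (\<lambda>x. f x + g x) = ip h f + ip h g"
  using ip_cnj[of "\<lambda>x. f x + g x" h] ip_cnj[of f h] ip_cnj[of g h] by (simp add: ip_add add_mem)

lemma ip_scale_right: "f \<in> H \<Longrightarrow> g \<in> H \<Longrightarrow> ip g (\<lambda>x. c * f x) = cnj c * ip g f"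
  using ip_cnj[of "\<lambda>x. c * f x" g] ip_cnj[of f g] by (simp add: ip_scale scale_mem)

lemma diff_eq: "f - g = (\<lambda>x. f x + (- 1) * g x)" for f g :: "'a \<Rightarrow> complex"
  by (simp add: fun_eq_iff)

lemma diff_mem: "f \<in> H \<Longrightarrow> g \<in> H \<Longrightarrow> f - g \<in> H"
  unfolding diff_eq by (intro add_mem scale_mem)

lemma ip_diff_right: "f \<in> H \<Longrightarrow> g \<in> H \<Longrightarrow> h \<in> H \<Longrightarrow> ip h (f - g) = ip h f - ip h g"
  unfolding diff_eq using ip_scale_right[of g h "-1"] ip_add_right[OF _ scale_mem, of f g h "-1"] by simp

lemma Im_ip_self: "f \<in> H \<Longrightarrow> ip f f = of_real (sq_norm f)"
  using ip_cnj[of f f] by (simp add: complex_eq_iff)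

lemma sq_norm_add_scale:
  assumes "f \<in> H" "g \<in> H"
  shows "sq_norm (\<lambda>x. f x + c * g x) = sq_norm f + 2 * Re (c * ip g f) + (cmod c)\<^sup>2 * sq_norm g"
proof -
  have "ip (\<lambda>x. f x + c * g x) (\<lambda>x. f x + c * g x) =
      ip f f + (c * ip g f + cnj (c * ip g f)) + c * cnj c * ip g g"
    using assms ip_cnj[of g f]
    by (simp add: ip_add ip_add_right ip_scale ip_scale_right scale_mem add_mem algebra_simps)
  also have "\<dots> = ip f f + of_real (2 * Re (c * ip g f)) + of_real ((cmod c)\<^sup>2) * of_real (sq_norm g)"
    using Im_ip_self[OF assms(2)] by (simp only: complex_add_cnj complex_norm_square)
  finally show ?thesis by simp
qed

lemma Cauchy_Schwarz:
  assumes "f \<in> H" "g \<in> H"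
  shows "cmod (ip g f) \<le> sqrt (sq_norm f) * sqrt (sq_norm g)"
proof (rule quadratic_nonneg_bound)
  show "0 \<le> sq_norm f + 2 * Re (c * ip g f) + (cmod c)\<^sup>2 * sq_norm g" for c
    using ip_nonneg[of "\<lambda>x. f x + c * g x"] sq_norm_add_scale[OF assms] assms
    by (simp add: add_mem scale_mem)
qed (use ip_nonneg assms in auto)

lemma ip_kernel_sum:
  assumes "snd ` set xs \<subseteq> X" "f \<in> H"
  shows "ip (kernel_sum xs) f = (\<Sum>(d, w)\<leftarrow>xs. d * cnj (f w))"
  using assms(1)
proof (induction xs)
  case Nil
  then show ?case using ip_scale[OF zero_mem assms(2), of 0] by (simp add: kernel_sum_Nil)
next
  case (Cons x xs)
  obtain d w where x: "x = (d, w)" by (cases x)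
  have w: "w \<in> X" and k: "zero_extend X (\<lambda>z. K z w) \<in> H" and s: "kernel_sum xs \<in> H"
    using Cons.prems x by (auto intro: kernel_mem kernel_sum_mem)
  have "ip (zero_extend X (\<lambda>z. K z w)) f = cnj (f w)"
    using reproducing[OF assms(2) w] ip_cnj[OF assms(2) k] by simp
  then show ?case
    using Cons k s assms(2) by (simp add: x kernel_sum_Cons ip_add ip_scale scale_mem)
qed

lemma bounded_functional_of_mem:
  assumes "zero_extend X h \<in> H" and xs: "snd ` set xs \<subseteq> X"
  shows "cmod (\<Sum>(d, w)\<leftarrow>xs. d * cnj (h w))
    \<le> sqrt (sq_norm (zero_extend X h)) * sqrt (sq_norm (kernel_sum xs))"
proof -
  have "(\<Sum>(d, w)\<leftarrow>xs. d * cnj (h w)) = (\<Sum>(d, w)\<leftarrow>xs. d * cnj (zero_extend X h w))"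
    using xs by (intro arg_cong[where f = sum_list] map_cong) (auto simp: zero_extend_def)
  also have "\<dots> = ip (kernel_sum xs) (zero_extend X h)" using ip_kernel_sum[OF xs assms(1)] by simp
  finally show ?thesis using Cauchy_Schwarz[OF assms(1) kernel_sum_mem[OF xs]] by simp
qed

text \<open>Riesz representation on the span of the kernels: minimize \<open>\<parallel>x\<parallel>\<^sup>2 - 2 Re \<Lambda> x\<close>.\<close>

lemma mem_of_bounded_functional:
  assumes M: "0 \<le> M" and bd: "\<And>xs. snd ` set xs \<subseteq> X \<Longrightarrow>
    cmod (\<Sum>(d, w)\<leftarrow>xs. d * cnj (h w)) \<le> M * sqrt (sq_norm (kernel_sum xs))"
  shows "zero_extend X h \<in> H"
proof -
  define V where "V = {xs :: (complex \<times> 'a) list. snd ` set xs \<subseteq> X}"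
  define \<Lambda> where "\<Lambda> xs = (\<Sum>(d, w)\<leftarrow>xs. d * cnj (h w))" for xs
  define J where "J xs = sq_norm (kernel_sum xs) - 2 * Re (\<Lambda> xs)" for xs
  have mem: "kernel_sum xs \<in> H" if "xs \<in> V" for xs using that by (auto simp: V_def intro: kernel_sum_mem)
  have nn: "0 \<le> sq_norm (kernel_sum xs)" if "xs \<in> V" for xs using mem[OF that] by (rule ip_nonneg)
  \<comment> \<open>Completing the square: \<open>x\<^sup>2 - 2 * M * x \<ge> - M\<^sup>2\<close>
    for the norm \<open>x\<close>.\<close>
  have lower: "- (M\<^sup>2) \<le> J xs" if "xs \<in> V" for xs
  proof -
    have "Re (\<Lambda> xs) \<le> M * sqrt (sq_norm (kernel_sum xs))"
      using bd[of xs] complex_Re_le_cmod[of "\<Lambda> xs"] that by (auto simp: V_def \<Lambda>_def)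
    moreover have "(sqrt (sq_norm (kernel_sum xs)))\<^sup>2 = sq_norm (kernel_sum xs)" using nn[OF that] by simp
    moreover have "0 \<le> (sqrt (sq_norm (kernel_sum xs)) - M)\<^sup>2" by simp
    ultimately show ?thesis unfolding J_def by (simp add: power2_diff algebra_simps)
  qed
  define i where "i = (INF xs\<in>V. J xs)"
  have bdd: "bdd_below (J ` V)" using lower by (intro bdd_belowI2)
  have i_le: "i \<le> J xs" if "xs \<in> V" for xs unfolding i_def by (rule cINF_lower[OF bdd that])
  have V: "[] \<in> V" by (simp add: V_def)
  have "\<exists>xs\<in>V. J xs < i + inverse (real (Suc n))" for n
  proof (rule ccontr)
    assume "\<not> ?thesis"
    then have "i + inverse (real (Suc n)) \<le> i"
      unfolding i_def by (intro cINF_greatest) (use V in \<open>auto simp: not_less i_def\<close>)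
    then show False by simp
  qed
  then obtain u where u: "\<And>n. u n \<in> V" "\<And>n. J (u n) < i + inverse (real (Suc n))" by metis
  define e where "e n = J (u n) - i" for n
  have e: "0 \<le> e n" "e n \<le> inverse (real (Suc n))" for n
    using i_le[OF u(1)[of n]] u(2)[of n] by (auto simp: e_def)
  have "e \<longlonglongrightarrow> 0"
    by (rule tendsto_sandwich[OF _ _ tendsto_const LIMSEQ_inverse_real_of_nat]) (use e in auto)
  from tendsto_real_sqrt[OF this] have sqrt_e: "(\<lambda>n. sqrt (e n)) \<longlonglongrightarrow> 0" by simp
  \<comment> \<open>Moving the near-minimizer by \<open>c * ys\<close> lowers \<open>J\<close> by at
    most \<open>e n\<close>, for every complex \<open>c\<close>;
    \<open>quadratic_nonneg_bound\<close> turns this into closeness of the two functionals at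
    \<open>ys\<close>.\<close>
  have approx: "cmod (ip (kernel_sum ys) (kernel_sum (u n)) - \<Lambda> ys) \<le> sqrt (e n) * sqrt (sq_norm (kernel_sum ys))"
    if ys: "ys \<in> V" for ys n
  proof (rule quadratic_nonneg_bound)
    fix c
    let ?zs = "u n @ map (\<lambda>(d, w). (c * d, w)) ys"
    have zs: "?zs \<in> V" using u(1)[of n] ys by (auto simp: V_def)
    have "\<Lambda> ?zs = \<Lambda> (u n) + c * \<Lambda> ys"
      by (simp add: \<Lambda>_def case_prod_unfold o_def mult.assoc sum_list_const_mult)
    moreover have "kernel_sum ?zs = (\<lambda>x. kernel_sum (u n) x + c * kernel_sum ys x)"
      by (simp add: kernel_sum_append kernel_sum_scale)
    ultimately have "J ?zs = J (u n) + 2 * Re (c * (ip (kernel_sum ys) (kernel_sum (u n)) - \<Lambda> ys))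
        + (cmod c)\<^sup>2 * sq_norm (kernel_sum ys)"
      unfolding J_def by (simp add: sq_norm_add_scale[OF mem[OF u(1)] mem[OF ys]] algebra_simps)
    then show "0 \<le> e n + 2 * Re (c * (ip (kernel_sum ys) (kernel_sum (u n)) - \<Lambda> ys))
        + (cmod c)\<^sup>2 * sq_norm (kernel_sum ys)"
      using i_le[OF zs] by (simp add: e_def)
  qed (use e nn[OF ys] in auto)
  \<comment> \<open>Both near-minimizers are tested against their own difference. The values of
    \<open>\<Lambda>\<close> cancel, leaving the squared norm of the difference.\<close>
  have close: "sqrt (sq_norm (kernel_sum (u m) - kernel_sum (u n))) \<le> sqrt (e m) + sqrt (e n)" for m n
  proof -
    let ?ys = "u m @ map (\<lambda>(d, w). (- 1 * d, w)) (u n)"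
    have ys: "?ys \<in> V" using u(1)[of n] u(1)[of m] by (auto simp: V_def)
    have eq: "kernel_sum ?ys = kernel_sum (u m) - kernel_sum (u n)"
      unfolding kernel_sum_append kernel_sum_scale by (simp add: diff_eq)
    let ?s = "sqrt (sq_norm (kernel_sum ?ys))"
    have "of_real (sq_norm (kernel_sum ?ys)) = ip (kernel_sum ?ys) (kernel_sum ?ys)"
      by (rule Im_ip_self[OF mem[OF ys], symmetric])
    also have "\<dots> = ip (kernel_sum ?ys) (kernel_sum (u m)) - ip (kernel_sum ?ys) (kernel_sum (u n))"
      by (subst (2) eq) (rule ip_diff_right[OF mem[OF u(1)] mem[OF u(1)] mem[OF ys]])
    also have "\<dots> = (ip (kernel_sum ?ys) (kernel_sum (u m)) - \<Lambda> ?ys) - (ip (kernel_sum ?ys) (kernel_sum (u n)) - \<Lambda> ?ys)"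
      by simp
    finally have "cmod (of_real (sq_norm (kernel_sum ?ys))) \<le>
        cmod (ip (kernel_sum ?ys) (kernel_sum (u m)) - \<Lambda> ?ys) + cmod (ip (kernel_sum ?ys) (kernel_sum (u n)) - \<Lambda> ?ys)"
      by (simp only: norm_triangle_ineq4)
    then have "cmod (of_real (sq_norm (kernel_sum ?ys))) \<le> sqrt (e m) * ?s + sqrt (e n) * ?s"
      using approx[OF ys, of m] approx[OF ys, of n] by linarith
    then have "?s * ?s \<le> (sqrt (e m) + sqrt (e n)) * ?s"
      using nn[OF ys] by (simp add: algebra_simps)
    then have "?s \<le> sqrt (e m) + sqrt (e n)"
      by (rule le_of_mult_self_le) (use nn[OF ys] e(1)[of m] e(1)[of n] in auto)
    then show ?thesis by (simp only: eq)
  qed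
  have "\<exists>f\<in>H. (\<lambda>n. sqrt (sq_norm (kernel_sum (u n) - f))) \<longlonglongrightarrow> 0"
  proof (rule complete)
    show "kernel_sum (u n) \<in> H" for n by (rule mem[OF u(1)])
    fix \<epsilon> :: real assume "0 < \<epsilon>"
    then obtain N where N: "\<And>n. N \<le> n \<Longrightarrow> sqrt (e n) < \<epsilon> / 2"
      using LIMSEQ_D[OF sqrt_e, of "\<epsilon> / 2"] e(1) by auto
    show "\<exists>N. \<forall>m\<ge>N. \<forall>n\<ge>N. sqrt (sq_norm (kernel_sum (u m) - kernel_sum (u n))) < \<epsilon>"
    proof (intro exI allI impI)
      fix m n assume "N \<le> m" "N \<le> n"
      then show "sqrt (sq_norm (kernel_sum (u m) - kernel_sum (u n))) < \<epsilon>"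
        using close[of m n] N[of m] N[of n] by linarith
    qed
  qed
  then obtain f where f: "f \<in> H" "(\<lambda>n. sqrt (sq_norm (kernel_sum (u n) - f))) \<longlonglongrightarrow> 0" by blast
  \<comment> \<open>Pairing with the kernel at \<open>w\<close> is evaluation at \<open>w\<close>,
    so the limit of the near-minimizers takes the value prescribed by
    \<open>\<Lambda>\<close>.\<close>
  have "f w = h w" if w: "w \<in> X" for w
  proof -
    let ?k = "kernel_sum [(1, w)]"
    have k: "[(1, w)] \<in> V" using w by (simp add: V_def)
    have kf: "ip ?k f = cnj (f w)" using ip_kernel_sum[of "[(1, w)]" f] w f(1) by simp
    have "cmod (cnj (f w) - cnj (h w)) \<le>
      sqrt (sq_norm (kernel_sum (u n) - f)) * sqrt (sq_norm ?k) + sqrt (e n) * sqrt (sq_norm ?k)" for n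
    proof -
      have eq: "cnj (f w) - cnj (h w) = (ip ?k (kernel_sum (u n)) - \<Lambda> [(1, w)]) - ip ?k (kernel_sum (u n) - f)"
        using ip_diff_right[OF mem[OF u(1)[of n]] f(1) mem[OF k]] kf by (simp add: \<Lambda>_def)
      show ?thesis
        unfolding eq
        using norm_triangle_ineq4[of "ip ?k (kernel_sum (u n)) - \<Lambda> [(1, w)]" "ip ?k (kernel_sum (u n) - f)"]
          approx[OF k, of n] Cauchy_Schwarz[OF diff_mem[OF mem[OF u(1)[of n]] f(1)] mem[OF k]]
        by linarith
    qed
    moreover have "(\<lambda>n. sqrt (sq_norm (kernel_sum (u n) - f)) * sqrt (sq_norm ?k) + sqrt (e n) * sqrt (sq_norm ?k))
        \<longlonglongrightarrow> 0 * sqrt (sq_norm ?k) + 0 * sqrt (sq_norm ?k)"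
      by (intro tendsto_intros f sqrt_e)
    ultimately have "cmod (cnj (f w) - cnj (h w)) \<le> 0 * sqrt (sq_norm ?k) + 0 * sqrt (sq_norm ?k)"
      by (intro LIMSEQ_le_const) auto
    then show ?thesis by simp
  qed
  then have "zero_extend X h = f"
    using zero_outside[OF f(1)] by (auto simp: zero_extend_def)
  then show ?thesis using f(1) by simp
qed

end

section \<open>Square integrable densities\<close>

text \<open>Duality in \<open>L\<^sup>2\<close>, tested on bounded nonnegative functions only. In
  this form the condition on the density can be compared with the kernel estimate, in which no
  density occurs.\<close>

lemma RN_deriv_square_integrable_iff:
  assumes fin: "finite_measure \<sigma>1" "finite_measure \<sigma>2" and sets: "sets \<sigma>1 = sets \<sigma>2"
  shows "(absolutely_continuous \<sigma>2 \<sigma>1 \<and> (\<integral>\<^sup>+\<zeta>. (RN_deriv \<sigma>2 \<sigma>1 \<zeta>)\<^sup>2 \<partial>\<sigma>2) < \<infinity>) \<longleftrightarrow>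
    (\<exists>K\<ge>0. \<forall>u B. u \<in> borel_measurable \<sigma>2 \<longrightarrow> (\<forall>x\<in>space \<sigma>2. 0 \<le> u x \<and> u x \<le> B) \<longrightarrow>
      (\<integral>x. u x \<partial>\<sigma>1) \<le> K * sqrt (\<integral>x. (u x)\<^sup>2 \<partial>\<sigma>2))"
    (is "?L \<longleftrightarrow> ?R")
proof -
  interpret s1: finite_measure \<sigma>1 by fact
  interpret s2: finite_measure \<sigma>2 by fact
  have sp: "space \<sigma>1 = space \<sigma>2" by (rule sets_eq_imp_space_eq[OF sets])
  have int: "(\<integral>\<^sup>+x. ennreal (u x) \<partial>\<sigma>1) = ennreal (\<integral>x. u x \<partial>\<sigma>1)"
    and sq: "(\<integral>\<^sup>+x. ennreal ((u x)\<^sup>2) \<partial>\<sigma>2) = ennreal (\<integral>x. (u x)\<^sup>2 \<partial>\<sigma>2)"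
    if [measurable]: "u \<in> borel_measurable \<sigma>2" and u: "\<forall>x\<in>space \<sigma>2. 0 \<le> u x \<and> u x \<le> B"
    for u :: "'a \<Rightarrow> real" and B
  proof -
    have 1: "u \<in> borel_measurable \<sigma>1"
      using that(1) sets by (simp cong: measurable_cong_sets)
    have "integrable \<sigma>1 u"
      by (rule s1.integrable_const_bound[where B = B]) (use u sp 1 in auto)
    then show "(\<integral>\<^sup>+x. ennreal (u x) \<partial>\<sigma>1) = ennreal (\<integral>x. u x \<partial>\<sigma>1)"
      using u sp by (intro nn_integral_eq_integral) auto
    have "integrable \<sigma>2 (\<lambda>x. (u x)\<^sup>2)"
      by (rule s2.integrable_const_bound[where B = "B\<^sup>2"]) (use u in \<open>auto intro!: AE_I2 power_mono\<close>)
    then show "(\<integral>\<^sup>+x. ennreal ((u x)\<^sup>2) \<partial>\<sigma>2) = ennreal (\<integral>x. (u x)\<^sup>2 \<partial>\<sigma>2)"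
      by (intro nn_integral_eq_integral) auto
  qed
  let ?g = "RN_deriv \<sigma>2 \<sigma>1"
  show ?thesis
  proof
    assume L: ?L
    then obtain a where a: "0 \<le> a" "(\<integral>\<^sup>+\<zeta>. (?g \<zeta>)\<^sup>2 \<partial>\<sigma>2) = ennreal a"
      by (cases "\<integral>\<^sup>+\<zeta>. (?g \<zeta>)\<^sup>2 \<partial>\<sigma>2") auto
    show ?R
    proof (intro exI[of _ "sqrt a"] conjI allI impI)
      fix u :: "'a \<Rightarrow> real" and B
      assume u: "u \<in> borel_measurable \<sigma>2" "\<forall>x\<in>space \<sigma>2. 0 \<le> u x \<and> u x \<le> B"
      note [measurable] = u(1)
      have nn: "0 \<le> (\<integral>x. u x \<partial>\<sigma>1)" "0 \<le> (\<integral>x. (u x)\<^sup>2 \<partial>\<sigma>2)"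
        using u sp by (auto intro!: integral_nonneg_AE)
      have "(\<integral>\<^sup>+x. ennreal (u x) \<partial>\<sigma>1) = (\<integral>\<^sup>+x. ?g x * ennreal (u x) \<partial>\<sigma>2)"
        using L sets by (intro s2.RN_deriv_nn_integral) auto
      then have "(ennreal (\<integral>x. u x \<partial>\<sigma>1))\<^sup>2 \<le> ennreal a * (\<integral>\<^sup>+x. (ennreal (u x))\<^sup>2 \<partial>\<sigma>2)"
        using Cauchy_Schwarz_nn_integral[of ?g \<sigma>2 "\<lambda>x. ennreal (u x)"] a int[OF u] by simp
      also have "(\<integral>\<^sup>+x. (ennreal (u x))\<^sup>2 \<partial>\<sigma>2) = (\<integral>\<^sup>+x. ennreal ((u x)\<^sup>2) \<partial>\<sigma>2)"
        using u by (intro nn_integral_cong) (simp add: ennreal_power)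
      also have "\<dots> = ennreal (\<integral>x. (u x)\<^sup>2 \<partial>\<sigma>2)" by (rule sq[OF u])
      finally have "(\<integral>x. u x \<partial>\<sigma>1)\<^sup>2 \<le> a * (\<integral>x. (u x)\<^sup>2 \<partial>\<sigma>2)"
        using nn a by (simp add: ennreal_power ennreal_mult'[symmetric])
      then have "(\<integral>x. u x \<partial>\<sigma>1) \<le> sqrt (a * (\<integral>x. (u x)\<^sup>2 \<partial>\<sigma>2))" by (rule real_le_rsqrt)
      then show "(\<integral>x. u x \<partial>\<sigma>1) \<le> sqrt a * sqrt (\<integral>x. (u x)\<^sup>2 \<partial>\<sigma>2)" by (simp add: real_sqrt_mult)
    qed (use a in simp)
  next
    assume ?R
    then obtain K where K: "0 \<le> K" and bd: "\<And>u B. u \<in> borel_measurable \<sigma>2 \<Longrightarrow>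
        (\<forall>x\<in>space \<sigma>2. 0 \<le> u x \<and> u x \<le> B) \<Longrightarrow> (\<integral>x. u x \<partial>\<sigma>1) \<le> K * sqrt (\<integral>x. (u x)\<^sup>2 \<partial>\<sigma>2)"
      by blast
    have ac: "absolutely_continuous \<sigma>2 \<sigma>1"
      unfolding absolutely_continuous_def
    proof
      fix N assume N: "N \<in> null_sets \<sigma>2"
      then have N2: "N \<in> sets \<sigma>2" by auto
      have "(\<integral>x. indicator N x \<partial>\<sigma>1) \<le> K * sqrt (\<integral>x. (indicator N x)\<^sup>2 \<partial>\<sigma>2)"
        using N2 by (intro bd[of _ 1]) (auto simp: indicator_def)
      also have "(\<lambda>x. (indicator N x)\<^sup>2) = (indicator N :: 'a \<Rightarrow> real)"
        by (auto simp: indicator_def)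
      also have "(\<integral>x. indicator N x \<partial>\<sigma>2) = measure \<sigma>2 N"
        using N2 by (simp add: sets.Int_space_eq2)
      also have "measure \<sigma>2 N = 0" using N by (simp add: measure_eq_0_null_sets)
      also have "(\<integral>x. indicator N x \<partial>\<sigma>1) = measure \<sigma>1 N"
        using N2 sets by (simp add: sets.Int_space_eq2)
      finally have "measure \<sigma>1 N = 0" by (simp add: measure_le_0_iff)
      then show "N \<in> null_sets \<sigma>1" using N2 sets by (auto simp: s1.emeasure_eq_measure)
    qed
    have fin_g: "AE x in \<sigma>2. ?g x \<noteq> \<infinity>"
      by (rule s2.RN_deriv_finite[OF s1.sigma_finite_measure_axioms ac sets])
    define G where "G x = enn2real (?g x)" for x
    have [measurable]: "G \<in> borel_measurable \<sigma>2" unfolding G_def by measurable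
    have G0: "0 \<le> G x" for x by (simp add: G_def)
    define u where "u n x = (if G x \<le> real n then G x else 0)" for n x
    have [measurable]: "u n \<in> borel_measurable \<sigma>2" for n unfolding u_def by measurable
    have u_bd: "\<forall>x\<in>space \<sigma>2. 0 \<le> u n x \<and> u n x \<le> real n" for n by (auto simp: u_def G0)
    \<comment> \<open>The truncated density is its own test function: the integral of
      \<open>(u n)\<^sup>2\<close> is at most that of \<open>u n\<close> against \<sigma>1, hence at
      most \<open>K\<close> times its own square root.\<close>
    have le: "(\<integral>\<^sup>+x. ennreal ((u n x)\<^sup>2) \<partial>\<sigma>2) \<le> ennreal (K\<^sup>2)" for n
    proof -
      let ?s = "\<integral>x. (u n x)\<^sup>2 \<partial>\<sigma>2"
      have s0: "0 \<le> ?s" by simp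
      have "ennreal ?s = (\<integral>\<^sup>+x. ennreal ((u n x)\<^sup>2) \<partial>\<sigma>2)" by (rule sq[symmetric, OF _ u_bd]) simp
      also have "\<dots> \<le> (\<integral>\<^sup>+x. ?g x * ennreal (u n x) \<partial>\<sigma>2)"
      proof (rule nn_integral_mono)
        fix x
        have "ennreal (G x) \<le> ?g x" unfolding G_def by (cases "?g x") auto
        then have "ennreal (G x) * ennreal (u n x) \<le> ?g x * ennreal (u n x)" by (rule mult_right_mono) simp
        then show "ennreal ((u n x)\<^sup>2) \<le> ?g x * ennreal (u n x)"
          by (auto simp: u_def power2_eq_square ennreal_mult G0)
      qed
      also have "\<dots> = (\<integral>\<^sup>+x. ennreal (u n x) \<partial>\<sigma>1)"
        using ac sets by (intro s2.RN_deriv_nn_integral[symmetric]) auto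
      also have "\<dots> = ennreal (\<integral>x. u n x \<partial>\<sigma>1)" by (rule int[OF _ u_bd]) simp
      also have "\<dots> \<le> ennreal (K * sqrt ?s)" by (intro ennreal_leI bd[OF _ u_bd]) simp
      finally have "?s \<le> K * sqrt ?s" using K s0 by simp
      then have "sqrt ?s * sqrt ?s \<le> K * sqrt ?s" using s0 by simp
      then have "sqrt ?s \<le> K" by (rule le_of_mult_self_le) (use s0 K in auto)
      then have "?s \<le> K\<^sup>2" using s0 by (simp add: sqrt_le_D)
      then show ?thesis by (subst sq[OF _ u_bd]) (auto intro: ennreal_leI)
    qed
    have "(\<integral>\<^sup>+x. (?g x)\<^sup>2 \<partial>\<sigma>2) = (\<integral>\<^sup>+x. ennreal ((G x)\<^sup>2) \<partial>\<sigma>2)"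
    proof (rule nn_integral_cong_AE)
      show "AE x in \<sigma>2. (?g x)\<^sup>2 = ennreal ((G x)\<^sup>2)"
        using fin_g
      proof eventually_elim
        case (elim x)
        then have "?g x = ennreal (G x)" unfolding G_def by (simp add: less_top)
        then show ?case by (simp add: ennreal_power G0)
      qed
    qed
    also have "\<dots> = (\<integral>\<^sup>+x. (SUP n. ennreal ((u n x)\<^sup>2)) \<partial>\<sigma>2)"
    proof (rule nn_integral_cong)
      fix x
      obtain n where n: "G x \<le> real n" using real_arch_simple by blast
      show "ennreal ((G x)\<^sup>2) = (SUP n. ennreal ((u n x)\<^sup>2))"
      proof (rule antisym)
        show "ennreal ((G x)\<^sup>2) \<le> (SUP n. ennreal ((u n x)\<^sup>2))"
          by (rule SUP_upper2[of n]) (use n in \<open>auto simp: u_def\<close>)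
        show "(SUP n. ennreal ((u n x)\<^sup>2)) \<le> ennreal ((G x)\<^sup>2)"
          by (rule SUP_least) (auto simp: u_def intro!: ennreal_leI)
      qed
    qed
    also have "\<dots> = (SUP n. \<integral>\<^sup>+x. ennreal ((u n x)\<^sup>2) \<partial>\<sigma>2)"
    proof (rule nn_integral_monotone_convergence_SUP)
      show "incseq (\<lambda>n x. ennreal ((u n x)\<^sup>2))"
        by (intro incseq_SucI le_funI ennreal_leI) (auto simp: u_def)
    qed simp
    also have "\<dots> \<le> ennreal (K\<^sup>2)" by (rule SUP_least) (rule le)
    also have "\<dots> < \<infinity>" by simp
    finally show ?L using ac by simp
  qed
qed

section \<open>Uniqueness on fibres\<close>

text \<open>On the fibre \<open>\<phi> = a\<close> the trigonometric polynomials in \<open>\<psi>\<close> form an algebra whose bounded pointwise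
  limits exhaust the bounded Borel functions.\<close>

lemma fibre_integral_unique:
  fixes M1 M2 :: "(complex \<times> complex) measure" and \<phi> \<psi> :: "complex \<times> complex \<Rightarrow> complex"
  assumes coord: "\<phi> = fst \<and> \<psi> = snd \<or> \<phi> = snd \<and> \<psi> = fst"
    and fin: "finite_measure M1" "finite_measure M2"
    and sets: "sets M1 = sets torus_borel" "sets M2 = sets torus_borel"
    and L: "L = {\<zeta> \<in> torus. \<phi> \<zeta> = a}"
    and res: "\<And>v. cmod v < 1 \<Longrightarrow>
      of_real m2 * (\<integral>\<zeta>. indicator L \<zeta> * (1 / (1 - \<psi> \<zeta> * v)) \<partial>M1) =
      of_real m1 * (\<integral>\<zeta>. indicator L \<zeta> * (1 / (1 - \<psi> \<zeta> * v)) \<partial>M2)"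
    and f: "f \<in> borel_measurable torus_borel" "\<And>\<zeta>. \<zeta> \<in> torus \<Longrightarrow> cmod (f \<zeta>) \<le> B"
  shows "of_real m2 * (\<integral>\<zeta>. indicator L \<zeta> * f \<zeta> \<partial>M1) = of_real m1 * (\<integral>\<zeta>. indicator L \<zeta> * f \<zeta> \<partial>M2)"
proof -
  interpret M1: finite_measure M1 by fact
  interpret M2: finite_measure M2 by fact
  have sp: "space M1 = torus" "space M2 = torus"
    using sets_eq_imp_space_eq[OF sets(1)] sets_eq_imp_space_eq[OF sets(2)] by (simp_all add: space_torus_borel)
  have meas: "f \<in> borel_measurable M1 \<longleftrightarrow> f \<in> borel_measurable torus_borel"
    "f \<in> borel_measurable M2 \<longleftrightarrow> f \<in> borel_measurable torus_borel" for f :: "complex \<times> complex \<Rightarrow> complex"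
    using measurable_cong_sets[OF sets(1) refl] measurable_cong_sets[OF sets(2) refl] by blast+
  have \<phi>\<psi>: "\<phi> \<in> borel_measurable torus_borel" "\<psi> \<in> borel_measurable torus_borel"
    using coord torus_borel_measurable by auto
  have L_sets: "L \<in> sets torus_borel"
  proof -
    have "{\<zeta> \<in> space torus_borel. \<phi> \<zeta> = a} \<in> sets torus_borel"
      using \<phi>\<psi>(1) by measurable
    then show ?thesis by (simp add: L space_torus_borel)
  qed
  have indL: "(\<lambda>\<zeta>. indicator L \<zeta>  :: complex) \<in> borel_measurable torus_borel"
    using L_sets by (rule borel_measurable_indicator)
  define I where "I f = of_real m2 * (\<integral>\<zeta>. indicator L \<zeta> * f \<zeta> \<partial>M1)
      - of_real m1 * (\<integral>\<zeta>. indicator L \<zeta> * f \<zeta> \<partial>M2)" for f :: "complex \<times> complex \<Rightarrow> complex"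
  define Bd where "Bd = {f :: complex \<times> complex \<Rightarrow> complex. f \<in> borel_measurable torus_borel \<and> (\<exists>B. \<forall>\<zeta>\<in>torus. cmod (f \<zeta>) \<le> B)}"
  have BdI: "f \<in> Bd" if "f \<in> borel_measurable torus_borel" "\<And>\<zeta>. \<zeta> \<in> torus \<Longrightarrow> cmod (f \<zeta>) \<le> B" for f B
    using that unfolding Bd_def by blast
  have int: "integrable M1 (\<lambda>\<zeta>. indicator L \<zeta> * f \<zeta>)" "integrable M2 (\<lambda>\<zeta>. indicator L \<zeta> * f \<zeta>)" if f: "f \<in> Bd" for f
  proof -
    obtain B where B: "\<And>\<zeta>. \<zeta> \<in> torus \<Longrightarrow> cmod (f \<zeta>) \<le> B" using f unfolding Bd_def by blast
    have m: "(\<lambda>\<zeta>. indicator L \<zeta> * f \<zeta>) \<in> borel_measurable torus_borel"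
      using f indL unfolding Bd_def by (auto intro: borel_measurable_times)
    have b: "cmod (indicator L \<zeta> * f \<zeta>) \<le> B" if "\<zeta> \<in> torus" for \<zeta>
      using B[OF that] order_trans[OF norm_ge_zero B[OF that]] by (simp add: indicator_def)
    show "integrable M1 (\<lambda>\<zeta>. indicator L \<zeta> * f \<zeta>)"
      by (rule M1.integrable_const_bound[where B = B]) (use m b sp meas in auto)
    show "integrable M2 (\<lambda>\<zeta>. indicator L \<zeta> * f \<zeta>)"
      by (rule M2.integrable_const_bound[where B = B]) (use m b sp meas in auto)
  qed
  have I_cong: "I f = I g" if "\<And>\<zeta>. \<zeta> \<in> L \<Longrightarrow> f \<zeta> = g \<zeta>" for f g
  proof -
    have "(\<lambda>\<zeta>. indicator L \<zeta> * f \<zeta>) = (\<lambda>\<zeta>. indicator L \<zeta> * g \<zeta>)"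
      using that by (auto simp: indicator_def fun_eq_iff)
    then show ?thesis by (simp add: I_def)
  qed
  have I_scale: "I (\<lambda>\<zeta>. c * f \<zeta>) = c * I f" for c f
  proof -
    have "(\<lambda>\<zeta>. indicator L \<zeta> * (c * f \<zeta>)) = (\<lambda>\<zeta>. c * (indicator L \<zeta> * f \<zeta>))" by (simp add: fun_eq_iff)
    then show ?thesis by (simp add: I_def algebra_simps)
  qed
  have I_add: "I (\<lambda>\<zeta>. f \<zeta> + g \<zeta>) = I f + I g" if "f \<in> Bd" "g \<in> Bd" for f g
    using int[OF that(1)] int[OF that(2)] by (simp add: I_def algebra_simps)
  \<comment> \<open>\<open>m1\<close> and \<open>m2\<close> are real, so the zeros of
    \<open>I\<close> are closed under conjugation; negative powers of \<open>\<psi>\<close> will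
    follow from positive ones.\<close>
  have I_cnj: "I (\<lambda>\<zeta>. cnj (f \<zeta>)) = cnj (I f)" for f
  proof -
    have "(\<lambda>\<zeta>. indicator L \<zeta> * cnj (f \<zeta>)) = (\<lambda>\<zeta>. cnj (indicator L \<zeta> * f \<zeta>))"
      by (simp add: fun_eq_iff indicator_def)
    then show ?thesis by (simp add: I_def del: complex_cnj_mult) simp
  qed
  have I_lim: "I g = 0" if u: "\<And>n. u n \<in> Bd" "\<And>n. I (u n) = 0"
      and B: "\<And>n x. x \<in> torus \<Longrightarrow> cmod (u n x) \<le> B" and lim: "\<And>x. x \<in> torus \<Longrightarrow> (\<lambda>n. u n x) \<longlonglongrightarrow> g x"
    for u g B
  proof -
    have m: "(\<lambda>\<zeta>. indicator L \<zeta> * u n \<zeta>) \<in> borel_measurable torus_borel" for n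
      using u(1)[of n] indL unfolding Bd_def by (auto intro: borel_measurable_times)
    have b: "cmod (indicator L \<zeta> * u n \<zeta>) \<le> B" if "\<zeta> \<in> torus" for \<zeta> n
      using B[OF that] order_trans[OF norm_ge_zero B[OF that]] by (simp add: indicator_def)
    have l: "(\<lambda>n. indicator L x * u n x) \<longlonglongrightarrow> indicator L x * g x" if "x \<in> torus" for x
      by (intro tendsto_intros lim that)
    have "(\<lambda>n. \<integral>\<zeta>. indicator L \<zeta> * u n \<zeta> \<partial>M1) \<longlonglongrightarrow> (\<integral>\<zeta>. indicator L \<zeta> * g \<zeta> \<partial>M1)"
      by (rule tendsto_integral_bounded[OF fin(1), where B = B]; (subst meas)?) (use m b l sp in blast)+
    moreover have "(\<lambda>n. \<integral>\<zeta>. indicator L \<zeta> * u n \<zeta> \<partial>M2) \<longlonglongrightarrow> (\<integral>\<zeta>. indicator L \<zeta> * g \<zeta> \<partial>M2)"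
      by (rule tendsto_integral_bounded[OF fin(2), where B = B]; (subst meas)?) (use m b l sp in blast)+
    ultimately have "(\<lambda>n. I (u n)) \<longlonglongrightarrow> I g"
      unfolding I_def by (intro tendsto_diff tendsto_mult tendsto_const)
    then show ?thesis unfolding u(2) by (rule LIMSEQ_unique) (rule tendsto_const)
  qed
  have Bd_lim: "g \<in> Bd" if u: "\<And>n. u n \<in> Bd"
      and B: "\<And>n x. x \<in> torus \<Longrightarrow> cmod (u n x) \<le> B" and lim: "\<And>x. x \<in> torus \<Longrightarrow> (\<lambda>n. u n x) \<longlonglongrightarrow> g x"
    for u g B
  proof (rule BdI)
    show "g \<in> borel_measurable torus_borel"
      by (rule borel_measurable_LIMSEQ_metric[of u]) (use u lim in \<open>auto simp: Bd_def space_torus_borel\<close>)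
    show "cmod (g x) \<le> B" if "x \<in> torus" for x
      by (rule Lim_bounded[OF tendsto_norm[OF lim[OF that]], of 0]) (use B that in auto)
  qed
  have Bd_add: "(\<lambda>x. f x + g x) \<in> Bd" if f: "f \<in> Bd" and g: "g \<in> Bd" for f g
  proof -
    obtain B B' where "\<forall>\<zeta>\<in>torus. cmod (f \<zeta>) \<le> B" "\<forall>\<zeta>\<in>torus. cmod (g \<zeta>) \<le> B'"
      using f g unfolding Bd_def by blast
    then show ?thesis
      using f g by (intro BdI[where B = "B + B'"]) (auto simp: Bd_def intro!: norm_triangle_mono)
  qed
  have Bd_mult: "(\<lambda>x. f x * g x) \<in> Bd" if f: "f \<in> Bd" and g: "g \<in> Bd" for f g
  proof -
    obtain B B' where B: "\<forall>\<zeta>\<in>torus. cmod (f \<zeta>) \<le> B" "\<forall>\<zeta>\<in>torus. cmod (g \<zeta>) \<le> B'"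
      using f g unfolding Bd_def by blast
    show ?thesis
    proof (rule BdI[where B = "B * B'"])
      show "cmod (f \<zeta> * g \<zeta>) \<le> B * B'" if "\<zeta> \<in> torus" for \<zeta>
        unfolding norm_mult using B that by (intro mult_mono) (auto intro: order_trans[OF norm_ge_zero])
    qed (use f g in \<open>auto simp: Bd_def\<close>)
  qed
  have Bd_const: "(\<lambda>x. c) \<in> Bd" for c by (rule BdI[where B = "cmod c"]) auto
  have Bd_scale: "(\<lambda>x. c * f x) \<in> Bd" if "f \<in> Bd" for c f
    using Bd_mult[OF Bd_const that] .
  define Q0 where "Q0 = {f \<in> Bd. I f = 0}"
  interpret Q0: bp_closed torus Q0
  proof
    show "\<exists>B. \<forall>x\<in>torus. cmod (f x) \<le> B" if "f \<in> Q0" for f using that by (auto simp: Q0_def Bd_def)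
    show "(\<lambda>x. f x + g x) \<in> Q0" if "f \<in> Q0" "g \<in> Q0" for f g
      using that by (auto simp: Q0_def I_add Bd_add)
    show "(\<lambda>x. c * f x) \<in> Q0" if "f \<in> Q0" for f c using that by (auto simp: Q0_def I_scale Bd_scale)
    fix u g B assume "\<And>n. u n \<in> Q0" "\<And>n x. x \<in> torus \<Longrightarrow> cmod (u n x) \<le> B" "\<And>x. x \<in> torus \<Longrightarrow> (\<lambda>n. u n x) \<longlonglongrightarrow> g x"
    then show "g \<in> Q0" unfolding Q0_def using I_lim[of u B g] Bd_lim[of u B g] by auto
  qed
  have \<psi>_norm: "cmod (\<psi> \<zeta>) = 1" "cmod (\<phi> \<zeta>) = 1" if "\<zeta> \<in> torus" for \<zeta> using coord that by auto
  have \<psi>Bd: "\<psi> \<in> Bd" by (rule BdI[where B = 1]) (use \<phi>\<psi> \<psi>_norm in auto)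
  have \<phi>Bd: "\<phi> \<in> Bd" by (rule BdI[where B = 1]) (use \<phi>\<psi> \<psi>_norm in auto)
  have cnjBd: "(\<lambda>x. cnj (f x)) \<in> Bd" if f: "f \<in> Bd" for f
  proof -
    obtain B where "\<forall>\<zeta>\<in>torus. cmod (f \<zeta>) \<le> B" using f unfolding Bd_def by blast
    moreover have "(\<lambda>x. cnj (f x)) \<in> borel_measurable torus_borel"
      using f measurable_compose[OF _ cnj_measurable] unfolding Bd_def by auto
    ultimately show ?thesis by (intro BdI[where B = B]) auto
  qed
  have powBd: "(\<lambda>x. f x ^ k) \<in> Bd" if "f \<in> Bd" for f k
    by (induction k) (auto intro: Bd_const Bd_mult that)
  \<comment> \<open>Each step of the induction multiplies by \<open>\<psi>\<close> but keeps the
    resolvent with arbitrary \<open>v\<close>, on which the next step relies.\<close>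
  have resQ: "(\<lambda>\<zeta>. \<psi> \<zeta> ^ k / (1 - \<psi> \<zeta> * v)) \<in> Q0" if "cmod v < 1" for k v
    using that
  proof (induction k arbitrary: v)
    case 0
    have "(\<lambda>\<zeta>. 1 / (1 - \<psi> \<zeta> * v)) \<in> Bd"
    proof (rule BdI[where B = "1 / (1 - cmod v)"])
      show "(\<lambda>\<zeta>. 1 / (1 - \<psi> \<zeta> * v)) \<in> borel_measurable torus_borel" using \<phi>\<psi> by measurable
    qed (use \<psi>_norm resolvent_bound[OF _ 0] in auto)
    then show ?case using res[OF 0] by (simp add: Q0_def I_def)
  next
    case (Suc k)
    have "(\<lambda>\<zeta>. \<psi> \<zeta> * \<psi> \<zeta> ^ k / (1 - \<psi> \<zeta> * v)) \<in> Q0"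
      by (rule Q0.resolvent_step(1)[where B = 1]) (use Suc \<psi>_norm in \<open>auto simp: norm_power\<close>)
    then show ?case by simp
  qed
  have pow: "(\<lambda>\<zeta>. \<psi> \<zeta> ^ k) \<in> Q0" for k using resQ[of 0 k] by simp
  have unit: "cnj (\<psi> \<zeta>) * \<psi> \<zeta> = 1" if "\<zeta> \<in> torus" for \<zeta>
    using \<psi>_norm[OF that] complex_norm_square[of "\<psi> \<zeta>"] by (simp add: mult.commute)
  have mono: "(\<lambda>\<zeta>. cnj (\<psi> \<zeta>) ^ n * \<psi> \<zeta> ^ k) \<in> Q0" for n k
  proof (cases "n \<le> k")
    case True
    show ?thesis
    proof (rule Q0.cong[OF pow[of "k - n"]])
      fix \<zeta> assume z: "\<zeta> \<in> torus"
      have "cnj (\<psi> \<zeta>) ^ n * \<psi> \<zeta> ^ k = (cnj (\<psi> \<zeta>) * \<psi> \<zeta>) ^ n * \<psi> \<zeta> ^ (k - n)"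
        using True by (simp add: power_mult_distrib flip: power_add mult.assoc)
      then show "cnj (\<psi> \<zeta>) ^ n * \<psi> \<zeta> ^ k = \<psi> \<zeta> ^ (k - n)" by (simp add: unit[OF z])
    qed
  next
    case False
    have "(\<lambda>\<zeta>. cnj (\<psi> \<zeta> ^ (n - k))) \<in> Q0"
      using pow[of "n - k"] cnjBd[of "\<lambda>\<zeta>. \<psi> \<zeta> ^ (n - k)"] I_cnj[of "\<lambda>\<zeta>. \<psi> \<zeta> ^ (n - k)"] by (simp add: Q0_def)
    then show ?thesis
    proof (rule Q0.cong)
      fix \<zeta> assume z: "\<zeta> \<in> torus"
      have "cnj (\<psi> \<zeta>) ^ n * \<psi> \<zeta> ^ k = (cnj (\<psi> \<zeta>) * \<psi> \<zeta>) ^ k * cnj (\<psi> \<zeta>) ^ (n - k)"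
      proof -
        have "cnj (\<psi> \<zeta>) ^ n = cnj (\<psi> \<zeta>) ^ k * cnj (\<psi> \<zeta>) ^ (n - k)"
          using False by (simp flip: power_add)
        then show ?thesis by (simp add: power_mult_distrib mult_ac)
      qed
      then show "cnj (\<psi> \<zeta>) ^ n * \<psi> \<zeta> ^ k = cnj (\<psi> \<zeta> ^ (n - k))" by (simp add: unit[OF z])
    qed
  qed
  \<comment> \<open>The formula is imposed on \<open>L\<close> only. There \<open>\<phi>\<close> is
    the constant \<open>a\<close>, so \<open>\<phi>\<close> and its conjugate count as trigonometric
    polynomials in \<open>\<psi>\<close> and all four coordinate functions are available.\<close>
  define Trig where "Trig = {f \<in> Bd. \<exists>n s. \<forall>\<zeta>\<in>L. f \<zeta> = cnj (\<psi> \<zeta>) ^ n * poly s (\<psi> \<zeta>)}"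
  have unitL: "\<psi> \<zeta> * cnj (\<psi> \<zeta>) = 1" if "\<zeta> \<in> L" for \<zeta>
    using unit[of \<zeta>] that by (simp add: L mult.commute)
  have Trig_Q0: "f \<in> Q0" if f: "f \<in> Trig" for f
  proof -
    obtain n s where ns: "\<forall>\<zeta>\<in>L. f \<zeta> = cnj (\<psi> \<zeta>) ^ n * poly s (\<psi> \<zeta>)" using f unfolding Trig_def by blast
    have "(\<lambda>\<zeta>. \<Sum>i\<le>degree s. coeff s i * (cnj (\<psi> \<zeta>) ^ n * \<psi> \<zeta> ^ i)) \<in> Q0"
      by (rule Q0.sum) (auto intro: Q0.scale mono)
    then have "I (\<lambda>\<zeta>. \<Sum>i\<le>degree s. coeff s i * (cnj (\<psi> \<zeta>) ^ n * \<psi> \<zeta> ^ i)) = 0" by (simp add: Q0_def)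
    moreover have "I f = I (\<lambda>\<zeta>. \<Sum>i\<le>degree s. coeff s i * (cnj (\<psi> \<zeta>) ^ n * \<psi> \<zeta> ^ i))"
      using ns by (intro I_cong) (simp add: poly_altdef sum_distrib_left mult_ac)
    ultimately show ?thesis using f by (simp add: Q0_def Trig_def)
  qed
  have Trig_mult: "(\<lambda>x. f x * g x) \<in> Trig" and Trig_add: "(\<lambda>x. f x + g x) \<in> Trig"
    if f: "f \<in> Trig" and g: "g \<in> Trig" for f g
  proof -
    obtain n s n' s' where ns: "\<forall>\<zeta>\<in>L. f \<zeta> = cnj (\<psi> \<zeta>) ^ n * poly s (\<psi> \<zeta>)"
      "\<forall>\<zeta>\<in>L. g \<zeta> = cnj (\<psi> \<zeta>) ^ n' * poly s' (\<psi> \<zeta>)" using f g unfolding Trig_def by blast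
    have "\<forall>\<zeta>\<in>L. f \<zeta> * g \<zeta> = cnj (\<psi> \<zeta>) ^ (n + n') * poly (s * s') (\<psi> \<zeta>)"
      using ns by (simp add: power_add)
    then show "(\<lambda>x. f x * g x) \<in> Trig" using f g Bd_mult unfolding Trig_def by blast
    have "\<forall>\<zeta>\<in>L. f \<zeta> + g \<zeta> = cnj (\<psi> \<zeta>) ^ (n + n') * poly (monom 1 n' * s + monom 1 n * s') (\<psi> \<zeta>)"
    proof
      fix \<zeta> assume z: "\<zeta> \<in> L"
      have "cnj (\<psi> \<zeta>) ^ k * \<psi> \<zeta> ^ k = 1" for k
        using unitL[OF z] by (simp add: mult.commute flip: power_mult_distrib)
      then have "cnj (\<psi> \<zeta>) ^ (n + n') * \<psi> \<zeta> ^ n' = cnj (\<psi> \<zeta>) ^ n"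
        "cnj (\<psi> \<zeta>) ^ (n + n') * \<psi> \<zeta> ^ n = cnj (\<psi> \<zeta>) ^ n'"
        by (simp_all add: power_add mult.assoc)
      then show "f \<zeta> + g \<zeta> = cnj (\<psi> \<zeta>) ^ (n + n') * poly (monom 1 n' * s + monom 1 n * s') (\<psi> \<zeta>)"
        using ns z by (simp add: poly_monom distrib_left flip: mult.assoc)
    qed
    then show "(\<lambda>x. f x + g x) \<in> Trig" using f g Bd_add unfolding Trig_def by blast
  qed
  have TrigI: "f \<in> Trig" if "f \<in> Bd" "\<And>\<zeta>. \<zeta> \<in> L \<Longrightarrow> f \<zeta> = cnj (\<psi> \<zeta>) ^ n * poly s (\<psi> \<zeta>)" for f n s
    using that unfolding Trig_def by blast
  have Trig_const: "f \<in> Trig" if "f \<in> Bd" "\<And>\<zeta>. \<zeta> \<in> L \<Longrightarrow> f \<zeta> = c" for f c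
    by (rule TrigI[where n = 0 and s = "[:c:]"]) (use that in auto)
  have Trig_Bd: "f \<in> Bd" if "f \<in> Trig" for f using that by (simp add: Trig_def)
  let ?Q = "bp_closure torus Trig"
  have Qbp: "bp_closed torus ?Q"
  proof (rule bp_closed_bp_closure)
    show "\<exists>B. \<forall>x\<in>torus. cmod (f x) \<le> B" if "f \<in> Trig" for f using Trig_Bd[OF that] by (simp add: Bd_def)
    show "(\<lambda>x. c * f x) \<in> Trig" if "f \<in> Trig" for f c
      by (rule Trig_mult[OF Trig_const that]) (auto intro: Bd_const)
  qed (rule Trig_add)
  interpret Q: bp_closed torus ?Q by (rule Qbp)
  have star: "bp_star_algebra ?Q"
  proof unfold_locales
    show "(\<lambda>x. f x * g x) \<in> ?Q" if "f \<in> ?Q" "g \<in> ?Q" for f g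
      by (rule bp_closure_mult[OF Qbp _ that]) (intro bp_closure.base Trig_mult)
    show "(\<lambda>_. 1) \<in> ?Q" by (intro bp_closure.base Trig_const Bd_const) auto
    have 1: "\<phi> \<in> ?Q" by (intro bp_closure.base Trig_const[where c = a] \<phi>Bd) (simp add: L)
    have 2: "(\<lambda>x. cnj (\<phi> x)) \<in> ?Q"
      by (intro bp_closure.base Trig_const[where c = "cnj a"] cnjBd \<phi>Bd) (simp add: L)
    have 3: "\<psi> \<in> ?Q" by (intro bp_closure.base TrigI[where n = 0 and s = "[:0, 1:]"] \<psi>Bd) simp
    have 4: "(\<lambda>x. cnj (\<psi> x)) \<in> ?Q"
      by (intro bp_closure.base TrigI[where n = 1 and s = 1] cnjBd \<psi>Bd) simp
    show "fst \<in> ?Q" "snd \<in> ?Q" "(\<lambda>x. cnj (fst x)) \<in> ?Q" "(\<lambda>x. cnj (snd x)) \<in> ?Q"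
      using coord 1 2 3 4 by auto
  qed
  have "h \<in> Q0" if "h \<in> ?Q" for h
    using that
  proof induction
    case (lim u B g)
    then show ?case by (rule_tac Q0.lim[of u B]) auto
  qed (rule Trig_Q0)
  then have "f \<in> Q0" using bp_star_algebra.borel_measurable[OF star f] by blast
  then show ?thesis by (simp add: Q0_def I_def)
qed

section \<open>The carrier of the Clark measure of a rational inner function\<close>

text \<open>The argument is rounded down to a multiple of \<open>2 * pi / N\<close>; a chord is at
  most as long as its arc.\<close>

lemma root_of_unity_near:
  assumes "cmod \<zeta> = 1" "0 < (N::nat)"
  obtains k where "k < N" "cmod (\<zeta> - cis (2 * pi * k / N)) \<le> 2 * pi / N"
proof -
  define t where "t = Arg2pi \<zeta>"
  have t: "0 \<le> t" "t < 2 * pi" by (auto simp: t_def Arg2pi_ge_0 Arg2pi_lt_2pi)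
  have z: "\<zeta> = cis t" using Arg2pi_eq[of \<zeta>] assms(1) by (simp add: t_def cis_conv_exp)
  define k where "k = nat \<lfloor>N * t / (2 * pi)\<rfloor>"
  have x0: "0 \<le> N * t / (2 * pi)" using t by simp
  have "N * t / (2 * pi) < N" using t assms(2) by (simp add: field_simps)
  then have k1: "k < N" using x0 unfolding k_def by (simp add: nat_less_iff floor_less_iff)
  have kf: "real k = of_int \<lfloor>N * t / (2 * pi)\<rfloor>" using x0 by (simp add: k_def)
  have "real k \<le> N * t / (2 * pi)" "N * t / (2 * pi) < real k + 1" unfolding kf by linarith+
  then have "2 * pi * k / N \<le> t" "t \<le> 2 * pi * k / N + 2 * pi / N"
    using assms(2) by (auto simp: field_simps)
  then have d: "\<bar>t - 2 * pi * k / N\<bar> \<le> 2 * pi / N" by linarith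
  have lip: "cmod (cis x - cis y) \<le> \<bar>x - y\<bar>" for x y
  proof -
    have "cis x - cis y = cis y * (cis (x - y) - 1)" by (simp add: cis_mult algebra_simps)
    then have "cmod (cis x - cis y) = cmod (exp (\<i> * of_real (x - y)) - 1)"
      by (simp add: norm_mult cis_conv_exp)
    also have "\<dots> = 2 * \<bar>sin ((x - y) / 2)\<bar>" by (rule dist_exp_i_1)
    also have "\<dots> \<le> \<bar>x - y\<bar>" using abs_sin_x_le_abs_x[of "(x - y) / 2"] by simp
    finally show ?thesis .
  qed
  show ?thesis using that[OF k1] order_trans[OF lip d] z by simp
qed

text \<open>Sample the Poisson integral of \<open>\<sigma>\<close> at the points \<open>(1 - 1/N) \<eta>\<close>, with \<open>\<eta>\<close> running over pairs of
  \<open>N\<close>-th roots of unity. Multiplied by \<open>\<bar>R - \<alpha> P\<bar>\<^sup>2\<close> it equals \<open>\<bar>P\<bar>\<^sup>2 - \<bar>R\<bar>\<^sup>2\<close>, which tends to \<open>0\<close>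
  at the torus, while every point of the torus is within \<open>O(1/N)\<close> of some \<open>\<eta>\<close>, where the Poisson
  kernel is at least of order \<open>N\<^sup>2\<close>.\<close>

lemma (in clark_measure) AE_boundary_equation:
  assumes cont: "continuous_on (cball 0 1 \<times> cball 0 1) P" "continuous_on (cball 0 1 \<times> cball 0 1) R"
    and torus_eq: "\<And>\<zeta>. \<zeta> \<in> torus \<Longrightarrow> cmod (R \<zeta>) = cmod (P \<zeta>)"
    and nz: "\<And>z. z \<in> bidisc \<Longrightarrow> P z \<noteq> 0" and b_eq: "\<And>z. z \<in> bidisc \<Longrightarrow> b z = R z / P z"
  shows "AE \<zeta> in \<sigma>. R \<zeta> - \<alpha> * P \<zeta> = 0"
proof -
  let ?D = "cball (0::complex) 1 \<times> cball (0::complex) 1"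
  have D: "compact ?D" by (intro compact_Times) auto
  define u where "u z = (cmod (R z - \<alpha> * P z))\<^sup>2" for z
  define h where "h z = (cmod (P z))\<^sup>2 - (cmod (R z))\<^sup>2" for z
  have uc: "continuous_on ?D u" and hc: "continuous_on ?D h"
    unfolding u_def h_def by (intro continuous_intros cont)+
  have poisson_cont: "continuous_on torus (poisson2 z)" if "z \<in> bidisc" for z
    unfolding poisson2_def
    by (intro continuous_intros) (use that in \<open>auto simp: dist_norm\<close>)
  have restr: "f \<in> borel_measurable \<sigma>" if "continuous_on torus f" for f :: "_ \<Rightarrow> real"
    unfolding measurable_eq by (rule borel_measurable_continuous_on_restrict[OF that])
  have int_cont: "integrable \<sigma> f" if f: "continuous_on torus f" for f :: "_ \<Rightarrow> real"
  proof -
    obtain B where "\<And>\<zeta>. \<zeta> \<in> torus \<Longrightarrow> norm (f \<zeta>) \<le> B" using continuous_torus_bounded[OF f] by metis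
    then show ?thesis by (intro integrable_const_bound[where B = B] restr f) (auto simp: space_eq)
  qed
  have ut: "continuous_on torus u" by (rule continuous_on_subset[OF uc torus_subset_cball])
  have poisson_int: "(\<integral>\<zeta>. u z * poisson2 z \<zeta> \<partial>\<sigma>) = h z" if z: "z \<in> bidisc" for z
  proof -
    have "(\<integral>\<zeta>. poisson2 z \<zeta> \<partial>\<sigma>) = (1 - (cmod (b z))\<^sup>2) / (cmod (\<alpha> - b z))\<^sup>2"
      using clark z unfolding is_clark_measure_def by blast
    then have int: "(\<integral>\<zeta>. u z * poisson2 z \<zeta> \<partial>\<sigma>) = u z * ((1 - (cmod (b z))\<^sup>2) / (cmod (\<alpha> - b z))\<^sup>2)"
      by (simp only: integral_mult_right_zero)
    have R: "R z = P z * b z" using nz[OF z] b_eq[OF z] by simp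
    have uz: "u z = (cmod (P z))\<^sup>2 * (cmod (\<alpha> - b z))\<^sup>2"
    proof -
      have "R z - \<alpha> * P z = P z * - (\<alpha> - b z)" by (simp add: R algebra_simps)
      then show ?thesis unfolding u_def by (simp only: norm_mult power_mult_distrib norm_minus_cancel)
    qed
    have "u z * ((1 - (cmod (b z))\<^sup>2) / (cmod (\<alpha> - b z))\<^sup>2) = (cmod (P z))\<^sup>2 * (1 - (cmod (b z))\<^sup>2)"
      using alpha_neq[OF z] unfolding uz by simp
    also have "\<dots> = h z" using R by (simp add: h_def norm_mult power_mult_distrib algebra_simps)
    finally show ?thesis using int by simp
  qed
  \<comment> \<open>The constant: at a nearby sample the Poisson kernel is at least
    \<open>(N / 81)\<^sup>2\<close>, while \<open>N\<^sup>2\<close> samples contribute at most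
    \<open>\<epsilon>\<close> each.\<close>
  have small: "(\<integral>\<zeta>. u \<zeta> \<partial>\<sigma>) \<le> \<epsilon> * (81\<^sup>2 + measure \<sigma> (space \<sigma>))" if e: "0 < \<epsilon>" for \<epsilon>
  proof -
    obtain d where d: "0 < d" "\<And>x y. x \<in> ?D \<Longrightarrow> y \<in> ?D \<Longrightarrow> dist y x < d \<Longrightarrow> dist (u y) (u x) < \<epsilon>"
      using compact_uniformly_continuous[OF uc D] e unfolding uniformly_continuous_on_def by metis
    obtain d' where d': "0 < d'" "\<And>x y. x \<in> ?D \<Longrightarrow> y \<in> ?D \<Longrightarrow> dist y x < d' \<Longrightarrow> dist (h y) (h x) < \<epsilon>"
      using compact_uniformly_continuous[OF hc D] e unfolding uniformly_continuous_on_def by metis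
    \<comment> \<open>The chosen sample point is within \<open>9 / N\<close> of
      \<open>\<zeta>\<close> in each coordinate, hence within \<open>18 / N\<close>; both
      \<open>d\<close> and \<open>d'\<close> have to exceed this.\<close>
    obtain N0 :: nat where N0: "18 / d + 18 / d' < real N0" using reals_Archimedean2 by blast
    define N where "N = N0 + 2"
    have N: "2 \<le> N" "0 < real N" by (auto simp: N_def)
    have "0 < 18 / d" "0 < 18 / d'" using d(1) d'(1) by simp_all
    then have "18 / d < N" "18 / d' < N" using N0 unfolding N_def of_nat_add by linarith+
    then have Nd: "18 / N < d" "18 / N < d'"
      using d(1) d'(1) N by (simp_all add: divide_less_eq mult.commute)
    define r where "r = 1 - 1 / real N"
    have r: "0 < r" "r < 1" "1 - r = 1 / N" using N by (auto simp: r_def field_simps)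
    define \<eta> where "\<eta> k = cis (2 * pi * real k / real N)" for k
    define w where "w k = (of_real r * \<eta> (fst k), of_real r * \<eta> (snd k))" for k
    have w: "w k \<in> bidisc" for k using r by (simp add: w_def \<eta>_def norm_mult)
    have pair_dist: "dist x y \<le> cmod (fst x - fst y) + cmod (snd x - snd y)" for x y :: "complex \<times> complex"
      unfolding dist_prod_def dist_norm by (rule sqrt_sum_squares_le_sum) auto
    have shrink: "cmod (of_real r * \<eta> k - \<eta> k) = 1 / N" for k
    proof -
      have "of_real r * \<eta> k - \<eta> k = - of_real (1 - r) * \<eta> k" by (simp add: algebra_simps)
      then show ?thesis using r by (simp add: norm_mult norm_divide \<eta>_def del: of_real_diff)
    qed
    have h_small: "h (w k) \<le> \<epsilon>" for k
    proof -
      have "dist (w k) (\<eta> (fst k), \<eta> (snd k)) \<le> 1 / N + 1 / N"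
        using pair_dist[of "w k" "(\<eta> (fst k), \<eta> (snd k))"] shrink by (simp add: w_def)
      also have "\<dots> < d'" using Nd N by (simp add: field_simps)
      finally have "dist (h (w k)) (h (\<eta> (fst k), \<eta> (snd k))) < \<epsilon>"
        using w[of k] by (intro d') (auto simp: \<eta>_def)
      moreover have "h (\<eta> (fst k), \<eta> (snd k)) = 0"
        using torus_eq[of "(\<eta> (fst k), \<eta> (snd k))"] by (simp add: h_def \<eta>_def)
      ultimately show ?thesis by (simp add: dist_real_def)
    qed
    let ?I = "{..<N} \<times> {..<N}"
    have sum_int: "(\<integral>\<zeta>. (\<Sum>k\<in>?I. u (w k) * poisson2 (w k) \<zeta>) \<partial>\<sigma>) \<le> real N ^ 2 * \<epsilon>"
    proof -
      have "(\<integral>\<zeta>. (\<Sum>k\<in>?I. u (w k) * poisson2 (w k) \<zeta>) \<partial>\<sigma>) = (\<Sum>k\<in>?I. h (w k))"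
        using poisson_int[OF w]
        by (subst Bochner_Integration.integral_sum) (auto intro!: int_cont continuous_intros poisson_cont w)
      also have "\<dots> \<le> (\<Sum>k\<in>?I. \<epsilon>)" by (intro sum_mono h_small)
      finally show ?thesis by (simp add: power2_eq_square)
    qed
    have near: "(real N / 81)\<^sup>2 * (u \<zeta> - \<epsilon>) \<le> (\<Sum>k\<in>?I. u (w k) * poisson2 (w k) \<zeta>)" if z: "\<zeta> \<in> torus" for \<zeta>
    proof -
      have c: "cmod (fst \<zeta>) = 1" "cmod (snd \<zeta>) = 1" using z by auto
      obtain k1 where k1: "k1 < N" "cmod (fst \<zeta> - \<eta> k1) \<le> 2 * pi / N"
        using root_of_unity_near[OF c(1), of N] N unfolding \<eta>_def by (metis gr0I not_numeral_le_zero)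
      obtain k2 where k2: "k2 < N" "cmod (snd \<zeta> - \<eta> k2) \<le> 2 * pi / N"
        using root_of_unity_near[OF c(2), of N] N unfolding \<eta>_def by (metis gr0I not_numeral_le_zero)
      \<comment> \<open>\<open>2 * pi / N\<close> along the circle plus \<open>1 / N\<close> for the
        radial shift; \<open>pi < 4\<close> gives the 9.\<close>
      have near1: "cmod (x - of_real r * \<eta> k) \<le> 9 / N" if "cmod (x - \<eta> k) \<le> 2 * pi / N" for x k
      proof -
        have "cmod (x - of_real r * \<eta> k) \<le> cmod (x - \<eta> k) + cmod (\<eta> k - of_real r * \<eta> k)"
          using norm_triangle_ineq[of "x - \<eta> k" "\<eta> k - of_real r * \<eta> k"] by simp
        also have "\<dots> \<le> 2 * pi / N + 1 / N" using that shrink[of k] by (simp add: norm_minus_commute)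
        also have "\<dots> = (2 * pi + 1) / N" by (simp add: add_divide_distrib)
        also have "\<dots> \<le> 9 / N" using pi_less_4 N by (intro divide_right_mono) auto
        finally show ?thesis .
      qed
      have factor: "real N / 81 \<le> (1 - (cmod (of_real r * \<eta> k))\<^sup>2) / (cmod (x - of_real r * \<eta> k))\<^sup>2"
        if x: "cmod x = 1" "cmod (x - \<eta> k) \<le> 2 * pi / N" for x k
      proof -
        have "cmod (of_real r * \<eta> k) = r" using r by (simp add: norm_mult \<eta>_def)
        moreover from this have pos: "0 < cmod (x - of_real r * \<eta> k)" using x(1) r by auto
        moreover have "(1 / N) / (9 / N)\<^sup>2 \<le> (1 - r\<^sup>2) / (cmod (x - of_real r * \<eta> k))\<^sup>2"
        proof (rule frac_le)
          have "r\<^sup>2 \<le> r" using r by (simp add: power2_eq_square mult_left_le)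
          then show "1 / N \<le> 1 - r\<^sup>2" "0 \<le> 1 - r\<^sup>2" using r by linarith+
          show "(cmod (x - of_real r * \<eta> k))\<^sup>2 \<le> (9 / N)\<^sup>2" using near1[OF x(2)] by (intro power_mono) auto
        qed (use pos in auto)
        moreover have "(1 / N) / (9 / N)\<^sup>2 = real N / 81" using N by (simp add: field_simps power2_eq_square)
        ultimately show ?thesis by (simp only:)
      qed
      let ?k = "(k1, k2)"
      have k: "?k \<in> ?I" using k1 k2 by simp
      have "(real N / 81) * (real N / 81) \<le> poisson2 (w ?k) \<zeta>"
        unfolding poisson2_def w_def fst_conv snd_conv
        by (intro mult_mono factor c k1 k2 order_trans[OF _ factor[OF c(1) k1(2)]]) auto
      then have P: "(real N / 81)\<^sup>2 \<le> poisson2 (w ?k) \<zeta>" by (simp add: power2_eq_square)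
      have "dist (w ?k) \<zeta> \<le> 9 / N + 9 / N"
        using pair_dist[of "w ?k" \<zeta>] near1[OF k1(2)] near1[OF k2(2)] by (simp add: w_def norm_minus_commute)
      also have "\<dots> < d" using Nd N by (simp add: field_simps)
      finally have "dist (u (w ?k)) (u \<zeta>) < \<epsilon>" using w[of ?k] z by (intro d) auto
      then have ul: "u \<zeta> - \<epsilon> \<le> u (w ?k)" by (simp add: dist_real_def)
      have "(real N / 81)\<^sup>2 * (u \<zeta> - \<epsilon>) \<le> (real N / 81)\<^sup>2 * u (w ?k)"
        using ul by (intro mult_left_mono) auto
      also have "\<dots> \<le> poisson2 (w ?k) \<zeta> * u (w ?k)" using P by (intro mult_right_mono) (auto simp: u_def)
      also have "\<dots> = u (w ?k) * poisson2 (w ?k) \<zeta>" by (rule mult.commute)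
      also have "\<dots> \<le> (\<Sum>k\<in>?I. u (w k) * poisson2 (w k) \<zeta>)"
      proof (rule member_le_sum[OF k])
        show "0 \<le> u (w x) * poisson2 (w x) \<zeta>" for x
          using w[of x] unfolding poisson2_def u_def
          by (intro mult_nonneg_nonneg divide_nonneg_nonneg) (auto simp: abs_square_le_1 power_le_one)
      qed simp
      finally show ?thesis .
    qed
    \<comment> \<open>Both sides of the integrated estimate carry the factor
      \<open>N\<^sup>2\<close>, which cancels and leaves a bound free of \<open>N\<close>.\<close>
    have "(real N / 81)\<^sup>2 * ((\<integral>\<zeta>. u \<zeta> \<partial>\<sigma>) - \<epsilon> * measure \<sigma> (space \<sigma>)) = (\<integral>\<zeta>. (real N / 81)\<^sup>2 * (u \<zeta> - \<epsilon>) \<partial>\<sigma>)"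
      using int_cont[OF ut] by (simp add: mult.commute)
    also have "\<dots> \<le> (\<integral>\<zeta>. (\<Sum>k\<in>?I. u (w k) * poisson2 (w k) \<zeta>) \<partial>\<sigma>)"
      by (rule integral_mono) (use near in \<open>auto simp: space_eq intro!: int_cont continuous_intros poisson_cont w ut\<close>)
    also have "\<dots> \<le> real N ^ 2 * \<epsilon>" by (rule sum_int)
    also have "\<dots> = (real N / 81)\<^sup>2 * (81\<^sup>2 * \<epsilon>)" by (simp add: power_divide)
    finally have "(\<integral>\<zeta>. u \<zeta> \<partial>\<sigma>) - \<epsilon> * measure \<sigma> (space \<sigma>) \<le> 81\<^sup>2 * \<epsilon>"
      using N by (simp del: power_divide add: mult_le_cancel_left)
    then show ?thesis by (simp add: algebra_simps)
  qed
  have "(\<integral>\<zeta>. u \<zeta> \<partial>\<sigma>) \<le> 0"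
  proof (rule ccontr)
    assume "\<not> ?thesis"
    then have pos: "0 < (\<integral>\<zeta>. u \<zeta> \<partial>\<sigma>)" by simp
    let ?C = "81\<^sup>2 + measure \<sigma> (space \<sigma>)"
    have C: "0 < ?C" by (simp add: add_pos_nonneg)
    have "(\<integral>\<zeta>. u \<zeta> \<partial>\<sigma>) \<le> (\<integral>\<zeta>. u \<zeta> \<partial>\<sigma>) / (2 * ?C) * ?C" using pos C by (intro small) auto
    also have "\<dots> = (\<integral>\<zeta>. u \<zeta> \<partial>\<sigma>) / 2" using C by (simp add: field_simps)
    finally show False using pos by simp
  qed
  moreover have "0 \<le> (\<integral>\<zeta>. u \<zeta> \<partial>\<sigma>)" by (simp add: u_def)
  ultimately have "integral\<^sup>L \<sigma> u = 0" by simp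
  moreover have "AE \<zeta> in \<sigma>. 0 \<le> u \<zeta>" by (simp add: u_def)
  ultimately have "AE \<zeta> in \<sigma>. u \<zeta> = 0"
    using integral_nonneg_eq_0_iff_AE[OF int_cont[OF ut]] by blast
  then show ?thesis by eventually_elim (simp add: u_def)
qed

section \<open>Integrals of Cauchy sums over the torus\<close>

lemma borel_measurable_torus_continuous:
  fixes f :: "complex \<times> complex \<Rightarrow> 'b::{second_countable_topology, real_normed_vector}"
  shows "continuous_on torus f \<Longrightarrow> f \<in> borel_measurable torus_borel"
  by (rule borel_measurable_continuous_on_restrict)

lemma cauchy_sum_torus:
  assumes "snd ` set xs \<subseteq> bidisc"
  shows "cauchy_sum xs \<in> borel_measurable torus_borel" "\<exists>B. \<forall>\<zeta>\<in>torus. cmod (cauchy_sum xs \<zeta>) \<le> B"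
proof -
  have c: "continuous_on torus (cauchy_sum xs)"
    by (rule continuous_on_subset[OF cauchy_sum_continuous[OF assms] torus_subset_cball])
  then show "cauchy_sum xs \<in> borel_measurable torus_borel" by (rule borel_measurable_torus_continuous)
  show "\<exists>B. \<forall>\<zeta>\<in>torus. cmod (cauchy_sum xs \<zeta>) \<le> B" using continuous_torus_bounded[OF c] by metis
qed

lemma cauchy_kernel_torus:
  assumes "w \<in> bidisc"
  shows "(\<lambda>\<zeta>. cauchy_kernel \<zeta> w) \<in> borel_measurable torus_borel"
    "\<exists>B. \<forall>\<zeta>\<in>torus. cmod (cauchy_kernel \<zeta> w) \<le> B"
proof -
  have "cauchy_sum [(1, w)] = (\<lambda>\<zeta>. cauchy_kernel \<zeta> w)" by (simp add: cauchy_sum_def fun_eq_iff)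
  moreover have "snd ` set [(1, w)] \<subseteq> bidisc" using assms by simp
  ultimately show "(\<lambda>\<zeta>. cauchy_kernel \<zeta> w) \<in> borel_measurable torus_borel"
    "\<exists>B. \<forall>\<zeta>\<in>torus. cmod (cauchy_kernel \<zeta> w) \<le> B"
    using cauchy_sum_torus[of "[(1, w)]"] by metis+
qed

lemma bp_cauchy_torus:
  assumes f: "f \<in> bp_cauchy"
  shows "f \<in> borel_measurable torus_borel" "\<exists>B. \<forall>\<zeta>\<in>torus. cmod (f \<zeta>) \<le> B"
proof -
  show "f \<in> borel_measurable torus_borel"
  proof (rule bp_closure_measurable)
    show "f \<in> bp_closure (space torus_borel) cauchy_span" using f by (simp only: space_torus_borel)
  qed (auto simp: cauchy_span_def cauchy_sum_torus)
  show "\<exists>B. \<forall>\<zeta>\<in>torus. cmod (f \<zeta>) \<le> B" by (rule bp_cauchy.bounded[OF f])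
qed

lemma borel_measurable_cnj: "f \<in> borel_measurable M \<Longrightarrow> (\<lambda>x. cnj (f x)) \<in> borel_measurable M"
  by (rule measurable_compose[OF _ cnj_measurable])

context torus_measure
begin

lemma integrable_mult_bounded:
  fixes f g :: "complex \<times> complex \<Rightarrow> complex"
  assumes "f \<in> borel_measurable torus_borel" "\<exists>B. \<forall>\<zeta>\<in>torus. cmod (f \<zeta>) \<le> B"
    and "g \<in> borel_measurable torus_borel" "\<exists>B. \<forall>\<zeta>\<in>torus. cmod (g \<zeta>) \<le> B"
  shows "integrable \<sigma> (\<lambda>\<zeta>. f \<zeta> * g \<zeta>)"
proof -
  obtain B B' where B: "\<forall>\<zeta>\<in>torus. cmod (f \<zeta>) \<le> B" "\<forall>\<zeta>\<in>torus. cmod (g \<zeta>) \<le> B'"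
    using assms by blast
  show ?thesis
  proof (rule integrable_bounded[where B = "B * B'"])
    show "cmod (f \<zeta> * g \<zeta>) \<le> B * B'" if "\<zeta> \<in> torus" for \<zeta>
      unfolding norm_mult using B that by (intro mult_mono) (auto intro: order_trans[OF norm_ge_zero])
  qed (intro borel_measurable_times assms)
qed

lemma integral_cauchy_sum:
  assumes xs: "snd ` set xs \<subseteq> bidisc"
    and g: "g \<in> borel_measurable torus_borel" "\<exists>B. \<forall>\<zeta>\<in>torus. cmod (g \<zeta>) \<le> B"
  shows "(\<integral>\<zeta>. cauchy_sum xs \<zeta> * g \<zeta> \<partial>\<sigma>) = (\<Sum>(c, w)\<leftarrow>xs. c * (\<integral>\<zeta>. cauchy_kernel \<zeta> w * g \<zeta> \<partial>\<sigma>))"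
  using xs
proof (induction xs)
  case Nil
  then show ?case by (simp add: cauchy_sum_Nil)
next
  case (Cons x xs)
  obtain c w where x: "x = (c, w)" by (cases x)
  have i: "integrable \<sigma> (\<lambda>\<zeta>. cauchy_kernel \<zeta> w * g \<zeta>)" "integrable \<sigma> (\<lambda>\<zeta>. cauchy_sum xs \<zeta> * g \<zeta>)"
    using Cons.prems x by (intro integrable_mult_bounded g cauchy_kernel_torus cauchy_sum_torus; force)+
  have "(\<integral>\<zeta>. cauchy_sum (x # xs) \<zeta> * g \<zeta> \<partial>\<sigma>) =
      (\<integral>\<zeta>. c * (cauchy_kernel \<zeta> w * g \<zeta>) + cauchy_sum xs \<zeta> * g \<zeta> \<partial>\<sigma>)"
    by (simp add: x cauchy_sum_Cons algebra_simps)
  also have "\<dots> = c * (\<integral>\<zeta>. cauchy_kernel \<zeta> w * g \<zeta> \<partial>\<sigma>) + (\<integral>\<zeta>. cauchy_sum xs \<zeta> * g \<zeta> \<partial>\<sigma>)"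
    using i by simp
  finally show ?case using Cons x by simp
qed

text \<open>Cauchy-Schwarz against the constant 1, obtained by expanding the integral of
  \<open>(M * u - I)\<^sup>2\<close> with \<open>M\<close> the total mass and \<open>I\<close> the
  integral of \<open>u\<close>. The case \<open>M = 0\<close> is separate because \<open>M\<close>
  is divided out.\<close>

lemma integral_square_le:
  fixes u :: "complex \<times> complex \<Rightarrow> real"
  assumes u: "u \<in> borel_measurable torus_borel" "\<And>\<zeta>. \<zeta> \<in> torus \<Longrightarrow> 0 \<le> u \<zeta> \<and> u \<zeta> \<le> B"
  shows "(\<integral>\<zeta>. u \<zeta> \<partial>\<sigma>) \<le> sqrt (measure \<sigma> (space \<sigma>)) * sqrt (\<integral>\<zeta>. (u \<zeta>)\<^sup>2 \<partial>\<sigma>)"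
proof -
  let ?M = "measure \<sigma> (space \<sigma>)" and ?I = "\<integral>\<zeta>. u \<zeta> \<partial>\<sigma>" and ?S = "\<integral>\<zeta>. (u \<zeta>)\<^sup>2 \<partial>\<sigma>"
  have i1: "integrable \<sigma> u" by (rule integrable_bounded[where B = B]) (use u in auto)
  have i2: "integrable \<sigma> (\<lambda>\<zeta>. (u \<zeta>)\<^sup>2)"
    by (rule integrable_bounded[where B = "B\<^sup>2"]) (use u in \<open>auto intro!: power_mono\<close>)
  have "0 \<le> (\<integral>\<zeta>. (?M * u \<zeta> - ?I)\<^sup>2 \<partial>\<sigma>)" by simp
  also have "\<dots> = (\<integral>\<zeta>. ?M\<^sup>2 * (u \<zeta>)\<^sup>2 - 2 * ?M * ?I * u \<zeta> + ?I\<^sup>2 \<partial>\<sigma>)"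
    by (simp add: power2_diff power_mult_distrib algebra_simps)
  also have "\<dots> = ?M\<^sup>2 * ?S - 2 * ?M * ?I * ?I + ?M * ?I\<^sup>2"
    using i1 i2 by simp
  also have "\<dots> = ?M * (?M * ?S - ?I\<^sup>2)" by (simp add: algebra_simps power2_eq_square)
  finally have nn: "0 \<le> ?M * (?M * ?S - ?I\<^sup>2)" .
  have "?I\<^sup>2 \<le> ?M * ?S"
  proof (cases "?M = 0")
    case True
    then have "emeasure \<sigma> (space \<sigma>) = 0" by (simp add: emeasure_eq_measure)
    then have "AE \<zeta> in \<sigma>. u \<zeta> = 0" by (auto intro!: AE_I[of _ _ "space \<sigma>"])
    then have "?I = 0" by (rule integral_eq_zero_AE)
    then show ?thesis using True by simp
  next
    case False
    then have "0 < ?M" using measure_nonneg[of \<sigma> "space \<sigma>"] by linarith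
    then show ?thesis using nn by (simp add: zero_le_mult_iff)
  qed
  then have "?I \<le> sqrt (?M * ?S)" by (rule real_le_rsqrt)
  then show ?thesis by (simp add: real_sqrt_mult)
qed

end

section \<open>Membership in de Branges-Rovnyak spaces\<close>

text \<open>Up to the factors \<open>\<alpha> - b\<close>, mapping \<open>cauchy_kernel (\<cdot>) w\<close> to the reproducing kernel is isometric from
  \<open>L\<^sup>2(\<sigma>)\<close> into \<open>\<H>(b)\<close>.\<close>

definition clark_coeffs :: "(complex \<times> complex \<Rightarrow> complex) \<Rightarrow> complex \<Rightarrow>
    (complex \<times> (complex \<times> complex)) list \<Rightarrow> (complex \<times> (complex \<times> complex)) list" where
  "clark_coeffs b \<alpha> = map (\<lambda>(c, w). (c / cnj (\<alpha> - b w), w))"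

lemma snd_clark_coeffs: "snd ` set (clark_coeffs b \<alpha> xs) = snd ` set xs"
  by (force simp: clark_coeffs_def)

lemma sum_list_clark_coeffs:
  "(\<Sum>(d, w)\<leftarrow>clark_coeffs b \<alpha> xs. f d w) = (\<Sum>(c, w)\<leftarrow>xs. f (c / cnj (\<alpha> - b w)) w)"
  by (simp add: clark_coeffs_def o_def case_prod_unfold)

lemma sum_list_cong_set:
  "(\<And>c w. (c, w) \<in> set xs \<Longrightarrow> f c w = g c w) \<Longrightarrow> (\<Sum>(c, w)\<leftarrow>xs. f c w) = (\<Sum>(c, w)\<leftarrow>xs. g c w)"
  by (rule arg_cong[where f = sum_list]) (auto intro!: map_cong)

context clark_measure
begin

lemma cnj_alpha_neq: "z \<in> bidisc \<Longrightarrow> cnj (\<alpha> - b z) \<noteq> 0"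
  using alpha_neq[of z] by (metis complex_cnj_zero_iff)

text \<open>\<open>kernel_identity\<close> term by term: \<open>\<alpha> - b\<close> times the
  Cauchy transform of \<open>cauchy_sum xs\<close> against \<sigma> is a combination of reproducing
  kernels, with coefficients adjusted by \<open>clark_coeffs\<close>.\<close>

lemma integral_cauchy_sum_kernel:
  assumes xs: "snd ` set xs \<subseteq> bidisc" and z: "z \<in> bidisc"
  shows "(\<integral>\<zeta>. cauchy_sum xs \<zeta> * cnj (cauchy_kernel \<zeta> z) \<partial>\<sigma>) =
    (\<Sum>(c, w)\<leftarrow>clark_coeffs b \<alpha> xs. c * dBR_kernel b z w) / (\<alpha> - b z)"
proof -
  have "(\<integral>\<zeta>. cauchy_sum xs \<zeta> * cnj (cauchy_kernel \<zeta> z) \<partial>\<sigma>) =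
      (\<Sum>(c, w)\<leftarrow>xs. c * (\<integral>\<zeta>. cauchy_kernel \<zeta> w * cnj (cauchy_kernel \<zeta> z) \<partial>\<sigma>))"
    using cauchy_kernel_torus[OF z] by (intro integral_cauchy_sum xs borel_measurable_cnj) auto
  also have "\<dots> = (\<Sum>(c, w)\<leftarrow>xs. (1 / (\<alpha> - b z)) * (c / cnj (\<alpha> - b w) * dBR_kernel b z w))"
  proof (rule sum_list_cong_set)
    fix c w assume "(c, w) \<in> set xs"
    then have w: "w \<in> bidisc" using xs by force
    show "c * (\<integral>\<zeta>. cauchy_kernel \<zeta> w * cnj (cauchy_kernel \<zeta> z) \<partial>\<sigma>) =
        (1 / (\<alpha> - b z)) * (c / cnj (\<alpha> - b w) * dBR_kernel b z w)"
      unfolding kernel_identity[OF z w] by (simp only: times_divide_eq_left times_divide_eq_right mult_1_left divide_divide_eq_left mult_ac)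
  qed
  also have "\<dots> = (1 / (\<alpha> - b z)) * (\<Sum>(c, w)\<leftarrow>xs. c / cnj (\<alpha> - b w) * dBR_kernel b z w)"
    by (simp only: sum_list_const_mult case_prod_unfold)
  finally show ?thesis by (simp only: sum_list_clark_coeffs) simp
qed

lemma sq_norm_kernel_sum:
  assumes H: "is_dBR_space b H ip" and xs: "snd ` set xs \<subseteq> bidisc"
  shows "Re (ip (rkhs.kernel_sum bidisc (dBR_kernel b) (clark_coeffs b \<alpha> xs))
      (rkhs.kernel_sum bidisc (dBR_kernel b) (clark_coeffs b \<alpha> xs))) =
    (\<integral>\<zeta>. (cmod (cauchy_sum xs \<zeta>))\<^sup>2 \<partial>\<sigma>)"
proof -
  interpret rkhs bidisc "dBR_kernel b" H ip by (rule H)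
  let ?k = "kernel_sum (clark_coeffs b \<alpha> xs)"
  have cs: "snd ` set (clark_coeffs b \<alpha> xs) \<subseteq> bidisc" using xs by (simp only: snd_clark_coeffs)
  have k: "?k z = (\<alpha> - b z) * (\<integral>\<zeta>. cauchy_sum xs \<zeta> * cnj (cauchy_kernel \<zeta> z) \<partial>\<sigma>)" if z: "z \<in> bidisc" for z
    unfolding integral_cauchy_sum_kernel[OF xs z] kernel_sum_def
    using alpha_neq[OF z] z by (simp add: zero_extend_def)
  have "of_real (\<integral>\<zeta>. (cmod (cauchy_sum xs \<zeta>))\<^sup>2 \<partial>\<sigma>) = (\<integral>\<zeta>. cauchy_sum xs \<zeta> * cnj (cauchy_sum xs \<zeta>) \<partial>\<sigma>)"
    by (simp only: integral_complex_of_real[symmetric] complex_norm_square)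
  also have "\<dots> = (\<Sum>(c, w)\<leftarrow>xs. c * (\<integral>\<zeta>. cauchy_kernel \<zeta> w * cnj (cauchy_sum xs \<zeta>) \<partial>\<sigma>))"
    using cauchy_sum_torus[OF xs] by (intro integral_cauchy_sum xs borel_measurable_cnj) auto
  also have "\<dots> = (\<Sum>(c, w)\<leftarrow>xs. c / cnj (\<alpha> - b w) * cnj (?k w))"
  proof (rule sum_list_cong_set)
    fix c w assume "(c, w) \<in> set xs"
    then have w: "w \<in> bidisc" using xs by force
    have "(\<integral>\<zeta>. cauchy_kernel \<zeta> w * cnj (cauchy_sum xs \<zeta>) \<partial>\<sigma>) =
        (\<integral>\<zeta>. cnj (cauchy_sum xs \<zeta> * cnj (cauchy_kernel \<zeta> w)) \<partial>\<sigma>)"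
      by (simp add: mult.commute)
    also have "\<dots> = cnj (\<integral>\<zeta>. cauchy_sum xs \<zeta> * cnj (cauchy_kernel \<zeta> w) \<partial>\<sigma>)"
      by (rule Bochner_Integration.integral_cnj)
    finally show "c * (\<integral>\<zeta>. cauchy_kernel \<zeta> w * cnj (cauchy_sum xs \<zeta>) \<partial>\<sigma>) = c / cnj (\<alpha> - b w) * cnj (?k w)"
      unfolding k[OF w] using cnj_alpha_neq[OF w] by (simp only: complex_cnj_mult) simp
  qed
  also have "\<dots> = ip ?k ?k"
    unfolding ip_kernel_sum[OF cs kernel_sum_mem[OF cs]] sum_list_clark_coeffs ..
  finally show ?thesis by (metis Re_complex_of_real)
qed

end

lemma dBR_kernel_cnj: "dBR_kernel b z w = cnj (dBR_kernel b w z)"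
  by (simp add: dBR_kernel_def cauchy_kernel_def mult.commute)

text \<open>Membership in a reproducing kernel space amounts to boundedness of the pairing with
  kernel combinations. The isometry for \<open>b2\<close> turns their norms into norms in
  \<open>L\<^sup>2(\<sigma>2)\<close>, and the factor
  \<open>(\<alpha> - b2) / (\<alpha> - b1)\<close> exchanges the coefficients for those of
  \<open>b1\<close>, so that the pairing becomes an integral against \<sigma>1.\<close>

lemma dBR_mem_iff:
  assumes "clark_measure b1 \<alpha> \<sigma>1" "clark_measure b2 \<alpha> \<sigma>2" "is_dBR_space b2 H ip" and w: "w \<in> bidisc"
  shows "zero_extend bidisc (\<lambda>z. (\<alpha> - b2 z) / (\<alpha> - b1 z) * dBR_kernel b1 z w) \<in> H \<longleftrightarrow>
    (\<exists>K\<ge>0. \<forall>xs. snd ` set xs \<subseteq> bidisc \<longrightarrow>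
      cmod (\<integral>\<zeta>. cauchy_sum xs \<zeta> * cnj (cauchy_kernel \<zeta> w) \<partial>\<sigma>1) \<le> K * sqrt (\<integral>\<zeta>. (cmod (cauchy_sum xs \<zeta>))\<^sup>2 \<partial>\<sigma>2))"
    (is "zero_extend bidisc ?h \<in> H \<longleftrightarrow> ?R")
proof -
  interpret s1: clark_measure b1 \<alpha> \<sigma>1 by fact
  interpret s2: clark_measure b2 \<alpha> \<sigma>2 by fact
  interpret rkhs bidisc "dBR_kernel b2" H ip by fact
  let ?c = "clark_coeffs b2 \<alpha>"
  define \<kappa> where "\<kappa> = \<alpha> - b1 w"
  have \<kappa>: "\<kappa> \<noteq> 0" using s1.alpha_neq[OF w] by (simp add: \<kappa>_def)
  have pairing: "(\<Sum>(d, z)\<leftarrow>?c xs. d * cnj (?h z)) = \<kappa> * (\<integral>\<zeta>. cauchy_sum xs \<zeta> * cnj (cauchy_kernel \<zeta> w) \<partial>\<sigma>1)"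
    if xs: "snd ` set xs \<subseteq> bidisc" for xs
  proof -
    have "(\<Sum>(d, z)\<leftarrow>?c xs. d * cnj (?h z)) = (\<Sum>(c, z)\<leftarrow>xs. c / cnj (\<alpha> - b1 z) * dBR_kernel b1 w z)"
      unfolding sum_list_clark_coeffs
    proof (rule sum_list_cong_set)
      fix c z assume "(c, z) \<in> set xs"
      then have z: "z \<in> bidisc" using xs by force
      show "c / cnj (\<alpha> - b2 z) * cnj (?h z) = c / cnj (\<alpha> - b1 z) * dBR_kernel b1 w z"
        unfolding dBR_kernel_cnj[of b1 w z] complex_cnj_mult complex_cnj_divide
        using s2.cnj_alpha_neq[OF z] by simp
    qed
    then show ?thesis
      unfolding s1.integral_cauchy_sum_kernel[OF xs w] sum_list_clark_coeffs
      using \<kappa> by (simp add: \<kappa>_def)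
  qed
  show ?thesis
  proof
    assume mem: "zero_extend bidisc ?h \<in> H"
    let ?K = "sqrt (sq_norm (zero_extend bidisc ?h)) / cmod \<kappa>"
    show ?R
    proof (intro exI[of _ ?K] conjI allI impI)
      show "0 \<le> ?K" using ip_nonneg[OF mem] by simp
      fix xs :: "(complex \<times> (complex \<times> complex)) list" assume xs: "snd ` set xs \<subseteq> bidisc"
      have "snd ` set (?c xs) \<subseteq> bidisc" using xs by (simp only: snd_clark_coeffs)
      from bounded_functional_of_mem[OF mem this]
      show "cmod (\<integral>\<zeta>. cauchy_sum xs \<zeta> * cnj (cauchy_kernel \<zeta> w) \<partial>\<sigma>1)
          \<le> ?K * sqrt (\<integral>\<zeta>. (cmod (cauchy_sum xs \<zeta>))\<^sup>2 \<partial>\<sigma>2)"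
        unfolding pairing[OF xs] s2.sq_norm_kernel_sum[OF assms(3) xs] norm_mult
        using \<kappa> by (simp add: field_simps)
    qed
  next
    assume ?R
    then obtain K where K: "0 \<le> K" "\<And>xs. snd ` set xs \<subseteq> bidisc \<Longrightarrow>
      cmod (\<integral>\<zeta>. cauchy_sum xs \<zeta> * cnj (cauchy_kernel \<zeta> w) \<partial>\<sigma>1) \<le> K * sqrt (\<integral>\<zeta>. (cmod (cauchy_sum xs \<zeta>))\<^sup>2 \<partial>\<sigma>2)"
      by blast
    show "zero_extend bidisc ?h \<in> H"
    proof (rule mem_of_bounded_functional)
      show "0 \<le> cmod \<kappa> * K" using K by simp
      fix ys :: "(complex \<times> (complex \<times> complex)) list" assume ys: "snd ` set ys \<subseteq> bidisc"
      \<comment> \<open>Inverts \<open>clark_coeffs\<close>, so that every kernel combination comes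
        from a Cauchy sum.\<close>
      define xs where "xs = map (\<lambda>(d, z). (d * cnj (\<alpha> - b2 z), z)) ys"
      have xs: "snd ` set xs \<subseteq> bidisc" using ys by (force simp: xs_def)
      have "?c xs = map (\<lambda>x. x) ys"
        unfolding xs_def clark_coeffs_def map_map
      proof (rule map_cong[OF refl])
        fix x assume "x \<in> set ys"
        then have "cnj (\<alpha> - b2 (snd x)) \<noteq> 0" using ys by (intro s2.cnj_alpha_neq) auto
        then show "((\<lambda>(c, w). (c / cnj (\<alpha> - b2 w), w)) \<circ> (\<lambda>(d, z). (d * cnj (\<alpha> - b2 z), z))) x = x"
          by (simp add: case_prod_unfold)
      qed
      then have ys_eq: "?c xs = ys" by simp
      show "cmod (\<Sum>(d, z)\<leftarrow>ys. d * cnj (?h z)) \<le> cmod \<kappa> * K * sqrt (sq_norm (kernel_sum ys))"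
        using mult_left_mono[OF K(2)[OF xs], of "cmod \<kappa>"] pairing[OF xs] s2.sq_norm_kernel_sum[OF assms(3) xs]
        unfolding ys_eq by (simp only: norm_mult mult.assoc norm_ge_zero)
    qed
  qed
qed

lemma bp_cauchy_bound:
  assumes "torus_measure \<sigma>1" "torus_measure \<sigma>2" and w: "w \<in> bidisc"
    and bd: "\<And>xs. snd ` set xs \<subseteq> bidisc \<Longrightarrow>
      cmod (\<integral>\<zeta>. cauchy_sum xs \<zeta> * cnj (cauchy_kernel \<zeta> w) \<partial>\<sigma>1) \<le> K * sqrt (\<integral>\<zeta>. (cmod (cauchy_sum xs \<zeta>))\<^sup>2 \<partial>\<sigma>2)"
    and f: "f \<in> bp_cauchy"
  shows "cmod (\<integral>\<zeta>. f \<zeta> * cnj (cauchy_kernel \<zeta> w) \<partial>\<sigma>1) \<le> K * sqrt (\<integral>\<zeta>. (cmod (f \<zeta>))\<^sup>2 \<partial>\<sigma>2)"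
  using f
proof induction
  case (base f)
  then show ?case using bd by (auto simp: cauchy_span_def)
next
  case (lim u B g)
  interpret s1: torus_measure \<sigma>1 by fact
  interpret s2: torus_measure \<sigma>2 by fact
  obtain C where C: "\<forall>\<zeta>\<in>torus. cmod (cauchy_kernel \<zeta> w) \<le> C" using cauchy_kernel_torus[OF w] by blast
  have m: "u n \<in> borel_measurable torus_borel" for n by (rule bp_cauchy_torus[OF lim.hyps(1)])
  have l1: "(\<lambda>n. \<integral>\<zeta>. u n \<zeta> * cnj (cauchy_kernel \<zeta> w) \<partial>\<sigma>1) \<longlonglongrightarrow> (\<integral>\<zeta>. g \<zeta> * cnj (cauchy_kernel \<zeta> w) \<partial>\<sigma>1)"
  proof (rule tendsto_integral_bounded[OF s1.finite_measure_axioms, where B = "B * C"])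
    show "(\<lambda>\<zeta>. u n \<zeta> * cnj (cauchy_kernel \<zeta> w)) \<in> borel_measurable \<sigma>1" for n
      unfolding s1.measurable_eq by (intro borel_measurable_times m borel_measurable_cnj cauchy_kernel_torus w)
    show "cmod (u n \<zeta> * cnj (cauchy_kernel \<zeta> w)) \<le> B * C" if "\<zeta> \<in> space \<sigma>1" for n \<zeta>
      unfolding norm_mult complex_mod_cnj using lim.hyps(2)[of \<zeta> n] C that
      by (intro mult_mono) (auto simp: s1.space_eq intro: order_trans[OF norm_ge_zero])
    show "(\<lambda>n. u n \<zeta> * cnj (cauchy_kernel \<zeta> w)) \<longlonglongrightarrow> g \<zeta> * cnj (cauchy_kernel \<zeta> w)" if "\<zeta> \<in> space \<sigma>1" for \<zeta>
      using that by (intro tendsto_intros lim.hyps) (simp only: s1.space_eq)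
  qed
  \<comment> \<open>The squared moduli are integrated as complex functions, for which
    \<open>tendsto_integral_bounded\<close> is stated.\<close>
  have l2: "(\<lambda>n. \<integral>\<zeta>. complex_of_real ((cmod (u n \<zeta>))\<^sup>2) \<partial>\<sigma>2) \<longlonglongrightarrow> (\<integral>\<zeta>. complex_of_real ((cmod (g \<zeta>))\<^sup>2) \<partial>\<sigma>2)"
  proof (rule tendsto_integral_bounded[OF s2.finite_measure_axioms, where B = "B\<^sup>2"])
    show "(\<lambda>\<zeta>. complex_of_real ((cmod (u n \<zeta>))\<^sup>2)) \<in> borel_measurable \<sigma>2" for n
      using m[of n] unfolding s2.measurable_eq by measurable
    show "cmod (complex_of_real ((cmod (u n \<zeta>))\<^sup>2)) \<le> B\<^sup>2" if "\<zeta> \<in> space \<sigma>2" for n \<zeta>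
    proof -
      have "(cmod (u n \<zeta>))\<^sup>2 \<le> B\<^sup>2" using lim.hyps(2) that by (intro power_mono) (auto simp: s2.space_eq)
      then show ?thesis by (simp only: norm_of_real abs_power2)
    qed
    show "(\<lambda>n. complex_of_real ((cmod (u n \<zeta>))\<^sup>2)) \<longlonglongrightarrow> complex_of_real ((cmod (g \<zeta>))\<^sup>2)" if "\<zeta> \<in> space \<sigma>2" for \<zeta>
      using that by (intro tendsto_intros lim.hyps) (simp only: s2.space_eq)
  qed
  then have "(\<lambda>n. \<integral>\<zeta>. (cmod (u n \<zeta>))\<^sup>2 \<partial>\<sigma>2) \<longlonglongrightarrow> (\<integral>\<zeta>. (cmod (g \<zeta>))\<^sup>2 \<partial>\<sigma>2)"
    unfolding integral_complex_of_real tendsto_of_real_iff .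
  then have l3: "(\<lambda>n. K * sqrt (\<integral>\<zeta>. (cmod (u n \<zeta>))\<^sup>2 \<partial>\<sigma>2)) \<longlonglongrightarrow> K * sqrt (\<integral>\<zeta>. (cmod (g \<zeta>))\<^sup>2 \<partial>\<sigma>2)"
    by (intro tendsto_mult tendsto_const tendsto_real_sqrt)
  show ?case by (rule LIMSEQ_le[OF tendsto_norm[OF l1] l3]) (use lim.IH in blast)
qed

section \<open>Annihilating measures\<close>

lemma holomorphic2_on_add:
  "holomorphic2_on f U \<Longrightarrow> holomorphic2_on g U \<Longrightarrow> holomorphic2_on (\<lambda>z. f z + g z) U"
  unfolding holomorphic2_on_def
proof
  fix z assume f: "\<forall>z\<in>U. \<exists>a b. (f has_derivative (\<lambda>h. a * fst h + b * snd h)) (at z)"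
    and g: "\<forall>z\<in>U. \<exists>a b. (g has_derivative (\<lambda>h. a * fst h + b * snd h)) (at z)" and z: "z \<in> U"
  obtain a b where "(f has_derivative (\<lambda>h. a * fst h + b * snd h)) (at z)" using f z by blast
  moreover obtain a' b' where "(g has_derivative (\<lambda>h. a' * fst h + b' * snd h)) (at z)" using g z by blast
  ultimately have "((\<lambda>z. f z + g z) has_derivative (\<lambda>h. (a * fst h + b * snd h) + (a' * fst h + b' * snd h))) (at z)"
    by (rule has_derivative_add)
  also have "(\<lambda>h. (a * fst h + b * snd h) + (a' * fst h + b' * snd h)) = (\<lambda>h. (a + a') * fst h + (b + b') * snd h)"
    by (simp add: algebra_simps)
  finally show "\<exists>a b. ((\<lambda>z. f z + g z) has_derivative (\<lambda>h. a * fst h + b * snd h)) (at z)" by blast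
qed

lemma holomorphic2_on_mult:
  "holomorphic2_on f U \<Longrightarrow> holomorphic2_on g U \<Longrightarrow> holomorphic2_on (\<lambda>z. f z * g z) U"
  unfolding holomorphic2_on_def
proof
  fix z assume f: "\<forall>z\<in>U. \<exists>a b. (f has_derivative (\<lambda>h. a * fst h + b * snd h)) (at z)"
    and g: "\<forall>z\<in>U. \<exists>a b. (g has_derivative (\<lambda>h. a * fst h + b * snd h)) (at z)" and z: "z \<in> U"
  obtain a b where "(f has_derivative (\<lambda>h. a * fst h + b * snd h)) (at z)" using f z by blast
  moreover obtain a' b' where "(g has_derivative (\<lambda>h. a' * fst h + b' * snd h)) (at z)" using g z by blast
  ultimately have "((\<lambda>z. f z * g z) has_derivative
      (\<lambda>h. f z * (a' * fst h + b' * snd h) + (a * fst h + b * snd h) * g z)) (at z)"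
    by (rule has_derivative_mult)
  also have "(\<lambda>h. f z * (a' * fst h + b' * snd h) + (a * fst h + b * snd h) * g z) =
      (\<lambda>h. (f z * a' + a * g z) * fst h + (f z * b' + b * g z) * snd h)"
    by (simp add: algebra_simps)
  finally show "\<exists>a b. ((\<lambda>z. f z * g z) has_derivative (\<lambda>h. a * fst h + b * snd h)) (at z)" by blast
qed

lemma holomorphic2_on_coordinate:
  assumes "f holomorphic_on ball 0 1"
  shows "holomorphic2_on (\<lambda>z. f (fst z)) bidisc" "holomorphic2_on (\<lambda>z. f (snd z)) bidisc"
proof -
  have d: "\<exists>D. (f has_derivative (\<lambda>h. D * h)) (at z)" if "z \<in> ball 0 1" for z
    using assms that holomorphic_on_imp_differentiable_at[of f "ball 0 1" z]
    unfolding field_differentiable_def has_field_derivative_def by auto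
  show "holomorphic2_on (\<lambda>z. f (fst z)) bidisc"
    unfolding holomorphic2_on_def
  proof
    fix z :: "complex \<times> complex" assume "z \<in> bidisc"
    then obtain D where "(f has_derivative (\<lambda>h. D * h)) (at (fst z))" using d[of "fst z"] by auto
    then have "((\<lambda>z. f (fst z)) has_derivative (\<lambda>h. D * fst h + 0 * snd h)) (at z)"
      using has_derivative_compose[OF has_derivative_fst[OF has_derivative_ident]] by simp
    then show "\<exists>a b. ((\<lambda>z. f (fst z)) has_derivative (\<lambda>h. a * fst h + b * snd h)) (at z)" by blast
  qed
  show "holomorphic2_on (\<lambda>z. f (snd z)) bidisc"
    unfolding holomorphic2_on_def
  proof
    fix z :: "complex \<times> complex" assume "z \<in> bidisc"
    then obtain D where "(f has_derivative (\<lambda>h. D * h)) (at (snd z))" using d[of "snd z"] by auto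
    then have "((\<lambda>z. f (snd z)) has_derivative (\<lambda>h. 0 * fst h + D * snd h)) (at z)"
      using has_derivative_compose[OF has_derivative_snd[OF has_derivative_ident]] by simp
    then show "\<exists>a b. ((\<lambda>z. f (snd z)) has_derivative (\<lambda>h. a * fst h + b * snd h)) (at z)" by blast
  qed
qed

lemma holomorphic2_on_slices:
  assumes "holomorphic2_on f bidisc"
  shows "w \<in> ball 0 1 \<Longrightarrow> (\<lambda>z. f (z, w)) holomorphic_on ball 0 1"
    and "z \<in> ball 0 1 \<Longrightarrow> (\<lambda>w. f (z, w)) holomorphic_on ball 0 1"
proof -
  have d: "\<exists>a b. (f has_derivative (\<lambda>h. a * fst h + b * snd h)) (at (z, w))" if "z \<in> ball 0 1" "w \<in> ball 0 1" for z w
    using assms that unfolding holomorphic2_on_def by blast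
  show "(\<lambda>z. f (z, w)) holomorphic_on ball 0 1" if w: "w \<in> ball 0 1" for w
    unfolding holomorphic_on_def
  proof
    fix z :: complex assume z: "z \<in> ball 0 1"
    obtain a b where "(f has_derivative (\<lambda>h. a * fst h + b * snd h)) (at (z, w))" using d[OF z w] by blast
    moreover have "((\<lambda>z. (z, w)) has_derivative (\<lambda>h. (h, 0))) (at z)"
      by (intro has_derivative_Pair has_derivative_ident has_derivative_const)
    ultimately have "((\<lambda>z. f (z, w)) has_derivative (\<lambda>h. a * h)) (at z)"
      using has_derivative_compose by fastforce
    then show "(\<lambda>z. f (z, w)) field_differentiable at z within ball 0 1"
      using field_differentiable_at_within unfolding field_differentiable_def has_field_derivative_def by blast
  qed
  show "(\<lambda>w. f (z, w)) holomorphic_on ball 0 1" if z: "z \<in> ball 0 1" for z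
    unfolding holomorphic_on_def
  proof
    fix w :: complex assume w: "w \<in> ball 0 1"
    obtain a b where "(f has_derivative (\<lambda>h. a * fst h + b * snd h)) (at (z, w))" using d[OF z w] by blast
    moreover have "((\<lambda>w. (z, w)) has_derivative (\<lambda>h. (0, h))) (at w)"
      by (intro has_derivative_Pair has_derivative_ident has_derivative_const)
    ultimately have "((\<lambda>w. f (z, w)) has_derivative (\<lambda>h. b * h)) (at w)"
      using has_derivative_compose by fastforce
    then show "(\<lambda>w. f (z, w)) field_differentiable at w within ball 0 1"
      using field_differentiable_at_within unfolding field_differentiable_def has_field_derivative_def by blast
  qed
qed

lemma closure_bidisc: "closure bidisc = cball 0 1 \<times> cball 0 1"
  by (simp add: closure_Times)

lemma cauchy_span_subset: "cauchy_span \<subseteq> bidisc_algebra"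
proof
  fix f assume "f \<in> cauchy_span"
  then obtain xs where xs: "f = cauchy_sum xs" "snd ` set xs \<subseteq> bidisc" by (auto simp: cauchy_span_def)
  have const: "holomorphic2_on (\<lambda>z. c) bidisc" for c
    using holomorphic2_on_coordinate(1)[of "\<lambda>_. c"] by simp
  have kernel: "holomorphic2_on (\<lambda>\<zeta>. cauchy_kernel \<zeta> w) bidisc" if w: "w \<in> bidisc" for w
  proof -
    have "(\<lambda>z. 1 / (1 - z * cnj v)) holomorphic_on ball 0 1" if "cmod v < 1" for v
      by (intro holomorphic_intros one_minus_mult_nonzero) (use that in auto)
    then show ?thesis
      unfolding cauchy_kernel_def using w by (intro holomorphic2_on_mult holomorphic2_on_coordinate) auto
  qed
  have "holomorphic2_on (cauchy_sum xs) bidisc"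
    using xs(2)
  proof (induction xs)
    case Nil
    then show ?case using const[of 0] by (simp add: cauchy_sum_Nil)
  next
    case (Cons x xs)
    then show ?case
      by (cases x) (auto simp: cauchy_sum_Cons intro!: holomorphic2_on_add holomorphic2_on_mult const kernel)
  qed
  then show "f \<in> bidisc_algebra"
    using cauchy_sum_continuous[OF xs(2)] by (simp add: bidisc_algebra_def closure_bidisc xs(1))
qed

lemma annihilator_bp_cauchy:
  assumes \<mu>: "\<mu> \<in> annihilator" and f: "f \<in> bp_cauchy"
  shows "cm_integral torus_borel \<mu> f = 0"
  using f
proof induction
  case (base f)
  then show ?case using \<mu> cauchy_span_subset by (auto simp: annihilator_def)
next
  case (lim u B g)
  have "complex_measure torus_borel \<mu>" using \<mu> by (simp add: annihilator_def)
  then have "(\<lambda>n. cm_integral torus_borel \<mu> (u n)) \<longlonglongrightarrow> cm_integral torus_borel \<mu> g"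
  proof (rule cm_integral_tendsto)
    show "u n \<in> borel_measurable torus_borel" for n by (rule bp_cauchy_torus[OF lim.hyps(1)])
  qed (use lim.hyps(2,3) in \<open>simp_all only: space_torus_borel\<close>)
  then show ?case unfolding lim.IH by (rule LIMSEQ_unique) (rule tendsto_const)
qed

lemma curve_part_sets: "curve_part m n c \<in> sets torus_borel"
proof -
  have "bipoly m n c \<in> borel_measurable torus_borel"
    "(\<lambda>\<zeta>. bipoly m n c (0, snd \<zeta>)) \<in> borel_measurable torus_borel"
    "(\<lambda>\<zeta>. bipoly m n c (fst \<zeta>, 0)) \<in> borel_measurable torus_borel"
    by (intro borel_measurable_torus_continuous continuous_intros)+
  then have "{\<zeta> \<in> space torus_borel. bipoly m n c \<zeta> = 0 \<and>
     bipoly m n c (0, snd \<zeta>) \<noteq> 0 \<and> bipoly m n c (fst \<zeta>, 0) \<noteq> 0} \<in> sets torus_borel"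
    by measurable
  then show ?thesis by (simp only: curve_part_def space_torus_borel)
qed

text \<open>The indicator of any Borel subset of the curve part lies in the closure, so an
  annihilating measure vanishes on all these subsets, and with them its total variation.\<close>

lemma annihilator_null_curve_part:
  assumes nz: "\<And>z. z \<in> bidisc \<Longrightarrow> bipoly m n c z \<noteq> 0"
  shows "annihilator_null_set (curve_part m n c)"
  unfolding annihilator_null_set_def
proof (intro conjI ballI curve_part_sets)
  fix \<mu> assume \<mu>: "\<mu> \<in> annihilator"
  have zero: "\<mu> A = 0" if A: "A \<in> sets torus_borel" "A \<subseteq> curve_part m n c" for A
  proof -
    have "(\<lambda>\<zeta>. indicator (curve_part m n c) \<zeta> * indicator A \<zeta>) \<in> bp_cauchy"
      by (rule curve_part_in_bp_cauchy[OF nz, where B = 1])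
         (use A(1) in \<open>auto intro!: borel_measurable_indicator simp: indicator_def\<close>)
    also have "(\<lambda>\<zeta>. indicator (curve_part m n c) \<zeta> * indicator A \<zeta> :: complex) = indicator A"
      using A(2) by (auto simp: indicator_def fun_eq_iff)
    finally have "cm_integral torus_borel \<mu> (indicator A) = 0" by (rule annihilator_bp_cauchy[OF \<mu>])
    moreover have "complex_measure torus_borel \<mu>" using \<mu> by (simp add: annihilator_def)
    ultimately show ?thesis using cm_integral_indicator[OF _ A(1)] by simp
  qed
  have "total_variation torus_borel \<mu> (curve_part m n c) \<le> 0"
    unfolding total_variation_def
  proof (rule SUP_least)
    fix A :: "nat \<Rightarrow> (complex \<times> complex) set"
    assume A: "A \<in> {A. range A \<subseteq> sets torus_borel \<and> disjoint_family A \<and> (\<Union>i. A i) = curve_part m n c}"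
    have "\<mu> (A i) = 0" for i using A by (intro zero) auto
    then show "(\<Sum>i. ennreal (cmod (\<mu> (A i)))) \<le> 0" by simp
  qed
  then show "total_variation torus_borel \<mu> (curve_part m n c) = 0" by simp
qed

text \<open>The coordinates are distributed like Lebesgue measure, hence without atoms, under a measure that
  represents the origin: integrate powers of \<open>(1 + cnj a z) / 2\<close>, which peaks at \<open>a\<close>.\<close>

lemma representing_measure_fibre:
  assumes \<rho>: "representing_measure_0 \<rho>" and coord: "\<phi> = fst \<or> \<phi> = snd" and a: "cmod a = 1"
  shows "{\<zeta> \<in> torus. \<phi> \<zeta> = a} \<in> null_sets \<rho>"
proof -
  have sets: "sets \<rho> = sets torus_borel" using \<rho> by (simp add: representing_measure_0_def)
  interpret finite_measure \<rho> using \<rho> by (intro finite_measureI) (simp add: representing_measure_0_def)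
  interpret torus_measure \<rho> by unfold_locales (rule sets)
  define f where "f n z = ((1 + cnj a * \<phi> z) / 2) ^ n" for n and z :: "complex \<times> complex"
  have \<phi>_cont: "continuous_on S \<phi>" for S using coord by (auto intro!: continuous_intros)
  have cont: "continuous_on S (f n)" for S n
    unfolding f_def by (intro continuous_intros \<phi>_cont) auto
  have "(\<lambda>z. ((1 + cnj a * z) / 2) ^ n) holomorphic_on ball 0 1" for n by (intro holomorphic_intros) auto
  note hol = holomorphic2_on_coordinate[OF this]
  have "f n \<in> bidisc_algebra" for n
    using hol[of n] coord cont unfolding bidisc_algebra_def f_def[abs_def] by auto
  then have "(\<integral>\<zeta>. f n \<zeta> \<partial>\<rho>) = f n (0, 0)" for n
    using \<rho> unfolding representing_measure_0_def by blast
  then have "(\<integral>\<zeta>. f n \<zeta> \<partial>\<rho>) = (1 / 2) ^ n" for n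
    using coord by (auto simp: f_def)
  then have "(\<lambda>n. \<integral>\<zeta>. f n \<zeta> \<partial>\<rho>) \<longlonglongrightarrow> 0"
    by (simp add: LIMSEQ_power_zero)
  moreover define L where "L = {\<zeta> \<in> torus. \<phi> \<zeta> = a}"
  have L: "L \<in> sets \<rho>"
  proof -
    have "\<phi> \<in> borel_measurable torus_borel" by (rule borel_measurable_torus_continuous[OF \<phi>_cont])
    then have "{\<zeta> \<in> space torus_borel. \<phi> \<zeta> = a} \<in> sets torus_borel" by measurable
    then show ?thesis by (simp add: L_def space_torus_borel sets)
  qed
  have "(\<lambda>n. \<integral>\<zeta>. f n \<zeta> \<partial>\<rho>) \<longlonglongrightarrow> (\<integral>\<zeta>. complex_of_real (indicator L \<zeta>) \<partial>\<rho>)"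
  proof (rule tendsto_integral_bounded[OF finite_measure_axioms, where B = 1])
    show "f n \<in> borel_measurable \<rho>" for n
      unfolding measurable_eq by (rule borel_measurable_torus_continuous[OF cont])
    fix \<zeta> assume "\<zeta> \<in> space \<rho>"
    then have z: "\<zeta> \<in> torus" by (simp only: space_eq)
    define y where "y = cnj a * \<phi> \<zeta>"
    have y: "cmod y = 1" using z a coord by (auto simp: y_def norm_mult)
    have le: "cmod ((1 + y) / 2) \<le> 1" using norm_triangle_ineq[of 1 y] y by simp
    then show "cmod (f n \<zeta>) \<le> 1" for n unfolding f_def y_def[symmetric] norm_power by (intro power_le_one) auto
    have unit: "a * cnj a = 1" using complex_norm_square[of a] a by simp
    show "(\<lambda>n. f n \<zeta>) \<longlonglongrightarrow> complex_of_real (indicator L \<zeta>)"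
    proof (cases "\<phi> \<zeta> = a")
      case True
      then have "f n \<zeta> = 1" for n using unit by (simp add: f_def mult.commute)
      then show ?thesis using True z by (simp add: L_def)
    next
      case False
      have "y \<noteq> 1"
      proof
        assume "y = 1"
        then have "a * (cnj a * \<phi> \<zeta>) = a" by (simp add: y_def)
        then show False using False unit by (simp only: mult.assoc[symmetric] mult_1_left)
      qed
      have "cmod ((1 + y) / 2) \<noteq> 1"
      proof
        assume "cmod ((1 + y) / 2) = 1"
        then have "(cmod (1 + y))\<^sup>2 = 4" by (simp add: norm_divide)
        then have "(1 + Re y)\<^sup>2 + (Im y)\<^sup>2 = 4" by (simp add: cmod_power2)
        moreover have "(Re y)\<^sup>2 + (Im y)\<^sup>2 = 1" using y cmod_power2[of y] by simp
        ultimately have "Re y = 1" by (simp add: power2_sum)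
        then have "Im y = 0" using \<open>(Re y)\<^sup>2 + (Im y)\<^sup>2 = 1\<close> by simp
        then show False using \<open>Re y = 1\<close> \<open>y \<noteq> 1\<close> by (simp add: complex_eq_iff)
      qed
      then have "(\<lambda>n. ((1 + y) / 2) ^ n) \<longlonglongrightarrow> 0" using le by (intro LIMSEQ_power_zero) simp
      then show ?thesis using False by (simp add: L_def f_def y_def)
    qed
  qed
  moreover have "(\<integral>\<zeta>. complex_of_real (indicator L \<zeta>) \<partial>\<rho>) = of_real (measure \<rho> L)"
    by (simp only: integral_complex_of_real Bochner_Integration.integral_indicator sets.Int_space_eq2 L)
  ultimately have "complex_of_real (measure \<rho> L) = 0" using LIMSEQ_unique by metis
  then have "L \<in> null_sets \<rho>" using L by (auto simp: emeasure_eq_measure)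
  then show ?thesis by (simp only: L_def)
qed

text \<open>\<open>measure_of\<close> gives \<open>S\<close> either the supremum over its subsets,
  which is 0, or the default 0 when the set function is not a measure. The lemma therefore applies
  to a pushforward directly.\<close>

lemma cm_integral_null:
  assumes S: "S \<in> sets M" and null: "\<And>A. A \<in> sets M \<Longrightarrow> A \<subseteq> S \<Longrightarrow> \<mu> A = 0"
  shows "cm_integral M \<mu> (\<lambda>x. indicator S x * g x) = 0"
proof -
  have "integral\<^sup>L (positive_part M r) (\<lambda>x. indicator S x * g x) = 0"
    if r: "\<And>A. A \<in> sets M \<Longrightarrow> A \<subseteq> S \<Longrightarrow> r A = 0" for r
  proof (rule integral_eq_zero_AE)
    have "(SUP B\<in>{B \<in> sets M. B \<subseteq> S}. ennreal (r B)) = 0"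
      using r by (intro antisym SUP_least) auto
    then have "emeasure (positive_part M r) S = 0"
      by (simp add: positive_part_def emeasure_measure_of_conv)
    moreover have "S \<in> sets (positive_part M r)"
      using S by (simp add: positive_part_def sets.space_closed)
    ultimately have "S \<in> null_sets (positive_part M r)" by auto
    then have "AE x in positive_part M r. x \<notin> S" by (rule AE_not_in)
    then show "AE x in positive_part M r. indicator S x * g x = 0" by eventually_elim simp
  qed
  then show ?thesis unfolding cm_integral_def using null by simp
qed

lemma conj_snd_measurable: "conj_snd \<in> measurable torus_borel torus_borel"
proof (rule measurable_restrict_space2)
  show "conj_snd \<in> space torus_borel \<rightarrow> torus" by (auto simp: space_torus_borel conj_snd_def)
  show "conj_snd \<in> borel_measurable torus_borel"
    unfolding conj_snd_def by (intro borel_measurable_torus_continuous continuous_intros)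
qed

text \<open>\<open>conj_snd\<close> carries lines to lines, and lines are null for
  \<open>\<rho>\<close>. The pushforward of \<open>\<nu>0\<close> thus vanishes on every Borel
  subset of the line, and a density in front cannot change that.\<close>

lemma component0_fibre_null:
  assumes \<nu>: "cm_absolutely_continuous \<nu>0 \<rho>" and \<rho>: "representing_measure_0 \<rho>"
    and coord: "\<phi> = fst \<or> \<phi> = snd" and a: "cmod a = 1"
    and S: "S \<in> sets torus_borel" "S \<subseteq> {\<zeta> \<in> torus. \<phi> \<zeta> = a}"
  shows "cm_density torus_borel g (cm_pushforward torus_borel conj_snd \<nu>0) S = 0"
  unfolding cm_density_def
proof (rule cm_integral_null[OF S(1)])
  fix A assume A: "A \<in> sets torus_borel" "A \<subseteq> S"
  let ?A = "conj_snd -` A \<inter> space torus_borel"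
  have "?A \<in> sets \<rho>"
    using measurable_sets[OF conj_snd_measurable A(1)] \<rho> by (simp add: representing_measure_0_def)
  moreover have "\<exists>b. cmod b = 1 \<and> ?A \<subseteq> {\<zeta> \<in> torus. \<phi> \<zeta> = b}"
  proof -
    have sub: "?A \<subseteq> {\<zeta> \<in> torus. \<phi> (conj_snd \<zeta>) = a}" using A(2) S(2) by (auto simp: space_torus_borel)
    from coord show ?thesis
    proof
      assume "\<phi> = fst"
      then show ?thesis using sub a by (intro exI[of _ a]) (simp add: conj_snd_def)
    next
      assume "\<phi> = snd"
      moreover have "cnj b = a \<longleftrightarrow> b = cnj a" for b by auto
      ultimately show ?thesis using sub a by (intro exI[of _ "cnj a"]) (simp add: conj_snd_def)
    qed
  qed
  ultimately have "?A \<in> null_sets \<rho>"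
    using representing_measure_fibre[OF \<rho> coord] null_sets_subset by blast
  then show "cm_pushforward torus_borel conj_snd \<nu>0 A = 0"
    using \<nu> by (simp add: cm_absolutely_continuous_def cm_pushforward_def)
qed

section \<open>Rational inner functions\<close>

lemma poly2_bipoly: "poly2 p = bipoly (degree_z1 p) (degree_z2 p) (\<lambda>j k. coeff (coeff p k) j)"
  by (simp add: fun_eq_iff bipoly_def poly2_eq_sum)

lemma reflection_bipoly: "reflection p = bipoly (degree_z1 p) (degree_z2 p)
    (\<lambda>j k. cnj (coeff (coeff p (degree_z2 p - k)) (degree_z1 p - j)))"
proof
  fix z
  let ?m = "degree_z1 p" and ?n = "degree_z2 p"
  have "reflection p z = (\<Sum>k\<le>?n. \<Sum>j\<le>?m. cnj (coeff (coeff p (?n - k)) j) * fst z ^ (?m - j) * snd z ^ k)"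
    unfolding reflection_def
    by (rule sum.reindex_bij_witness[of _ "\<lambda>k. ?n - k" "\<lambda>k. ?n - k"]) auto
  also have "\<dots> = (\<Sum>k\<le>?n. \<Sum>j\<le>?m. cnj (coeff (coeff p (?n - k)) (?m - j)) * fst z ^ j * snd z ^ k)"
    by (rule sum.cong[OF refl], rule sum.reindex_bij_witness[of _ "\<lambda>j. ?m - j" "\<lambda>j. ?m - j"]) auto
  finally show "reflection p z = bipoly ?m ?n (\<lambda>j k. cnj (coeff (coeff p (?n - k)) (?m - j))) z"
    by (simp add: bipoly_def)
qed

lemma norm_reflection_torus:
  assumes "\<zeta> \<in> torus"
  shows "cmod (reflection p \<zeta>) = cmod (poly2 p \<zeta>)"
proof -
  obtain a b where z: "\<zeta> = (a, b)" "cmod a = 1" "cmod b = 1" using assms by auto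
  have inv: "1 / cnj y = y" if "cmod y = 1" for y
  proof -
    have "y * cnj y = 1" using complex_norm_square[of y] that by simp
    then show ?thesis by (metis divide_eq_eq mult_zero_right zero_neq_one)
  qed
  have "a \<noteq> 0" "b \<noteq> 0" using z by auto
  then show ?thesis using z by (simp add: reflection_eq inv norm_mult norm_power)
qed

lemma holomorphic_bipoly_slices:
  "(\<lambda>z. bipoly m n c (z, w)) holomorphic_on S" "(\<lambda>w. bipoly m n c (z, w)) holomorphic_on S"
  unfolding bipoly_def by (auto intro!: holomorphic_intros)

lemma finite_bipoly_zeros:
  assumes "bipoly m n c (0, 0) \<noteq> 0"
  shows "finite {a. bipoly m n c (a, 0) = 0}" "finite {b. bipoly m n c (0, b) = 0}"
proof -
  define s where "s = (\<Sum>j\<le>m. monom (c j 0) j)"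
  define t where "t = (\<Sum>k\<le>n. monom (c 0 k) k)"
  have s: "poly s a = bipoly m n c (a, 0)" for a
    by (simp add: s_def bipoly_def poly_sum poly_monom sum_atMost_shift0[of _ n])
  have t: "poly t b = bipoly m n c (0, b)" for b
    by (simp add: t_def bipoly_def poly_sum poly_monom sum_atMost_shift0[of _ m])
  have "s \<noteq> 0" "t \<noteq> 0" using s[of 0] t[of 0] assms by auto
  then show "finite {a. bipoly m n c (a, 0) = 0}" "finite {b. bipoly m n c (0, b) = 0}"
    using poly_roots_finite[of s] poly_roots_finite[of t] by (simp_all add: s t)
qed

text \<open>Where \<open>b = \<alpha>\<close> the quotient in \<open>is_clark_measure\<close> is \<open>x / 0 = 0\<close>, so the zero measure has to be
  excluded first: it would force \<open>\<bar>b\<bar> = 1\<close> everywhere, hence \<open>b\<close> constant.\<close>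

lemma clark_measure_norm_less:
  assumes alpha: "cmod \<alpha> = 1" and clark: "is_clark_measure b \<alpha> \<sigma>"
    and hol1: "\<And>w. w \<in> ball 0 1 \<Longrightarrow> (\<lambda>z. b (z, w)) holomorphic_on ball 0 1"
    and hol2: "\<And>z. z \<in> ball 0 1 \<Longrightarrow> (\<lambda>w. b (z, w)) holomorphic_on ball 0 1"
    and nonconst: "\<not> b constant_on bidisc" and z: "z \<in> bidisc"
  shows "cmod (b z) < 1"
proof -
  interpret torus_measure \<sigma>
    using clark by (simp add: is_clark_measure_def torus_measure_def torus_measure_axioms_def)
  have formula: "(\<integral>\<zeta>. poisson2 z \<zeta> \<partial>\<sigma>) = (1 - (cmod (b z))\<^sup>2) / (cmod (\<alpha> - b z))\<^sup>2" if "z \<in> bidisc" for z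
    using clark that unfolding is_clark_measure_def by blast
  have sp: "emeasure \<sigma> (space \<sigma>) \<noteq> 0"
  proof
    assume zero: "emeasure \<sigma> (space \<sigma>) = 0"
    have norm: "cmod (b z) = 1" if z: "z \<in> bidisc" for z
    proof -
      have "AE \<zeta> in \<sigma>. poisson2 z \<zeta> = 0" using zero by (auto intro!: AE_I[of _ _ "space \<sigma>"])
      then have "(\<integral>\<zeta>. poisson2 z \<zeta> \<partial>\<sigma>) = 0" by (rule integral_eq_zero_AE)
      then have "\<alpha> = b z \<or> (cmod (b z))\<^sup>2 = 1" using formula[OF z] by auto
      then show ?thesis using alpha by (auto simp: power2_eq_1_iff) (use norm_ge_zero[of "b z"] in linarith)
    qed
    \<comment> \<open>The modulus is 1 throughout, so it is maximal at the centre of each disc and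
      the maximum principle makes the slices constant, first in one variable and then in the
      other.\<close>
    have c1: "b (z, w) = b (0, w)" if "z \<in> ball 0 1" "w \<in> ball 0 1" for z w
    proof -
      have "(\<lambda>z. b (z, w)) constant_on ball 0 1"
        by (rule maximum_modulus_principle[OF hol1[OF that(2)], of "ball 0 1" 0]) (use norm that in auto)
      then show ?thesis using that unfolding constant_on_def by (metis centre_in_ball zero_less_one)
    qed
    have c2: "b (0, w) = b (0, 0)" if "w \<in> ball 0 1" for w
    proof -
      have "(\<lambda>w. b (0, w)) constant_on ball 0 1"
        by (rule maximum_modulus_principle[OF hol2[of 0], of "ball 0 1" 0]) (use norm in auto)
      then show ?thesis using that unfolding constant_on_def by (metis centre_in_ball zero_less_one)
    qed
    have "b x = b (0, 0)" if "x \<in> bidisc" for x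
      using c1[of "fst x" "snd x"] c2[of "snd x"] that by auto
    then show False using nonconst unfolding constant_on_def by blast
  qed
  have pos: "0 < poisson2 z \<zeta>" if "\<zeta> \<in> torus" for \<zeta>
  proof -
    have "cmod (fst z) < 1" "cmod (snd z) < 1" using z by auto
    then have "(cmod (fst z))\<^sup>2 < 1" "(cmod (snd z))\<^sup>2 < 1" "fst \<zeta> \<noteq> fst z" "snd \<zeta> \<noteq> snd z"
      using that by (auto simp: abs_square_less_1)
    then show ?thesis unfolding poisson2_def by (intro mult_pos_pos divide_pos_pos) auto
  qed
  have cont: "continuous_on torus (poisson2 z)"
    unfolding poisson2_def by (intro continuous_intros) (use z in auto)
  obtain B where B: "\<And>\<zeta>. \<zeta> \<in> torus \<Longrightarrow> norm (poisson2 z \<zeta>) \<le> B"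
    using continuous_torus_bounded[OF cont] by metis
  have int: "integrable \<sigma> (poisson2 z)"
    by (rule integrable_bounded[OF borel_measurable_torus_continuous[OF cont] B])
  have AE_nn: "AE \<zeta> in \<sigma>. 0 \<le> poisson2 z \<zeta>"
    using pos by (intro AE_I2) (simp add: space_eq less_imp_le)
  have "(\<integral>\<zeta>. poisson2 z \<zeta> \<partial>\<sigma>) \<noteq> 0"
  proof
    assume "(\<integral>\<zeta>. poisson2 z \<zeta> \<partial>\<sigma>) = 0"
    then have "AE \<zeta> in \<sigma>. poisson2 z \<zeta> = 0"
      using integral_nonneg_eq_0_iff_AE[OF int AE_nn] by blast
    moreover have "AE \<zeta> in \<sigma>. poisson2 z \<zeta> \<noteq> 0"
      by (intro AE_I2) (use pos in \<open>force simp: space_eq\<close>)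
    ultimately have "AE \<zeta> in \<sigma>. False" by eventually_elim simp
    then show False using sp by (simp add: AE_iff_null null_sets_def)
  qed
  then have "0 < (\<integral>\<zeta>. poisson2 z \<zeta> \<partial>\<sigma>)"
    using integral_nonneg_AE[OF AE_nn] by linarith
  then have "0 < (1 - (cmod (b z))\<^sup>2) / (cmod (\<alpha> - b z))\<^sup>2" by (simp only: formula[OF z])
  then have "0 < 1 - (cmod (b z))\<^sup>2" by (auto simp: zero_less_divide_iff)
  then show ?thesis by (simp add: abs_square_less_1)
qed

section \<open>From the kernel estimate to the square integrable density\<close>

definition fibre :: "(complex \<times> complex \<Rightarrow> complex) \<Rightarrow> complex \<Rightarrow> (complex \<times> complex) set" where
  "fibre \<phi> a = {\<zeta> \<in> torus. \<phi> \<zeta> = a}"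

lemma fibre_sets: "\<phi> = fst \<or> \<phi> = snd \<Longrightarrow> fibre \<phi> a \<in> sets torus_borel"
proof -
  assume "\<phi> = fst \<or> \<phi> = snd"
  then have "\<phi> \<in> borel_measurable torus_borel" using torus_borel_measurable by auto
  then have "{\<zeta> \<in> space torus_borel. \<phi> \<zeta> = a} \<in> sets torus_borel" by measurable
  then show ?thesis by (simp add: fibre_def space_torus_borel)
qed

text \<open>\<open>\<phi> - a\<close> is a polynomial without zeros in the bidisc, since
  \<open>a\<close> has modulus 1.\<close>

lemma fibre_in_bp_cauchy:
  assumes coord: "\<phi> = fst \<or> \<phi> = snd" and a: "cmod a = 1"
  shows "indicator (fibre \<phi> a) \<in> bp_cauchy"
proof -
  have f: "bipoly 1 0 (\<lambda>j k. if j = 0 then - a else 1) z = fst z - a"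
    and s: "bipoly 0 1 (\<lambda>j k. if k = 0 then - a else 1) z = snd z - a" for z
    by (simp_all add: bipoly_def)
  from coord show ?thesis
  proof
    assume \<phi>: "\<phi> = fst"
    have "(\<lambda>\<zeta>. of_bool (bipoly 1 0 (\<lambda>j k. if j = 0 then - a else 1) \<zeta> = 0)) \<in> bp_cauchy"
    proof (rule zero_set_in_bp_cauchy)
      fix z assume "z \<in> bidisc"
      then show "bipoly 1 0 (\<lambda>j k. if j = 0 then - a else 1) z \<noteq> 0" unfolding f using a by auto
    qed
    then show ?thesis
      unfolding f by (rule bp_cauchy.cong) (auto simp: \<phi> fibre_def indicator_def)
  next
    assume \<phi>: "\<phi> = snd"
    have "(\<lambda>\<zeta>. of_bool (bipoly 0 1 (\<lambda>j k. if k = 0 then - a else 1) \<zeta> = 0)) \<in> bp_cauchy"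
    proof (rule zero_set_in_bp_cauchy)
      fix z assume "z \<in> bidisc"
      then show "bipoly 0 1 (\<lambda>j k. if k = 0 then - a else 1) z \<noteq> 0" unfolding s using a by auto
    qed
    then show ?thesis
      unfolding s by (rule bp_cauchy.cong) (auto simp: \<phi> fibre_def indicator_def)
  qed
qed

section \<open>Clark measures on lines\<close>

context clark_measure
begin

text \<open>\<open>polarized_poisson 0 v\<close> is the resolvent
  \<open>1 / (1 - v * \<psi>)\<close>. That its integral over the line is independent of
  \<open>v\<close> says that all Fourier coefficients of the restriction but the zeroth vanish, the
  negative ones by conjugation.\<close>

lemma fibre_poisson:
  fixes \<phi> \<psi> :: "complex \<times> complex \<Rightarrow> complex"
  assumes coord: "\<phi> = fst \<and> \<psi> = snd \<or> \<phi> = snd \<and> \<psi> = fst"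
    and a: "cmod a = 1" and v: "cmod v < 1"
  shows "(\<integral>\<zeta>. indicator (fibre \<phi> a) \<zeta> * (1 / (1 - \<psi> \<zeta> * v)) \<partial>\<sigma>) = of_real (measure \<sigma> (fibre \<phi> a))"
proof -
  have L: "fibre \<phi> a = {\<zeta> \<in> space \<sigma>. \<phi> \<zeta> = a}" by (simp only: fibre_def space_eq)
  from coord show ?thesis
  proof
    assume \<phi>\<psi>: "\<phi> = fst \<and> \<psi> = snd"
    have "(\<integral>\<zeta>. indicator {\<zeta> \<in> space \<sigma>. \<phi> \<zeta> = a} \<zeta> * polarized_poisson 0 v (\<psi> \<zeta>) \<partial>\<sigma>) =
        of_real (measure \<sigma> {\<zeta> \<in> space \<sigma>. \<phi> \<zeta> = a})"
      by (rule fibre_poisson_integral[where f = "\<lambda>z z'. herglotz (z, z') / 2"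
            and g = "\<lambda>v v'. cnj (herglotz (cnj v, cnj v')) / 2"])
         (use \<phi>\<psi> a v finite_measure_axioms in \<open>auto simp: space_eq polarized_identity add_divide_distrib\<close>)
    then show ?thesis by (simp add: L polarized_poisson_def mult.commute)
  next
    assume \<phi>\<psi>: "\<phi> = snd \<and> \<psi> = fst"
    have "(\<integral>\<zeta>. indicator {\<zeta> \<in> space \<sigma>. \<phi> \<zeta> = a} \<zeta> * polarized_poisson 0 v (\<psi> \<zeta>) \<partial>\<sigma>) =
        of_real (measure \<sigma> {\<zeta> \<in> space \<sigma>. \<phi> \<zeta> = a})"
      by (rule fibre_poisson_integral[where f = "\<lambda>z z'. herglotz (z', z) / 2"
            and g = "\<lambda>v v'. cnj (herglotz (cnj v', cnj v)) / 2"])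
         (use \<phi>\<psi> a v finite_measure_axioms in \<open>auto simp: space_eq polarized_identity add_divide_distrib mult.commute[of "polarized_poisson _ _ (snd _)"]\<close>)
    then show ?thesis by (simp add: L polarized_poisson_def mult.commute)
  qed
qed

text \<open>On the line the factor of the Cauchy kernel in \<open>\<phi>\<close> is constant, and
  the other factor integrates to the mass.\<close>

lemma fibre_cauchy_kernel:
  fixes \<phi> \<psi> :: "complex \<times> complex \<Rightarrow> complex"
  assumes coord: "\<phi> = fst \<and> \<psi> = snd \<or> \<phi> = snd \<and> \<psi> = fst"
    and a: "cmod a = 1" and w: "w \<in> bidisc"
  shows "(\<integral>\<zeta>. indicator (fibre \<phi> a) \<zeta> * cnj (cauchy_kernel \<zeta> w) \<partial>\<sigma>) =
    of_real (measure \<sigma> (fibre \<phi> a)) / (1 - cnj a * \<phi> w)"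
proof -
  have v: "cmod (cnj (\<psi> w)) < 1" using coord w by auto
  have "(\<integral>\<zeta>. indicator (fibre \<phi> a) \<zeta> * cnj (cauchy_kernel \<zeta> w) \<partial>\<sigma>) =
      (\<integral>\<zeta>. cnj ((1 / (1 - a * cnj (\<phi> w))) * (indicator (fibre \<phi> a) \<zeta> * (1 / (1 - \<psi> \<zeta> * cnj (\<psi> w))))) \<partial>\<sigma>)"
  proof (rule Bochner_Integration.integral_cong[OF refl])
    fix \<zeta>
    have "cauchy_kernel \<zeta> w = (1 / (1 - \<phi> \<zeta> * cnj (\<phi> w))) * (1 / (1 - \<psi> \<zeta> * cnj (\<psi> w)))"
      using coord by (auto simp: cauchy_kernel_def)
    then show "indicator (fibre \<phi> a) \<zeta> * cnj (cauchy_kernel \<zeta> w) =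
        cnj ((1 / (1 - a * cnj (\<phi> w))) * (indicator (fibre \<phi> a) \<zeta> * (1 / (1 - \<psi> \<zeta> * cnj (\<psi> w)))))"
      by (simp add: indicator_def fibre_def)
  qed
  also have "\<dots> = cnj ((1 / (1 - a * cnj (\<phi> w))) * of_real (measure \<sigma> (fibre \<phi> a)))"
    unfolding Bochner_Integration.integral_cnj integral_mult_right_zero fibre_poisson[OF coord a v] ..
  finally show ?thesis by simp
qed

end

section \<open>Consequences of the kernel estimate at one point\<close>

locale clark_pair =
  s1: clark_measure b1 \<alpha> \<sigma>1 + s2: clark_measure b2 \<alpha> \<sigma>2 for b1 b2 \<alpha> \<sigma>1 \<sigma>2 +
  fixes w :: "complex \<times> complex" and K :: real
  assumes w: "w \<in> bidisc" and K: "0 \<le> K"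
    and bound: "f \<in> bp_cauchy \<Longrightarrow> cmod (\<integral>\<zeta>. f \<zeta> * cnj (cauchy_kernel \<zeta> w) \<partial>\<sigma>1)
      \<le> K * sqrt (\<integral>\<zeta>. (cmod (f \<zeta>))\<^sup>2 \<partial>\<sigma>2)"
begin

text \<open>Testing with the indicator of the line shows that \<sigma>1 does not charge it unless
  \<sigma>2 does. By uniqueness on fibres \<sigma>1 is then \<open>m1 / m2\<close> times \<sigma>2
  on the line, and Cauchy-Schwarz passes from the integral to the \<open>L\<^sup>2\<close>
  norm.\<close>

lemma fibre_bound:
  fixes \<phi> :: "complex \<times> complex \<Rightarrow> complex"
  assumes coord: "\<phi> = fst \<or> \<phi> = snd" and a: "cmod a = 1"
  shows "\<exists>C\<ge>0. \<forall>u B. u \<in> borel_measurable torus_borel \<longrightarrow> (\<forall>\<zeta>\<in>torus. 0 \<le> u \<zeta> \<and> u \<zeta> \<le> B) \<longrightarrow>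
    (\<integral>\<zeta>. indicator (fibre \<phi> a) \<zeta> * u \<zeta> \<partial>\<sigma>1) \<le> C * sqrt (\<integral>\<zeta>. (u \<zeta>)\<^sup>2 \<partial>\<sigma>2)"
proof -
  obtain \<psi> :: "complex \<times> complex \<Rightarrow> complex" where \<phi>\<psi>: "\<phi> = fst \<and> \<psi> = snd \<or> \<phi> = snd \<and> \<psi> = fst" using coord by auto
  let ?L = "fibre \<phi> a"
  have L: "?L \<in> sets torus_borel" by (rule fibre_sets[OF coord])
  define m1 m2 where "m1 = measure \<sigma>1 ?L" and "m2 = measure \<sigma>2 ?L"
  have "cmod (of_real m1 / (1 - cnj a * \<phi> w)) \<le> K * sqrt m2"
  proof -
    have "(\<integral>\<zeta>. (cmod (indicator ?L \<zeta>))\<^sup>2 \<partial>\<sigma>2) = (\<integral>\<zeta>. indicator ?L \<zeta> \<partial>\<sigma>2)"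
      by (intro Bochner_Integration.integral_cong refl) (simp add: indicator_def)
    also have "\<dots> = m2"
      using L s2.sets_eq by (simp add: m2_def sets.Int_space_eq2)
    finally show ?thesis
      using bound[OF fibre_in_bp_cauchy[OF coord a]] by (simp only: s1.fibre_cauchy_kernel[OF \<phi>\<psi> a w] m1_def)
  qed
  moreover have "1 - cnj a * \<phi> w \<noteq> 0"
    using coord a w by (intro one_minus_mult_nonzero) auto
  ultimately have m1_zero: "m1 = 0" if "m2 = 0" using that by (simp add: norm_divide divide_le_0_iff)
  have transfer: "m2 * (\<integral>\<zeta>. indicator ?L \<zeta> * u \<zeta> \<partial>\<sigma>1) = m1 * (\<integral>\<zeta>. indicator ?L \<zeta> * u \<zeta> \<partial>\<sigma>2)"
    if u: "u \<in> borel_measurable torus_borel" "\<forall>\<zeta>\<in>torus. 0 \<le> u \<zeta> \<and> u \<zeta> \<le> B" for u B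
  proof -
    have "of_real m2 * (\<integral>\<zeta>. indicator ?L \<zeta> * complex_of_real (u \<zeta>) \<partial>\<sigma>1) =
        of_real m1 * (\<integral>\<zeta>. indicator ?L \<zeta> * complex_of_real (u \<zeta>) \<partial>\<sigma>2)"
    proof (rule fibre_integral_unique[OF \<phi>\<psi> s1.finite_measure_axioms s2.finite_measure_axioms s1.sets_eq s2.sets_eq fibre_def])
      show "cmod (complex_of_real (u \<zeta>)) \<le> B" if "\<zeta> \<in> torus" for \<zeta> using u(2) that by auto
      show "(\<lambda>\<zeta>. complex_of_real (u \<zeta>)) \<in> borel_measurable torus_borel" using u(1) by measurable
      show "complex_of_real m2 * (\<integral>\<zeta>. indicator ?L \<zeta> * (1 / (1 - \<psi> \<zeta> * v)) \<partial>\<sigma>1) =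
          of_real m1 * (\<integral>\<zeta>. indicator ?L \<zeta> * (1 / (1 - \<psi> \<zeta> * v)) \<partial>\<sigma>2)" if "cmod v < 1" for v
        unfolding s1.fibre_poisson[OF \<phi>\<psi> a that] s2.fibre_poisson[OF \<phi>\<psi> a that] m1_def m2_def by (rule mult.commute)
    qed
    moreover have "(\<integral>\<zeta>. indicator ?L \<zeta> * complex_of_real (u \<zeta>) \<partial>\<sigma>) = of_real (\<integral>\<zeta>. indicator ?L \<zeta> * u \<zeta> \<partial>\<sigma>)" for \<sigma>
    proof -
      have "indicator ?L \<zeta> * complex_of_real (u \<zeta>) = complex_of_real (indicator ?L \<zeta> * u \<zeta>)" for \<zeta>
        by (simp add: indicator_def)
      then show ?thesis by (simp only: integral_complex_of_real)
    qed
    ultimately have "complex_of_real (m2 * (\<integral>\<zeta>. indicator ?L \<zeta> * u \<zeta> \<partial>\<sigma>1)) =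
        complex_of_real (m1 * (\<integral>\<zeta>. indicator ?L \<zeta> * u \<zeta> \<partial>\<sigma>2))"
      by (simp only: of_real_mult)
    then show ?thesis by (simp only: of_real_eq_iff)
  qed
  have le2: "(\<integral>\<zeta>. indicator ?L \<zeta> * u \<zeta> \<partial>\<sigma>2) \<le> sqrt (measure \<sigma>2 (space \<sigma>2)) * sqrt (\<integral>\<zeta>. (u \<zeta>)\<^sup>2 \<partial>\<sigma>2)"
    and nn: "0 \<le> (\<integral>\<zeta>. indicator ?L \<zeta> * u \<zeta> \<partial>\<sigma>1)" and nn0: "m1 = 0 \<Longrightarrow> (\<integral>\<zeta>. indicator ?L \<zeta> * u \<zeta> \<partial>\<sigma>1) = 0"
    if u: "u \<in> borel_measurable torus_borel" "\<forall>\<zeta>\<in>torus. 0 \<le> u \<zeta> \<and> u \<zeta> \<le> B" for u B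
  proof -
    have i2: "integrable \<sigma>2 u" by (rule s2.integrable_bounded[where B = B]) (use u in auto)
    have "(\<integral>\<zeta>. indicator ?L \<zeta> * u \<zeta> \<partial>\<sigma>2) \<le> (\<integral>\<zeta>. u \<zeta> \<partial>\<sigma>2)"
    proof (rule integral_mono)
      show "integrable \<sigma>2 (\<lambda>\<zeta>. indicator ?L \<zeta> * u \<zeta>)"
        using integrable_mult_indicator[OF _ i2, of ?L] L s2.sets_eq by simp
      show "indicator ?L \<zeta> * u \<zeta> \<le> u \<zeta>" if "\<zeta> \<in> space \<sigma>2" for \<zeta>
        using u(2) that by (auto simp: indicator_def s2.space_eq)
    qed (rule i2)
    also have "\<dots> \<le> sqrt (measure \<sigma>2 (space \<sigma>2)) * sqrt (\<integral>\<zeta>. (u \<zeta>)\<^sup>2 \<partial>\<sigma>2)"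
      using u by (intro s2.integral_square_le[where B = B]) auto
    finally show "(\<integral>\<zeta>. indicator ?L \<zeta> * u \<zeta> \<partial>\<sigma>2) \<le> \<dots>" .
    show "0 \<le> (\<integral>\<zeta>. indicator ?L \<zeta> * u \<zeta> \<partial>\<sigma>1)"
      using u(2) by (intro integral_nonneg_AE AE_I2) (auto simp: indicator_def s1.space_eq)
    show "(\<integral>\<zeta>. indicator ?L \<zeta> * u \<zeta> \<partial>\<sigma>1) = 0" if "m1 = 0"
    proof (rule integral_eq_zero_AE)
      have "?L \<in> null_sets \<sigma>1"
        using that L s1.sets_eq by (auto simp: m1_def s1.emeasure_eq_measure)
      then have "AE \<zeta> in \<sigma>1. \<zeta> \<notin> ?L" by (rule AE_not_in)
      then show "AE \<zeta> in \<sigma>1. indicator ?L \<zeta> * u \<zeta> = 0" by eventually_elim simp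
    qed
  qed
  \<comment> \<open>For \<open>m2 = 0\<close> the quotient is 0 by convention, which fits since then
    \<open>m1 = 0\<close> as well.\<close>
  let ?C = "m1 / m2 * sqrt (measure \<sigma>2 (space \<sigma>2))"
  have m: "0 \<le> m1" "0 \<le> m2" by (simp_all add: m1_def m2_def)
  show ?thesis
  proof (intro exI[of _ ?C] conjI allI impI)
    show "0 \<le> ?C" using m by simp
    fix u :: "complex \<times> complex \<Rightarrow> real" and B
    assume u: "u \<in> borel_measurable torus_borel" "\<forall>\<zeta>\<in>torus. 0 \<le> u \<zeta> \<and> u \<zeta> \<le> B"
    show "(\<integral>\<zeta>. indicator ?L \<zeta> * u \<zeta> \<partial>\<sigma>1) \<le> ?C * sqrt (\<integral>\<zeta>. (u \<zeta>)\<^sup>2 \<partial>\<sigma>2)"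
    proof (cases "m2 = 0")
      case True
      then show ?thesis using nn0[OF u] m1_zero by simp
    next
      case False
      then have "(\<integral>\<zeta>. indicator ?L \<zeta> * u \<zeta> \<partial>\<sigma>1) = m1 / m2 * (\<integral>\<zeta>. indicator ?L \<zeta> * u \<zeta> \<partial>\<sigma>2)"
        using transfer[OF u] by (simp add: field_simps)
      also have "\<dots> \<le> m1 / m2 * (sqrt (measure \<sigma>2 (space \<sigma>2)) * sqrt (\<integral>\<zeta>. (u \<zeta>)\<^sup>2 \<partial>\<sigma>2))"
        using le2[OF u] m by (intro mult_left_mono) auto
      finally show ?thesis by (simp only: mult.assoc)
    qed
  qed
qed

lemma curve_bound:
  assumes nz: "\<And>z. z \<in> bidisc \<Longrightarrow> bipoly m n c z \<noteq> 0"
    and u: "u \<in> borel_measurable torus_borel" "\<forall>\<zeta>\<in>torus. 0 \<le> u \<zeta> \<and> u \<zeta> \<le> B"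
  shows "(\<integral>\<zeta>. indicator (curve_part m n c) \<zeta> * u \<zeta> \<partial>\<sigma>1) \<le> 4 * K * sqrt (\<integral>\<zeta>. (u \<zeta>)\<^sup>2 \<partial>\<sigma>2)"
proof -
  let ?N = "curve_part m n c"
  define \<kappa> where "\<kappa> \<zeta> = cnj (cauchy_kernel \<zeta> w)" for \<zeta>
  have \<kappa>: "\<kappa> \<zeta> \<noteq> 0" "cmod (1 / \<kappa> \<zeta>) \<le> 4" if z: "\<zeta> \<in> torus" for \<zeta>
  proof -
    define x y where "x = 1 - fst \<zeta> * cnj (fst w)" and "y = 1 - snd \<zeta> * cnj (snd w)"
    have c: "cmod (fst \<zeta>) = 1" "cmod (snd \<zeta>) = 1" "cmod (fst w) < 1" "cmod (snd w) < 1" using z w by auto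
    have nz: "x \<noteq> 0" "y \<noteq> 0" unfolding x_def y_def using c by (intro one_minus_mult_nonzero; simp)+
    have le: "cmod x \<le> 2" "cmod y \<le> 2"
      unfolding x_def y_def using c norm_triangle_ineq4[of 1 "fst \<zeta> * cnj (fst w)"]
        norm_triangle_ineq4[of 1 "snd \<zeta> * cnj (snd w)"] by (auto simp: norm_mult)
    have "cauchy_kernel \<zeta> w = 1 / (x * y)" by (simp add: cauchy_kernel_def x_def y_def)
    then show "\<kappa> \<zeta> \<noteq> 0" using nz by (simp add: \<kappa>_def)
    have "cmod (1 / \<kappa> \<zeta>) = cmod x * cmod y"
      using nz \<open>cauchy_kernel \<zeta> w = 1 / (x * y)\<close> by (simp add: \<kappa>_def norm_divide norm_mult)
    also have "\<dots> \<le> 2 * 2" using le by (intro mult_mono) auto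
    finally show "cmod (1 / \<kappa> \<zeta>) \<le> 4" by simp
  qed
  define f where "f \<zeta> = complex_of_real (u \<zeta>) * (1 / \<kappa> \<zeta>)" for \<zeta>
  have f_le: "cmod (f \<zeta>) \<le> 4 * u \<zeta>" if "\<zeta> \<in> torus" for \<zeta>
    using mult_left_mono[OF \<kappa>(2)[OF that], of "u \<zeta>"] u(2) that
    unfolding f_def norm_mult by (auto simp: mult.commute)
  have [measurable]: "\<kappa> \<in> borel_measurable torus_borel"
    unfolding \<kappa>_def by (intro borel_measurable_cnj cauchy_kernel_torus w)
  note [measurable] = u(1)
  have f_meas: "f \<in> borel_measurable torus_borel" unfolding f_def by measurable
  have mem: "(\<lambda>\<zeta>. indicator ?N \<zeta> * f \<zeta>) \<in> bp_cauchy"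
  proof (rule curve_part_in_bp_cauchy[OF nz f_meas])
    show "cmod (f \<zeta>) \<le> 4 * B" if "\<zeta> \<in> torus" for \<zeta>
      using f_le[OF that] u(2) that by force
  qed
  have N: "?N \<in> sets \<sigma>1" using curve_part_sets s1.sets_eq by simp
  have "(\<integral>\<zeta>. indicator ?N \<zeta> * f \<zeta> * \<kappa> \<zeta> \<partial>\<sigma>1) = (\<integral>\<zeta>. complex_of_real (indicator ?N \<zeta> * u \<zeta>) \<partial>\<sigma>1)"
  proof (rule Bochner_Integration.integral_cong[OF refl])
    fix \<zeta> assume "\<zeta> \<in> space \<sigma>1"
    then have "\<kappa> \<zeta> \<noteq> 0" by (intro \<kappa>) (simp only: s1.space_eq)
    then show "indicator ?N \<zeta> * f \<zeta> * \<kappa> \<zeta> = complex_of_real (indicator ?N \<zeta> * u \<zeta>)"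
      by (simp add: f_def indicator_def)
  qed
  then have "cmod (of_real (\<integral>\<zeta>. indicator ?N \<zeta> * u \<zeta> \<partial>\<sigma>1)) \<le>
      K * sqrt (\<integral>\<zeta>. (cmod (indicator ?N \<zeta> * f \<zeta>))\<^sup>2 \<partial>\<sigma>2)"
    using bound[OF mem] by (simp only: integral_complex_of_real \<kappa>_def)
  then have "(\<integral>\<zeta>. indicator ?N \<zeta> * u \<zeta> \<partial>\<sigma>1) \<le> K * sqrt (\<integral>\<zeta>. (cmod (indicator ?N \<zeta> * f \<zeta>))\<^sup>2 \<partial>\<sigma>2)"
    by (simp only: norm_of_real)
  also have "\<dots> \<le> K * sqrt (\<integral>\<zeta>. (4 * u \<zeta>)\<^sup>2 \<partial>\<sigma>2)"
  proof (intro mult_left_mono real_sqrt_le_mono integral_mono K)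
    show "integrable \<sigma>2 (\<lambda>\<zeta>. (4 * u \<zeta>)\<^sup>2)"
    proof (rule s2.integrable_bounded[where B = "(4 * B)\<^sup>2"])
      show "norm ((4 * u \<zeta>)\<^sup>2) \<le> (4 * B)\<^sup>2" if "\<zeta> \<in> torus" for \<zeta>
        unfolding real_norm_def abs_power2 using u(2) that by (intro power_mono) auto
    qed measurable
    have sq: "(cmod (indicator ?N \<zeta> * f \<zeta>))\<^sup>2 \<le> (4 * u \<zeta>)\<^sup>2" if "\<zeta> \<in> torus" for \<zeta>
    proof (rule power_mono)
      have "0 \<le> u \<zeta>" using u(2) that by blast
      then show "cmod (indicator ?N \<zeta> * f \<zeta>) \<le> 4 * u \<zeta>"
        using f_le[OF that] by (simp add: indicator_def)
    qed simp
    show "(cmod (indicator ?N \<zeta> * f \<zeta>))\<^sup>2 \<le> (4 * u \<zeta>)\<^sup>2" if "\<zeta> \<in> space \<sigma>2" for \<zeta>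
      using sq that by (simp only: s2.space_eq)
    show "integrable \<sigma>2 (\<lambda>\<zeta>. (cmod (indicator ?N \<zeta> * f \<zeta>))\<^sup>2)"
    proof (rule s2.integrable_bounded[where B = "(4 * B)\<^sup>2"])
      have "?N \<in> sets torus_borel" by (rule curve_part_sets)
      then show "(\<lambda>\<zeta>. (cmod (indicator ?N \<zeta> * f \<zeta>))\<^sup>2) \<in> borel_measurable torus_borel"
        using f_meas by measurable
      fix \<zeta> assume z: "\<zeta> \<in> torus"
      have "(4 * u \<zeta>)\<^sup>2 \<le> (4 * B)\<^sup>2" using u(2) z by (intro power_mono) auto
      then show "norm ((cmod (indicator ?N \<zeta> * f \<zeta>))\<^sup>2) \<le> (4 * B)\<^sup>2"
        unfolding real_norm_def abs_power2 using sq[OF z] by linarith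
    qed
  qed
  also have "\<dots> = 4 * K * sqrt (\<integral>\<zeta>. (u \<zeta>)\<^sup>2 \<partial>\<sigma>2)"
    by (simp add: power_mult_distrib real_sqrt_mult)
  finally show ?thesis .
qed

text \<open>Almost every point for \<sigma>1 lies on the curve part or on one of finitely many
  lines, so the constants add up. The lines may meet, hence an inequality in place of a
  decomposition.\<close>

lemma square_integrable_bound:
  assumes nz: "\<And>z. z \<in> bidisc \<Longrightarrow> bipoly m n c z \<noteq> 0"
    and AE: "AE \<zeta> in \<sigma>1. bipoly m n c \<zeta> = 0"
  shows "\<exists>C\<ge>0. \<forall>u B. u \<in> borel_measurable \<sigma>2 \<longrightarrow> (\<forall>\<zeta>\<in>space \<sigma>2. 0 \<le> u \<zeta> \<and> u \<zeta> \<le> B) \<longrightarrow>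
    (\<integral>\<zeta>. u \<zeta> \<partial>\<sigma>1) \<le> C * sqrt (\<integral>\<zeta>. (u \<zeta>)\<^sup>2 \<partial>\<sigma>2)"
proof -
  \<comment> \<open>A line is indexed by a coordinate function and its value; a zero in the first
    variable gives a line for \<open>fst\<close>, one in the second a line for
    \<open>snd\<close>.\<close>
  define I where "I = {fst} \<times> {a. cmod a = 1 \<and> bipoly m n c (a, 0) = 0} \<union>
    {snd :: complex \<times> complex \<Rightarrow> complex} \<times> {b. cmod b = 1 \<and> bipoly m n c (0, b) = 0}"
  have "bipoly m n c (0, 0) \<noteq> 0" by (rule nz) simp
  note fin = finite_bipoly_zeros[OF this]
  have I: "finite I"
    unfolding I_def
    by (intro finite_UnI finite_cartesian_product finite_subset[OF _ fin(1)] finite_subset[OF _ fin(2)]) auto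
  define bd where "bd i C \<longleftrightarrow> (\<forall>u B. u \<in> borel_measurable torus_borel \<longrightarrow> (\<forall>\<zeta>\<in>torus. 0 \<le> u \<zeta> \<and> u \<zeta> \<le> B) \<longrightarrow>
    (\<integral>\<zeta>. indicator (fibre (fst i) (snd i)) \<zeta> * u \<zeta> \<partial>\<sigma>1) \<le> C * sqrt (\<integral>\<zeta>. (u \<zeta>)\<^sup>2 \<partial>\<sigma>2))"
    for i :: "(complex \<times> complex \<Rightarrow> complex) \<times> complex" and C :: real
  have "\<forall>i\<in>I. \<exists>C\<ge>0. bd i C"
    unfolding bd_def by (intro ballI fibre_bound) (auto simp: I_def)
  then obtain C where C: "\<And>i. i \<in> I \<Longrightarrow> 0 \<le> C i" and bd: "\<And>i. i \<in> I \<Longrightarrow> bd i (C i)"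
    by metis
  have C_bound: "(\<integral>\<zeta>. indicator (fibre (fst i) (snd i)) \<zeta> * u \<zeta> \<partial>\<sigma>1) \<le> C i * sqrt (\<integral>\<zeta>. (u \<zeta>)\<^sup>2 \<partial>\<sigma>2)"
    if "i \<in> I" "u \<in> borel_measurable torus_borel" "\<forall>\<zeta>\<in>torus. 0 \<le> u \<zeta> \<and> u \<zeta> \<le> B" for i u B
    using bd[OF that(1)] that(2,3) unfolding bd_def by blast
  let ?N = "curve_part m n c"
  show ?thesis
  proof (intro exI[of _ "4 * K + sum C I"] conjI allI impI)
    show "0 \<le> 4 * K + sum C I" using K C by (intro add_nonneg_nonneg sum_nonneg) auto
    fix u :: "complex \<times> complex \<Rightarrow> real" and B
    assume "u \<in> borel_measurable \<sigma>2" "\<forall>\<zeta>\<in>space \<sigma>2. 0 \<le> u \<zeta> \<and> u \<zeta> \<le> B"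
    then have u: "u \<in> borel_measurable torus_borel" "\<forall>\<zeta>\<in>torus. 0 \<le> u \<zeta> \<and> u \<zeta> \<le> B"
      by (simp_all only: s2.measurable_eq s2.space_eq)
    have i1: "integrable \<sigma>1 u" by (rule s1.integrable_bounded[where B = B]) (use u in auto)
    have int: "integrable \<sigma>1 (\<lambda>\<zeta>. indicator A \<zeta> * u \<zeta>)" if "A \<in> sets torus_borel" for A
      using integrable_mult_indicator[OF _ i1, of A] that s1.sets_eq by simp
    have Li: "fibre (fst i) (snd i) \<in> sets torus_borel" if "i \<in> I" for i
      using that by (intro fibre_sets) (auto simp: I_def)
    have int_sum: "integrable \<sigma>1 (\<lambda>\<zeta>. \<Sum>i\<in>I. indicator (fibre (fst i) (snd i)) \<zeta> * u \<zeta>)"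
      by (intro Bochner_Integration.integrable_sum int Li)
    have "(\<integral>\<zeta>. u \<zeta> \<partial>\<sigma>1) \<le>
        (\<integral>\<zeta>. indicator ?N \<zeta> * u \<zeta> + (\<Sum>i\<in>I. indicator (fibre (fst i) (snd i)) \<zeta> * u \<zeta>) \<partial>\<sigma>1)"
    proof (rule integral_mono_AE[OF i1])
      show "integrable \<sigma>1 (\<lambda>\<zeta>. indicator ?N \<zeta> * u \<zeta> + (\<Sum>i\<in>I. indicator (fibre (fst i) (snd i)) \<zeta> * u \<zeta>))"
        by (intro Bochner_Integration.integrable_add int_sum int curve_part_sets)
      show "AE \<zeta> in \<sigma>1. u \<zeta> \<le> indicator ?N \<zeta> * u \<zeta> + (\<Sum>i\<in>I. indicator (fibre (fst i) (snd i)) \<zeta> * u \<zeta>)"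
        using AE AE_space
      proof eventually_elim
        case (elim \<zeta>)
        then have z: "\<zeta> \<in> torus" by (simp only: s1.space_eq)
        have u0: "0 \<le> u \<zeta>" using u(2) z by blast
        have nn: "0 \<le> indicator (fibre (fst i) (snd i)) \<zeta> * u \<zeta>" for i :: "(complex \<times> complex \<Rightarrow> complex) \<times> complex"
          using u0 by simp
        show ?case
        proof (cases "\<zeta> \<in> ?N")
          case True
          moreover have "0 \<le> (\<Sum>i\<in>I. indicator (fibre (fst i) (snd i)) \<zeta> * u \<zeta>)"
            by (rule sum_nonneg) (rule nn)
          ultimately show ?thesis by simp
        next
          case False
          have unit: "cmod (fst \<zeta>) = 1" "cmod (snd \<zeta>) = 1" using z by auto
          have "bipoly m n c (0, snd \<zeta>) = 0 \<or> bipoly m n c (fst \<zeta>, 0) = 0"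
            using False elim(1) z unfolding curve_part_def by blast
          then obtain i where i: "i \<in> I" "\<zeta> \<in> fibre (fst i) (snd i)"
          proof
            assume "bipoly m n c (0, snd \<zeta>) = 0"
            then show ?thesis using that[of "(snd, snd \<zeta>)"] unit z by (simp add: I_def fibre_def)
          next
            assume "bipoly m n c (fst \<zeta>, 0) = 0"
            then show ?thesis using that[of "(fst, fst \<zeta>)"] unit z by (simp add: I_def fibre_def)
          qed
          have "u \<zeta> = indicator (fibre (fst i) (snd i)) \<zeta> * u \<zeta>" using i(2) by simp
          also have "\<dots> \<le> (\<Sum>i\<in>I. indicator (fibre (fst i) (snd i)) \<zeta> * u \<zeta>)"
            by (rule member_le_sum[OF i(1) _ I]) (rule nn)
          finally show ?thesis using False by simp
        qed
      qed
    qed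
    also have "\<dots> = (\<integral>\<zeta>. indicator ?N \<zeta> * u \<zeta> \<partial>\<sigma>1) + (\<Sum>i\<in>I. \<integral>\<zeta>. indicator (fibre (fst i) (snd i)) \<zeta> * u \<zeta> \<partial>\<sigma>1)"
      using int[OF curve_part_sets] int_sum int[OF Li]
      by (simp add: Bochner_Integration.integral_sum)
    also have "\<dots> \<le> 4 * K * sqrt (\<integral>\<zeta>. (u \<zeta>)\<^sup>2 \<partial>\<sigma>2) + (\<Sum>i\<in>I. C i * sqrt (\<integral>\<zeta>. (u \<zeta>)\<^sup>2 \<partial>\<sigma>2))"
      by (intro add_mono sum_mono curve_bound[OF nz u] C_bound[OF _ u])
    also have "\<dots> = (4 * K + sum C I) * sqrt (\<integral>\<zeta>. (u \<zeta>)\<^sup>2 \<partial>\<sigma>2)"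
      by (simp add: sum_distrib_right algebra_simps)
    finally show "(\<integral>\<zeta>. u \<zeta> \<partial>\<sigma>1) \<le> (4 * K + sum C I) * sqrt (\<integral>\<zeta>. (u \<zeta>)\<^sup>2 \<partial>\<sigma>2)" .
  qed
qed

end

section \<open>From the density to the kernel estimate\<close>

lemma kernel_bound_of_square_integrable:
  assumes "torus_measure \<sigma>1" "torus_measure \<sigma>2" and w: "w \<in> bidisc" and C: "0 \<le> C"
    and bd: "\<And>u B. u \<in> borel_measurable \<sigma>2 \<Longrightarrow> (\<forall>\<zeta>\<in>space \<sigma>2. 0 \<le> u \<zeta> \<and> u \<zeta> \<le> B) \<Longrightarrow>
      (\<integral>\<zeta>. u \<zeta> \<partial>\<sigma>1) \<le> C * sqrt (\<integral>\<zeta>. (u \<zeta>)\<^sup>2 \<partial>\<sigma>2)"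
  shows "\<exists>K\<ge>0. \<forall>xs. snd ` set xs \<subseteq> bidisc \<longrightarrow>
      cmod (\<integral>\<zeta>. cauchy_sum xs \<zeta> * cnj (cauchy_kernel \<zeta> w) \<partial>\<sigma>1) \<le> K * sqrt (\<integral>\<zeta>. (cmod (cauchy_sum xs \<zeta>))\<^sup>2 \<partial>\<sigma>2)"
proof -
  interpret s1: torus_measure \<sigma>1 by fact
  interpret s2: torus_measure \<sigma>2 by fact
  obtain D where D: "\<forall>\<zeta>\<in>torus. cmod (cauchy_kernel \<zeta> w) \<le> D" using cauchy_kernel_torus[OF w] by blast
  \<comment> \<open>The point (1, 1) serves only to see that \<open>D\<close> is
    nonnegative.\<close>
  have "cmod (cauchy_kernel (1, 1) w) \<le> D" using D by simp
  then have D0: "0 \<le> D" by (rule order_trans[OF norm_ge_zero])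
  show ?thesis
  proof (intro exI[of _ "D * C"] conjI allI impI)
    show "0 \<le> D * C" using D0 C by simp
    fix xs :: "(complex \<times> (complex \<times> complex)) list" assume xs: "snd ` set xs \<subseteq> bidisc"
    obtain B where B: "\<forall>\<zeta>\<in>torus. cmod (cauchy_sum xs \<zeta>) \<le> B" using cauchy_sum_torus[OF xs] by blast
    have m: "cauchy_sum xs \<in> borel_measurable torus_borel" by (rule cauchy_sum_torus[OF xs])
    have mc: "(\<lambda>\<zeta>. cmod (cauchy_sum xs \<zeta>)) \<in> borel_measurable torus_borel" using m by measurable
    have i: "integrable \<sigma>1 (\<lambda>\<zeta>. cmod (cauchy_sum xs \<zeta>))"
      by (rule s1.integrable_bounded[where B = B]) (use B mc in auto)
    have "cmod (\<integral>\<zeta>. cauchy_sum xs \<zeta> * cnj (cauchy_kernel \<zeta> w) \<partial>\<sigma>1)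
        \<le> (\<integral>\<zeta>. cmod (cauchy_sum xs \<zeta> * cnj (cauchy_kernel \<zeta> w)) \<partial>\<sigma>1)"
      by (rule integral_norm_bound)
    also have "\<dots> \<le> (\<integral>\<zeta>. D * cmod (cauchy_sum xs \<zeta>) \<partial>\<sigma>1)"
    proof (rule integral_mono_AE')
      show "integrable \<sigma>1 (\<lambda>\<zeta>. D * cmod (cauchy_sum xs \<zeta>))" using i by simp
      show "AE \<zeta> in \<sigma>1. cmod (cauchy_sum xs \<zeta> * cnj (cauchy_kernel \<zeta> w)) \<le> D * cmod (cauchy_sum xs \<zeta>)"
      proof (rule AE_I2)
        fix \<zeta> assume "\<zeta> \<in> space \<sigma>1"
        then have "cmod (cauchy_kernel \<zeta> w) \<le> D" using D by (simp only: s1.space_eq)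
        then show "cmod (cauchy_sum xs \<zeta> * cnj (cauchy_kernel \<zeta> w)) \<le> D * cmod (cauchy_sum xs \<zeta>)"
          unfolding norm_mult complex_mod_cnj by (subst mult.commute) (rule mult_right_mono, auto)
      qed
    qed (use D0 in simp)
    also have "\<dots> = D * (\<integral>\<zeta>. cmod (cauchy_sum xs \<zeta>) \<partial>\<sigma>1)" by simp
    also have "\<dots> \<le> D * (C * sqrt (\<integral>\<zeta>. (cmod (cauchy_sum xs \<zeta>))\<^sup>2 \<partial>\<sigma>2))"
    proof (intro mult_left_mono D0 bd)
      show "(\<lambda>\<zeta>. cmod (cauchy_sum xs \<zeta>)) \<in> borel_measurable \<sigma>2" unfolding s2.measurable_eq by (rule mc)
      show "\<forall>\<zeta>\<in>space \<sigma>2. 0 \<le> cmod (cauchy_sum xs \<zeta>) \<and> cmod (cauchy_sum xs \<zeta>) \<le> B"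
        using B by (simp only: s2.space_eq) simp
    qed
    finally show "cmod (\<integral>\<zeta>. cauchy_sum xs \<zeta> * cnj (cauchy_kernel \<zeta> w) \<partial>\<sigma>1)
        \<le> D * C * sqrt (\<integral>\<zeta>. (cmod (cauchy_sum xs \<zeta>))\<^sup>2 \<partial>\<sigma>2)" by (simp only: mult.assoc)
  qed
qed

section \<open>The carrier of the component \<mu>0\<close>

lemma carriesD: "carries M B \<mu> \<Longrightarrow> A \<in> sets M \<Longrightarrow> \<mu> A = \<mu> (A \<inter> B)"
  unfolding carries_def by blast

text \<open>Mutual singularity makes \<open>\<mu>0\<close> the restriction of the positive measure
  \<sigma> to \<open>A0\<close>. Vanishing of \<open>\<mu>0\<close> on lines therefore becomes a
  null set statement for \<sigma>, and the carrier can be checked almost everywhere.\<close>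

lemma (in torus_measure) curve_part_carries_component0:
  assumes nz: "\<And>z. z \<in> bidisc \<Longrightarrow> bipoly m n c z \<noteq> 0"
    and AE: "AE \<zeta> in \<sigma>. bipoly m n c \<zeta> = 0"
    and dec: "RP_decomposition (cm_of \<sigma>) \<mu>0 \<mu>1 \<mu>2"
  shows "carries torus_borel (curve_part m n c) \<mu>0"
proof -
  let ?N = "curve_part m n c"
  have sum: "cm_of \<sigma> S = \<mu>0 S + \<mu>1 S + \<mu>2 S" if "S \<in> sets torus_borel" for S
    using dec that by (simp add: RP_decomposition_def)
  obtain A1 B1 A2 B2 where A: "A1 \<inter> B1 = {}" "carries torus_borel A1 \<mu>0" "carries torus_borel B1 \<mu>1"
    "A2 \<inter> B2 = {}" "carries torus_borel A2 \<mu>0" "carries torus_borel B2 \<mu>2"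
    using dec unfolding RP_decomposition_def mutually_singular_def by blast
  have empty: "\<mu>1 {} = 0" "\<mu>2 {} = 0"
    using dec by (auto simp: RP_decomposition_def RP_def complex_measure_def)
  have sets: "A1 \<in> sets torus_borel" "A2 \<in> sets torus_borel" using A by (auto simp: carries_def)
  define A0 where "A0 = A1 \<inter> A2"
  have A0: "A0 \<in> sets torus_borel" using sets by (simp add: A0_def)
  have eq: "\<mu>0 S = cm_of \<sigma> (S \<inter> A0)" if S: "S \<in> sets torus_borel" for S
  proof -
    have SA: "S \<inter> A0 \<in> sets torus_borel" using S A0 by blast
    have "\<mu>1 (S \<inter> A0) = \<mu>1 (S \<inter> A0 \<inter> B1)" "\<mu>2 (S \<inter> A0) = \<mu>2 (S \<inter> A0 \<inter> B2)"
      by (rule carriesD[OF A(3) SA], rule carriesD[OF A(6) SA])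
    moreover have "S \<inter> A0 \<inter> B1 = {}" "S \<inter> A0 \<inter> B2 = {}" using A by (auto simp: A0_def)
    moreover have "\<mu>0 S = \<mu>0 (S \<inter> A0)"
      using carriesD[OF A(2) S] carriesD[OF A(5) sets.Int[OF S sets(1)]] by (simp only: A0_def Int_assoc)
    ultimately show ?thesis using sum[OF SA] empty by simp
  qed
  obtain \<nu>0 \<rho> where \<nu>: "representing_measure_0 \<rho>" "cm_absolutely_continuous \<nu>0 \<rho>"
    "\<And>S. S \<in> sets torus_borel \<Longrightarrow> \<mu>0 S = cm_density torus_borel (\<lambda>\<zeta>. cnj (fst \<zeta>) * snd \<zeta>)
             (cm_pushforward torus_borel conj_snd \<nu>0) S"
    using dec unfolding RP_decomposition_def by blast
  have fibre_null: "fibre \<phi> a \<inter> A0 \<in> null_sets \<sigma>" if "\<phi> = fst \<or> \<phi> = snd" "cmod a = 1" for \<phi> a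
  proof -
    have S: "fibre \<phi> a \<inter> A0 \<in> sets torus_borel" using fibre_sets[OF that(1)] A0 by blast
    have "\<mu>0 (fibre \<phi> a \<inter> A0) = 0"
      unfolding \<nu>(3)[OF S]
      by (rule component0_fibre_null[OF \<nu>(2,1) that S]) (auto simp: fibre_def)
    then have "measure \<sigma> (fibre \<phi> a \<inter> A0) = 0"
      using eq[OF S] by (simp add: cm_of_def Int_assoc)
    then show ?thesis using S sets_eq by (auto simp: emeasure_eq_measure)
  qed
  define I where "I = {fst} \<times> {a. cmod a = 1 \<and> bipoly m n c (a, 0) = 0} \<union>
    {snd :: complex \<times> complex \<Rightarrow> complex} \<times> {b. cmod b = 1 \<and> bipoly m n c (0, b) = 0}"
  have "bipoly m n c (0, 0) \<noteq> 0" by (rule nz) simp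
  note fin = finite_bipoly_zeros[OF this]
  have I: "finite I"
    unfolding I_def
    by (intro finite_UnI finite_cartesian_product finite_subset[OF _ fin(1)] finite_subset[OF _ fin(2)]) auto
  have "AE \<zeta> in \<sigma>. \<forall>i\<in>I. \<zeta> \<notin> fibre (fst i) (snd i) \<inter> A0"
    using I by (intro AE_finite_allI AE_not_in fibre_null) (auto simp: I_def)
  then have AE_N: "AE \<zeta> in \<sigma>. \<zeta> \<in> A0 \<longrightarrow> \<zeta> \<in> ?N"
    using AE AE_space
  proof eventually_elim
    case (elim \<zeta>)
    then have z: "\<zeta> \<in> torus" by (simp only: space_eq)
    have unit: "cmod (fst \<zeta>) = 1" "cmod (snd \<zeta>) = 1" using z by auto
    show ?case
    proof (rule impI, rule ccontr)
      assume "\<zeta> \<in> A0" "\<zeta> \<notin> ?N"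
      then have "bipoly m n c (0, snd \<zeta>) = 0 \<or> bipoly m n c (fst \<zeta>, 0) = 0"
        using elim(2) z unfolding curve_part_def by blast
      then have "(snd, snd \<zeta>) \<in> I \<or> (fst, fst \<zeta>) \<in> I" using unit unfolding I_def by blast
      moreover have "\<zeta> \<in> fibre snd (snd \<zeta>)" "\<zeta> \<in> fibre fst (fst \<zeta>)" using z by (auto simp: fibre_def)
      ultimately show False using bspec[OF elim(1)] \<open>\<zeta> \<in> A0\<close> by fastforce
    qed
  qed
  show ?thesis
    unfolding carries_def
  proof (intro conjI ballI curve_part_sets)
    fix S assume S: "S \<in> sets torus_borel"
    have SN: "S \<inter> ?N \<in> sets torus_borel" using S curve_part_sets by blast
    have "measure \<sigma> (S \<inter> A0) = measure \<sigma> (S \<inter> ?N \<inter> A0)"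
    proof (rule measure_eq_AE)
      show "AE x in \<sigma>. (x \<in> S \<inter> A0) = (x \<in> S \<inter> ?N \<inter> A0)" using AE_N by eventually_elim auto
      show "S \<inter> A0 \<in> sets \<sigma>" "S \<inter> ?N \<inter> A0 \<in> sets \<sigma>" using S SN A0 sets_eq by auto
    qed
    then show "\<mu>0 S = \<mu>0 (S \<inter> ?N)" by (simp add: eq[OF S] eq[OF SN] cm_of_def)
  qed
qed

theorem theorem5p2:
  fixes p :: "complex poly poly"
    and b1 :: "complex \<times> complex \<Rightarrow> complex"
    and \<alpha> :: complex
    and \<sigma>1 :: "(complex \<times> complex) measure"
  assumes p_nonzero: "\<forall>z\<in>bidisc. poly2 p z \<noteq> 0"
    and b1_eq: "b1 = (\<lambda>z. reflection p z / poly2 p z)"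
    and b1_nonconst: "\<not> b1 constant_on bidisc"
    and alpha: "cmod \<alpha> = 1"
    and sigma1: "is_clark_measure b1 \<alpha> \<sigma>1"
  shows "(\<forall>\<mu>0 \<mu>1 \<mu>2. RP_decomposition (cm_of \<sigma>1) \<mu>0 \<mu>1 \<mu>2 \<longrightarrow>
            (\<exists>N. annihilator_null_set N \<and> carries torus_borel N \<mu>0))
       \<and> (\<forall>b2 \<sigma>2 H ip.
            holomorphic2_on b2 bidisc \<longrightarrow> b2 ` bidisc \<subseteq> ball 0 1 \<longrightarrow> \<not> b2 constant_on bidisc \<longrightarrow>
            is_clark_measure b2 \<alpha> \<sigma>2 \<longrightarrow> is_dBR_space b2 H ip \<longrightarrow>
            ((absolutely_continuous \<sigma>2 \<sigma>1 \<and> (\<integral>\<^sup>+\<zeta>. (RN_deriv \<sigma>2 \<sigma>1 \<zeta>)\<^sup>2 \<partial>\<sigma>2) < \<infinity>)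
             \<longleftrightarrow> (\<forall>w\<in>bidisc. zero_extend bidisc
                   (\<lambda>z. (\<alpha> - b2 z) / (\<alpha> - b1 z) * dBR_kernel b1 z w) \<in> H))
          \<and> ((\<forall>w\<in>bidisc. zero_extend bidisc
                   (\<lambda>z. (\<alpha> - b2 z) / (\<alpha> - b1 z) * dBR_kernel b1 z w) \<in> H)
             \<longleftrightarrow> (\<exists>w\<in>bidisc. zero_extend bidisc
                   (\<lambda>z. (\<alpha> - b2 z) / (\<alpha> - b1 z) * dBR_kernel b1 z w) \<in> H)))"
proof -
  let ?m = "degree_z1 p" and ?n = "degree_z2 p"
  \<comment> \<open>The coefficients of the reflection minus \<alpha> times \<open>p\<close>. In the
    bidisc this polynomial equals \<open>- poly2 p z * (\<alpha> - b1 z)\<close> and is thus free of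
    zeros.\<close>
  define c where "c j k = cnj (coeff (coeff p (?n - k)) (?m - j)) - \<alpha> * coeff (coeff p k) j" for j k
  have c: "bipoly ?m ?n c z = reflection p z - \<alpha> * poly2 p z" for z
    by (simp add: reflection_bipoly poly2_bipoly bipoly_def c_def sum_subtractf sum_distrib_left algebra_simps)
  have nzp: "poly2 p (z, w) \<noteq> 0" if "z \<in> ball 0 1" "w \<in> ball 0 1" for z w
    using p_nonzero that by blast
  have hol1: "(\<lambda>z. b1 (z, w)) holomorphic_on ball 0 1" if "w \<in> ball 0 1" for w
    unfolding b1_eq using nzp[OF _ that] unfolding reflection_bipoly poly2_bipoly
    by (intro holomorphic_on_divide holomorphic_bipoly_slices)
  have hol2: "(\<lambda>w. b1 (z, w)) holomorphic_on ball 0 1" if "z \<in> ball 0 1" for z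
    unfolding b1_eq using nzp[OF that] unfolding reflection_bipoly poly2_bipoly
    by (intro holomorphic_on_divide holomorphic_bipoly_slices)
  \<comment> \<open>The strict bound on \<open>b1\<close> is drawn from the Clark measure and
    non-constancy, not from the algebra of the reflection.\<close>
  have less: "cmod (b1 z) < 1" if "z \<in> bidisc" for z
    by (rule clark_measure_norm_less[OF alpha sigma1 hol1 hol2 b1_nonconst that])
  interpret s1: clark_measure b1 \<alpha> \<sigma>1
    by unfold_locales (fact alpha hol1 hol2 less sigma1)+
  have nz: "bipoly ?m ?n c z \<noteq> 0" if z: "z \<in> bidisc" for z
  proof -
    have p: "poly2 p z \<noteq> 0" using p_nonzero z by blast
    have "bipoly ?m ?n c z = - (poly2 p z * (\<alpha> - b1 z))"
      using p by (simp add: c b1_eq field_simps)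
    then show ?thesis using p s1.alpha_neq[OF z] by simp
  qed
  have "AE \<zeta> in \<sigma>1. reflection p \<zeta> - \<alpha> * poly2 p \<zeta> = 0"
  proof (rule s1.AE_boundary_equation)
    show "continuous_on (cball 0 1 \<times> cball 0 1) (poly2 p)" "continuous_on (cball 0 1 \<times> cball 0 1) (reflection p)"
      unfolding poly2_bipoly reflection_bipoly by (intro continuous_intros)+
  qed (use p_nonzero norm_reflection_torus b1_eq in auto)
  then have AE: "AE \<zeta> in \<sigma>1. bipoly ?m ?n c \<zeta> = 0" by (simp only: c)
  show ?thesis
  proof (intro conjI allI impI)
    fix \<mu>0 \<mu>1 \<mu>2 assume "RP_decomposition (cm_of \<sigma>1) \<mu>0 \<mu>1 \<mu>2"
    then show "\<exists>N. annihilator_null_set N \<and> carries torus_borel N \<mu>0"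
      using annihilator_null_curve_part[OF nz] s1.curve_part_carries_component0[OF nz AE] by blast
  next
    fix b2 \<sigma>2 H ip
    assume b2: "holomorphic2_on b2 bidisc" "b2 ` bidisc \<subseteq> ball 0 1" "is_clark_measure b2 \<alpha> \<sigma>2"
      and H: "is_dBR_space b2 H ip"
    let ?mem = "\<lambda>w. zero_extend bidisc (\<lambda>z. (\<alpha> - b2 z) / (\<alpha> - b1 z) * dBR_kernel b1 z w) \<in> H"
    let ?i = "absolutely_continuous \<sigma>2 \<sigma>1 \<and> (\<integral>\<^sup>+\<zeta>. (RN_deriv \<sigma>2 \<sigma>1 \<zeta>)\<^sup>2 \<partial>\<sigma>2) < \<infinity>"
    interpret s2: clark_measure b2 \<alpha> \<sigma>2
    proof
      show "cmod (b2 z) < 1" if "z \<in> bidisc" for z using b2(2) that by fastforce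
    qed (use alpha b2 holomorphic2_on_slices[OF b2(1)] in auto)
    note mem_iff = dBR_mem_iff[OF s1.clark_measure_axioms s2.clark_measure_axioms H]
    have "sets \<sigma>1 = sets \<sigma>2" using s1.sets_eq s2.sets_eq by simp
    note i_iff = RN_deriv_square_integrable_iff[OF s1.finite_measure_axioms s2.finite_measure_axioms this]
    have i_ii: "?mem w" if ?i and w: "w \<in> bidisc" for w
    proof -
      obtain C where "0 \<le> C" and "\<And>u B. u \<in> borel_measurable \<sigma>2 \<Longrightarrow>
          (\<forall>\<zeta>\<in>space \<sigma>2. 0 \<le> u \<zeta> \<and> u \<zeta> \<le> B) \<Longrightarrow> (\<integral>\<zeta>. u \<zeta> \<partial>\<sigma>1) \<le> C * sqrt (\<integral>\<zeta>. (u \<zeta>)\<^sup>2 \<partial>\<sigma>2)"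
        using \<open>?i\<close> unfolding i_iff by blast
      then show ?thesis
        unfolding mem_iff[OF w]
        by (rule kernel_bound_of_square_integrable[OF s1.torus_measure_axioms s2.torus_measure_axioms w])
    qed
    \<comment> \<open>Membership at one point already yields (i), and (i) yields membership at every
      point by \<open>i_ii\<close>; the origin supplies the point needed to pass from (ii) to
      (iii).\<close>
    have iii_i: ?i if w: "w \<in> bidisc" and "?mem w" for w
    proof -
      obtain K where "0 \<le> K" and K: "\<And>xs. snd ` set xs \<subseteq> bidisc \<Longrightarrow>
          cmod (\<integral>\<zeta>. cauchy_sum xs \<zeta> * cnj (cauchy_kernel \<zeta> w) \<partial>\<sigma>1) \<le> K * sqrt (\<integral>\<zeta>. (cmod (cauchy_sum xs \<zeta>))\<^sup>2 \<partial>\<sigma>2)"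
        using \<open>?mem w\<close> unfolding mem_iff[OF w] by blast
      interpret clark_pair b1 b2 \<alpha> \<sigma>1 \<sigma>2 w K
      proof unfold_locales
        show "cmod (\<integral>\<zeta>. f \<zeta> * cnj (cauchy_kernel \<zeta> w) \<partial>\<sigma>1) \<le> K * sqrt (\<integral>\<zeta>. (cmod (f \<zeta>))\<^sup>2 \<partial>\<sigma>2)"
          if "f \<in> bp_cauchy" for f
          by (rule bp_cauchy_bound[OF s1.torus_measure_axioms s2.torus_measure_axioms w K that])
      qed (fact w \<open>0 \<le> K\<close>)+
      show ?thesis unfolding i_iff by (rule square_integrable_bound[OF nz AE])
    qed
    have o: "(0, 0) \<in> bidisc" by simp
    show "?i \<longleftrightarrow> (\<forall>w\<in>bidisc. ?mem w)"
    proof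
      assume ?i
      then show "\<forall>w\<in>bidisc. ?mem w" by (intro ballI i_ii)
    next
      assume "\<forall>w\<in>bidisc. ?mem w"
      from bspec[OF this o] show ?i by (rule iii_i[OF o])
    qed
    show "(\<forall>w\<in>bidisc. ?mem w) \<longleftrightarrow> (\<exists>w\<in>bidisc. ?mem w)"
    proof
      assume "\<forall>w\<in>bidisc. ?mem w"
      from bspec[OF this o] show "\<exists>w\<in>bidisc. ?mem w" by (rule bexI[OF _ o])
    next
      assume "\<exists>w\<in>bidisc. ?mem w"
      then obtain w where w: "w \<in> bidisc" "?mem w" by (rule bexE)
      have ?i by (rule iii_i[OF w])
      then show "\<forall>w\<in>bidisc. ?mem w" by (intro ballI i_ii)
    qed
  qed
qed

end
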